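(* Consider the case of state-independent material parameters, a time step $\tau>0$ and time index $n\ge1$, and let $\varphi_h^{n-1}\in\mathcal V_h^{\mathrm{ch}}$, $\mathbf u_h^{n-1}\in\mathcal V_h^{\mathbf u}$, $\theta_h^{n-1}\in\mathcal V_h^{\mathrm f}$ be given. Then solving the discrete problem (D) find $\varphi_h^n,\mu_h^n\in\mathcal V_h^{\mathrm{ch}}$, $\mathbf u_h^n\in\mathcal V_h^{\mathbf u}$, $\theta_h^n,p_h^n\in\mathcal V_h^{\mathrm f}$ such that for all $\eta_h^\varphi,\eta_h^\mu\in\mathcal V_h^{\mathrm{ch}}$, $\boldsymbol\eta_h\in\mathcal V_h^{\mathbf u}$, $\eta_h^\theta,\eta_h^p\in\mathcal V_h^{\mathrm f}$ $$\begin{aligned} &(\varphi_h^n-\varphi_h^{n-1},\eta_h^\varphi)+\tau(m\nabla\mu_h^n,\nabla\eta_h^\varphi)-\tau(R,\eta_h^\varphi)=0,\\ &(\mu_h^n,\eta_h^\mu)-\gamma\Big(\ell(\nabla\varphi_h^n,\nabla\eta_h^\mu)+\tfrac1\ell(\Psi_c'(\varphi_h^n)-\Psi_e'(\varphi_h^{n-1}),\eta_h^\mu)\Big)+(\mathcal T'(\varphi_h^n):\mathbb C(\boldsymbol\varepsilon(\mathbf u_h^n)-\mathcal T(\varphi_h^n)),\eta_h^\mu)=0,\\ &(\mathbb C(\boldsymbol\varepsilon(\mathbf u_h^n)-\mathcal T(\varphi_h^n)),\boldsymbol\varepsilon(\boldsymbol\eta_h))-(\alpha M(\theta_h^n-\alpha\nabla\cdot\mathbf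 u_h^n),\nabla\cdot\boldsymbol\eta_h)-(\mathbf f,\boldsymbol\eta_h)=0,\\ &(\theta_h^n-\theta_h^{n-1},\eta_h^\theta)+\tau(\kappa\nabla p_h^n,\nabla\eta_h^\theta)-\tau(S_{\mathrm f},\eta_h^\theta)=0,\\ &(p_h^n,\eta_h^p)-(M(\theta_h^n-\alpha\nabla\cdot\mathbf u_h^n),\eta_h^p)=0 \end{aligned}$$ is equivalent to solving the minimization problem (M) $\displaystyle(\varphi_h^n,\mathbf u_h^n,\theta_h^n)=\operatorname*{arg\,min}_{\varphi_h\in\bar{\mathcal V}_h^{\mathrm{ch},n},\,\mathbf u_h\in\mathcal V_h^{\mathbf u},\,\theta_h\in\bar{\mathcal V}_h^{\mathrm f,n}}\mathcal H_\tau^n(\varphi_h,\mathbf u_h,\theta_h)$ with the potential $$\mathcal H_\tau^n(\varphi_h,\mathbf u_h,\theta_h)=\frac{\|\varphi_h-\varphi_h^{n-1}-\tau R\|^2_{\mathcal V_{h,m}^{\mathrm{ch},'}}}{2\tau}+\mathcal E_{\mathrm c}(\varphi_h,\boldsymbol\varepsilon(\mathbf u_h),\theta_h)+\frac{\|\theta_h-\theta_h^{n-1}-\tau S_{\mathrm f}\|^2_{\mathcal V_{h,\kappa}^{\mathrm f,'}}}{2\tau}-\frac\gamma\ell(\Psi_e'(\varphi_h^{n-1}),\varphi_h)-(\mathbf f,\mathbf u_h)$$ and the convex energy $$\mathcal E_{\mathrm c}(\varphi_h,\boldsymbol\varepsilon(\mathbf u_h),\theta_h)=\int_\Omega\frac{\gamma\ell}2|\nabla\varphi_h|^2+\frac12(\boldsymbol\varepsilon(\mathbf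 u_h)-\mathcal T(\varphi_h)):\mathbb C(\boldsymbol\varepsilon(\mathbf u_h)-\mathcal T(\varphi_h))+\frac M2(\theta_h-\alpha\nabla\cdot\mathbf u_h)^2\,dx+\frac\gamma\ell\int_\Omega\Psi_c(\varphi_h)\,dx;$$ that is, $(\varphi_h^n,\mathbf u_h^n,\theta_h^n)$ solves (M) if and only if there exist $\mu_h^n\in\mathcal V_h^{\mathrm{ch}}$, $p_h^n\in\mathcal V_h^{\mathrm f}$ such that $(\varphi_h^n,\mu_h^n,\mathbf u_h^n,\theta_h^n,p_h^n)$ solves (D).
   Context: Setting. $\Omega\subset\mathbb R^d$, $d\in\{2,3\}$, is a domain with Lipschitz continuous boundary; $(\cdot,\cdot)$ and $\|\cdot\|$ denote $L^2(\Omega)$ inner products and norms (scalar, vector or tensor valued); $\boldsymbol\varepsilon(\mathbf u)=\frac12(\nabla\mathbf u+\nabla\mathbf u^T)$. $\gamma,\ell>0$ are constants. $\mathcal V_h^{\mathrm{ch}}\subseteq H^1(\Omega)$, $\mathcal V_h^{\mathbf u}\subseteq (H_0^1(\Omega))^d$, $\mathcal V_h^{\mathrm f}\subseteq H^1(\Omega)$ are conforming finite element spaces with mesh diameter $h$. Assumptions. (A1) $\Psi:\mathbb R\to\mathbb R$, $\Psi\ge0$, $\Psi=\Psi_c-\Psi_e$ with $\Psi_c,\Psi_e$ convex and differentiable, and $\Psi_c'$ Lipschitz. (A2) $m,\kappa,M$ are positive constants and $\alpha$ is a constant with $0<\alpha\le1$. (A3) $\mathbb C$ is a constant symmetric positive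 definite fourth-order stiffness tensor (with the usual symmetries of linear elasticity) with $c_{\mathbb C}|\boldsymbol\varepsilon|^2\le\boldsymbol\varepsilon:\mathbb C\boldsymbol\varepsilon\le C_{\mathbb C}|\boldsymbol\varepsilon|^2$ for all $\boldsymbol\varepsilon\in\mathbb R^{d\times d}_{\mathrm{sym}}$, $c_{\mathbb C},C_{\mathbb C}>0$. (A4) The eigenstrain $\mathcal T$ (symmetric-matrix-valued function of $\varphi$, applied pointwise) is Lipschitz continuous, differentiable, and satisfies $c_{\mathcal T}\|\varphi\|_{L^2(\Omega)}\le\|\mathcal T(\varphi)\|_{L^2(\Omega)^{d\times d}}\le C_{\mathcal T}\|\varphi\|_{L^2(\Omega)}$ for all $\varphi\in L^2(\Omega)$, with $c_{\mathcal T},C_{\mathcal T}>0$. (A5) $R,S_{\mathrm f}\in L^2(\Omega)$, $\mathbf f\in (L^2(\Omega))^d$, independent of time. Dual norms. For $(y,\mathrm z)\in\{(m,\mathrm{ch}),(\kappa,\mathrm f)\}$ let $\mathcal V_{h,0}^{\mathrm z}=\{\phi_h\in\mathcal V_h^{\mathrm z}:\int_\Omega\phi_h\,dx=0\}$ with norm $\|\phi_h\|_{h,y}=\|y^{1/2}\nabla\phi_h\|$, and let $\mathcal V_{h,y}^{\mathrm z,'}$ be the dual space of $(\mathcal V_{h,0}^{\mathrm z},\|\cdot\|_{h,y})$ with dual norm $\|s\|_{\mathcal V_{h,y}^{\mathrm z,'}}=\sup\{\langle s,l_h\rangle/\|l_h\|_{h,y}: l_h\in\mathcal V_{h,0}^{\mathrm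 z},\|l_h\|_{h,y}\ne0\}$; $L^2$ functions are identified with functionals via the $L^2$ inner product. Affine spaces. $\bar{\mathcal V}_h^{\mathrm{ch},n}=\{\varphi_h\in\mathcal V_h^{\mathrm{ch}}:\int_\Omega\frac{\varphi_h-\varphi_h^{n-1}}\tau dx=\int_\Omega R\,dx\}$, $\bar{\mathcal V}_h^{\mathrm f,n}=\{\theta_h\in\mathcal V_h^{\mathrm f}:\int_\Omega\frac{\theta_h-\theta_h^{n-1}}\tau dx=\int_\Omega S_{\mathrm f}\,dx\}$.
   Formalization: Convexity of the energy E_c on the discrete spaces is an explicit hypothesis, since (A1)-(A5) do not imply it for nonlinear eigenstrain and (D)⇒(M) can then fail; the scalar finite element spaces are taken to contain the constants. *)

theory Defs
  imports "HOL-Analysis.Analysis"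
begin

text \<open>Elements of Lebesgue and Sobolev spaces are represented by functions on the whole of
  \<open>real ^ 'd\<close>; only their values on \<open>\<Omega>\<close>, up to null sets, enter the norms, the inner products and
  the gradients below.\<close>

section \<open>Lipschitz domains\<close>

text \<open>Near every boundary point, \<open>\<Omega>\<close> is the region strictly above the graph, in some direction \<open>e\<close>,
  of a Lipschitz function \<open>g\<close> of the coordinates orthogonal to \<open>e\<close>.\<close>

definition lipschitz_boundary :: "(real ^ 'd) set \<Rightarrow> bool" where
  "lipschitz_boundary \<Omega> \<longleftrightarrow>
    (\<forall>x\<in>frontier \<Omega>. \<exists>e g r L. norm e = 1 \<and> r > 0 \<and> L-lipschitz_on UNIV g \<and>
      \<Omega> \<inter> ball x r = {y \<in> ball x r. y \<bullet> e > (g (y - (y \<bullet> e) *\<^sub>R e) :: real)})"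

definition lipschitz_domain :: "(real ^ 'd) set \<Rightarrow> bool" where
  "lipschitz_domain \<Omega> \<longleftrightarrow>
    open \<Omega> \<and> connected \<Omega> \<and> \<Omega> \<noteq> {} \<and> bounded \<Omega> \<and> lipschitz_boundary \<Omega>"

section \<open>The spaces L2, H1 and H10\<close>

definition L2 :: "(real ^ 'd) set \<Rightarrow> (real ^ 'd \<Rightarrow> 'b::euclidean_space) set" where
  "L2 \<Omega> = {f. f \<in> borel_measurable (lebesgue_on \<Omega>) \<and>
              integrable (lebesgue_on \<Omega>) (\<lambda>x. (norm (f x))\<^sup>2)}"

text \<open>On \<open>real ^ 'd ^ 'd\<close> the library inner product is the Frobenius product \<open>A : B\<close>.\<close>

definition l2_inner ::
  "(real ^ 'd) set \<Rightarrow> (real ^ 'd \<Rightarrow> 'b::euclidean_space) \<Rightarrow> (real ^ 'd \<Rightarrow> 'b) \<Rightarrow> real" where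
  "l2_inner \<Omega> f g = (LINT x|lebesgue_on \<Omega>. f x \<bullet> g x)"

definition l2_norm :: "(real ^ 'd) set \<Rightarrow> (real ^ 'd \<Rightarrow> 'b::euclidean_space) \<Rightarrow> real" where
  "l2_norm \<Omega> f = sqrt (l2_inner \<Omega> f f)"

definition partial_deriv :: "'d \<Rightarrow> (real ^ 'd \<Rightarrow> real) \<Rightarrow> real ^ 'd \<Rightarrow> real" where
  "partial_deriv i f x = deriv (\<lambda>t. f (x + t *\<^sub>R axis i 1)) 0"

primrec Ck :: "nat \<Rightarrow> (real ^ 'd \<Rightarrow> real) \<Rightarrow> bool" where
  "Ck 0 f \<longleftrightarrow> continuous_on UNIV f"
| "Ck (Suc k) f \<longleftrightarrow> f differentiable_on UNIV \<and> (\<forall>i. Ck k (partial_deriv i f))"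

definition test_functions :: "(real ^ 'd) set \<Rightarrow> (real ^ 'd \<Rightarrow> real) set" where
  "test_functions \<Omega> = {\<psi>. (\<forall>k. Ck k \<psi>) \<and> compact (closure {x. \<psi> x \<noteq> 0}) \<and>
                            closure {x. \<psi> x \<noteq> 0} \<subseteq> \<Omega>}"

definition is_weak_gradient ::
  "(real ^ 'd) set \<Rightarrow> (real ^ 'd \<Rightarrow> real) \<Rightarrow> (real ^ 'd \<Rightarrow> real ^ 'd) \<Rightarrow> bool" where
  "is_weak_gradient \<Omega> f g \<longleftrightarrow>
    (\<forall>\<psi>\<in>test_functions \<Omega>. \<forall>i.
      (LINT x|lebesgue_on \<Omega>. f x * partial_deriv i \<psi> x) = - (LINT x|lebesgue_on \<Omega>. g x $ i * \<psi> x))"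

definition H1 :: "(real ^ 'd) set \<Rightarrow> (real ^ 'd \<Rightarrow> real) set" where
  "H1 \<Omega> = {f \<in> L2 \<Omega>. \<exists>g\<in>L2 \<Omega>. is_weak_gradient \<Omega> f g}"

text \<open>The weak gradient is unique only almost everywhere on \<open>\<Omega>\<close>; \<open>grad\<close> picks a representative.\<close>

definition grad :: "(real ^ 'd) set \<Rightarrow> (real ^ 'd \<Rightarrow> real) \<Rightarrow> real ^ 'd \<Rightarrow> real ^ 'd" where
  "grad \<Omega> f = (SOME g. g \<in> L2 \<Omega> \<and> is_weak_gradient \<Omega> f g)"

definition h1_norm :: "(real ^ 'd) set \<Rightarrow> (real ^ 'd \<Rightarrow> real) \<Rightarrow> real" where
  "h1_norm \<Omega> f = sqrt ((l2_norm \<Omega> f)\<^sup>2 + (l2_norm \<Omega> (grad \<Omega> f))\<^sup>2)"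

definition H10 :: "(real ^ 'd) set \<Rightarrow> (real ^ 'd \<Rightarrow> real) set" where
  "H10 \<Omega> = {f \<in> H1 \<Omega>. \<forall>e>0. \<exists>\<psi>\<in>test_functions \<Omega>. h1_norm \<Omega> (\<lambda>x. f x - \<psi> x) < e}"

definition H10_vec :: "(real ^ 'd) set \<Rightarrow> (real ^ 'd \<Rightarrow> real ^ 'd) set" where
  "H10_vec \<Omega> = {u. \<forall>i. (\<lambda>x. u x $ i) \<in> H10 \<Omega>}"

definition vgrad :: "(real ^ 'd) set \<Rightarrow> (real ^ 'd \<Rightarrow> real ^ 'd) \<Rightarrow> real ^ 'd \<Rightarrow> real ^ 'd ^ 'd" where
  "vgrad \<Omega> u x = (\<chi> i. grad \<Omega> (\<lambda>y. u y $ i) x)"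

definition strain :: "(real ^ 'd) set \<Rightarrow> (real ^ 'd \<Rightarrow> real ^ 'd) \<Rightarrow> real ^ 'd \<Rightarrow> real ^ 'd ^ 'd" where
  "strain \<Omega> u x = (1/2) *\<^sub>R (vgrad \<Omega> u x + transpose (vgrad \<Omega> u x))"

definition dvg :: "(real ^ 'd) set \<Rightarrow> (real ^ 'd \<Rightarrow> real ^ 'd) \<Rightarrow> real ^ 'd \<Rightarrow> real" where
  "dvg \<Omega> u x = trace (vgrad \<Omega> u x)"

section \<open>Conforming discrete spaces\<close>

text \<open>No mesh, polynomial degree or mesh diameter is fixed: a conforming discrete space is any
  finite-dimensional subspace. A scalar space that carries no boundary condition also contains
  the constants.\<close>

definition fin_dim_space :: "('a \<Rightarrow> 'b::real_vector) set \<Rightarrow> bool" where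
  "fin_dim_space V \<longleftrightarrow> (\<exists>B. finite B \<and> V = {\<lambda>x. \<Sum>b\<in>B. c b *\<^sub>R b x |c. True})"

definition conforming_H1 :: "(real ^ 'd) set \<Rightarrow> (real ^ 'd \<Rightarrow> real) set \<Rightarrow> bool" where
  "conforming_H1 \<Omega> V \<longleftrightarrow> fin_dim_space V \<and> V \<subseteq> H1 \<Omega> \<and> (\<exists>v\<in>V. \<forall>x\<in>\<Omega>. v x = 1)"

definition conforming_H10_vec :: "(real ^ 'd) set \<Rightarrow> (real ^ 'd \<Rightarrow> real ^ 'd) set \<Rightarrow> bool" where
  "conforming_H10_vec \<Omega> V \<longleftrightarrow> fin_dim_space V \<and> V \<subseteq> H10_vec \<Omega>"

section \<open>Discrete dual norms and affine spaces\<close>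

definition mean_zero :: "(real ^ 'd) set \<Rightarrow> (real ^ 'd \<Rightarrow> real) set \<Rightarrow> (real ^ 'd \<Rightarrow> real) set" where
  "mean_zero \<Omega> V = {v \<in> V. (LINT x|lebesgue_on \<Omega>. v x) = 0}"

definition weighted_norm :: "(real ^ 'd) set \<Rightarrow> real \<Rightarrow> (real ^ 'd \<Rightarrow> real) \<Rightarrow> real" where
  "weighted_norm \<Omega> y v = l2_norm \<Omega> (\<lambda>x. sqrt y *\<^sub>R grad \<Omega> v x)"

text \<open>The inserted 0 matters only when there is no \<open>l\<close> with \<open>weighted_norm \<Omega> y l \<noteq> 0\<close>: the supremum
  of the empty set is unspecified in \<open>real\<close>, while the dual norm is then 0.\<close>

definition dual_norm ::
  "(real ^ 'd) set \<Rightarrow> real \<Rightarrow> (real ^ 'd \<Rightarrow> real) set \<Rightarrow> ((real ^ 'd \<Rightarrow> real) \<Rightarrow> real) \<Rightarrow> real" where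
  "dual_norm \<Omega> y V s =
    Sup (insert 0 {s l / weighted_norm \<Omega> y l |l. l \<in> mean_zero \<Omega> V \<and> weighted_norm \<Omega> y l \<noteq> 0})"

definition affine_space ::
  "(real ^ 'd) set \<Rightarrow> (real ^ 'd \<Rightarrow> real) set \<Rightarrow> real \<Rightarrow> (real ^ 'd \<Rightarrow> real) \<Rightarrow> (real ^ 'd \<Rightarrow> real)
    \<Rightarrow> (real ^ 'd \<Rightarrow> real) set" where
  "affine_space \<Omega> V \<tau> v_old S =
    {v \<in> V. (LINT x|lebesgue_on \<Omega>. (v x - v_old x) / \<tau>) = (LINT x|lebesgue_on \<Omega>. S x)}"

section \<open>Material laws and energies\<close>

definition tensor_apply :: "real ^ 'd ^ 'd ^ 'd ^ 'd \<Rightarrow> real ^ 'd ^ 'd \<Rightarrow> real ^ 'd ^ 'd" where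
  "tensor_apply C e = (\<chi> i j. \<Sum>k\<in>UNIV. \<Sum>l\<in>UNIV. C $ i $ j $ k $ l * e $ k $ l)"

definition elasticity_symmetries :: "real ^ 'd ^ 'd ^ 'd ^ 'd \<Rightarrow> bool" where
  "elasticity_symmetries C \<longleftrightarrow>
    (\<forall>i j k l. C $ i $ j $ k $ l = C $ j $ i $ k $ l \<and>
               C $ i $ j $ k $ l = C $ i $ j $ l $ k \<and>
               C $ i $ j $ k $ l = C $ k $ l $ i $ j)"

definition energy_c ::
  "(real ^ 'd) set \<Rightarrow> real \<Rightarrow> real \<Rightarrow> real \<Rightarrow> real \<Rightarrow> real ^ 'd ^ 'd ^ 'd ^ 'd
    \<Rightarrow> (real \<Rightarrow> real ^ 'd ^ 'd) \<Rightarrow> (real \<Rightarrow> real)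
    \<Rightarrow> (real ^ 'd \<Rightarrow> real) \<Rightarrow> (real ^ 'd \<Rightarrow> real ^ 'd) \<Rightarrow> (real ^ 'd \<Rightarrow> real) \<Rightarrow> real" where
  "energy_c \<Omega> \<gamma> ell M \<alpha> C T \<Psi>c \<phi> u \<theta> =
    (LINT x|lebesgue_on \<Omega>.
        \<gamma> * ell / 2 * (norm (grad \<Omega> \<phi> x))\<^sup>2
      + 1/2 * ((strain \<Omega> u x - T (\<phi> x)) \<bullet> tensor_apply C (strain \<Omega> u x - T (\<phi> x)))
      + M / 2 * (\<theta> x - \<alpha> * dvg \<Omega> u x)\<^sup>2)
    + \<gamma> / ell * (LINT x|lebesgue_on \<Omega>. \<Psi>c (\<phi> x))"

definition convex_functional_on ::
  "('a \<Rightarrow> real) set \<Rightarrow> ('a \<Rightarrow> 'b::real_vector) set \<Rightarrow> ('a \<Rightarrow> real) set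
    \<Rightarrow> (('a \<Rightarrow> real) \<Rightarrow> ('a \<Rightarrow> 'b) \<Rightarrow> ('a \<Rightarrow> real) \<Rightarrow> real) \<Rightarrow> bool" where
  "convex_functional_on V W X E \<longleftrightarrow>
    (\<forall>\<phi>\<in>V. \<forall>\<phi>'\<in>V. \<forall>u\<in>W. \<forall>u'\<in>W. \<forall>\<theta>\<in>X. \<forall>\<theta>'\<in>X. \<forall>t\<in>{0..1}.
      E (\<lambda>x. (1 - t) * \<phi> x + t * \<phi>' x)
        (\<lambda>x. (1 - t) *\<^sub>R u x + t *\<^sub>R u' x)
        (\<lambda>x. (1 - t) * \<theta> x + t * \<theta>' x)
      \<le> (1 - t) * E \<phi> u \<theta> + t * E \<phi>' u' \<theta>')"

definition potential ::
  "(real ^ 'd) set \<Rightarrow> real \<Rightarrow> real \<Rightarrow> real \<Rightarrow> real \<Rightarrow> real \<Rightarrow> real \<Rightarrow> real ^ 'd ^ 'd ^ 'd ^ 'd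
    \<Rightarrow> (real \<Rightarrow> real ^ 'd ^ 'd) \<Rightarrow> (real \<Rightarrow> real) \<Rightarrow> (real \<Rightarrow> real)
    \<Rightarrow> (real ^ 'd \<Rightarrow> real) \<Rightarrow> (real ^ 'd \<Rightarrow> real) \<Rightarrow> (real ^ 'd \<Rightarrow> real ^ 'd)
    \<Rightarrow> (real ^ 'd \<Rightarrow> real) set \<Rightarrow> (real ^ 'd \<Rightarrow> real) set \<Rightarrow> real
    \<Rightarrow> (real ^ 'd \<Rightarrow> real) \<Rightarrow> (real ^ 'd \<Rightarrow> real)
    \<Rightarrow> (real ^ 'd \<Rightarrow> real) \<Rightarrow> (real ^ 'd \<Rightarrow> real ^ 'd) \<Rightarrow> (real ^ 'd \<Rightarrow> real) \<Rightarrow> real" where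
  "potential \<Omega> \<gamma> ell m \<kappa> M \<alpha> C T \<Psi>c \<Psi>e R Sf f Vch Vf \<tau> \<phi>_old \<theta>_old \<phi> u \<theta> =
      (dual_norm \<Omega> m Vch (l2_inner \<Omega> (\<lambda>x. \<phi> x - \<phi>_old x - \<tau> * R x)))\<^sup>2 / (2 * \<tau>)
    + energy_c \<Omega> \<gamma> ell M \<alpha> C T \<Psi>c \<phi> u \<theta>
    + (dual_norm \<Omega> \<kappa> Vf (l2_inner \<Omega> (\<lambda>x. \<theta> x - \<theta>_old x - \<tau> * Sf x)))\<^sup>2 / (2 * \<tau>)
    - \<gamma> / ell * l2_inner \<Omega> (\<lambda>x. deriv \<Psi>e (\<phi>_old x)) \<phi>
    - l2_inner \<Omega> f u"

end

theory Submission
  imports Defs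
begin

text \<open>Fix a candidate \<open>(\<phi>, u, \<theta>)\<close> satisfying the mean-value constraints. Riesz representation in
  the finite-dimensional space turns the residual \<open>\<phi> - \<phi>_old - \<tau> R\<close> into some \<open>w\<close> whose squared
  energy norm is the squared dual norm, and the first evolution equation says exactly that \<open>- \<tau> \<mu>\<close>
  is such a representer; likewise for \<open>\<theta>\<close> and \<open>p\<close>. Along a line through the candidate the squared dual
  norms are therefore quadratic with slope \<open>2 (w, \<eta>)\<close>, while the energy is convex and differentiable, so
  minimality is equivalent to the vanishing of all directional derivatives, which are the remaining
  equations tested with mean-free functions. Representers exist because a weak gradient that vanishes
  on a connected open set forces the function to be constant: its integral over a small box does not
  change when the box is translated, and Lebesgue differentiation recovers the function.\<close>

section \<open>Product bump functions\<close>

text \<open>The gradient energies vanish on constants, so they are only semi-definite, and a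
  functional has a representer only if it vanishes on every function of zero energy. For the
  residuals the mean-value constraints provide this, once zero energy is known to force a function
  to be constant; hence the measure-theoretic first half. There, weak gradients are tested with
  C-infinity functions supported in \<Omega>, and \<open>grad\<close> is an arbitrary choice among
  representatives: its linearity and the constancy theorem hold almost everywhere and rest on
  explicit bump functions. The eigenstrain \<open>T\<close> is nonlinear and merely differentiable
  with a Lipschitz bound. Differentiation of the elastic energy therefore relies on Lipschitz
  estimates of increments, and convexity, which cannot be read off the integrand, enters as the
  property of \<open>energy_c\<close> on the discrete spaces that leads from stationarity to
  minimality. \<Psi>e comes with no growth condition. That its derivative at
  \<open>\<phi>_old\<close> is square integrable follows from \<Psi> \<ge> 0, which keeps \<Psi>e
  below \<Psi>c, a function of at most quadratic growth.\<close>

primrec smooth_n :: "nat \<Rightarrow> (real \<Rightarrow> real) \<Rightarrow> bool" where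
  "smooth_n 0 f \<longleftrightarrow> continuous_on UNIV f"
| "smooth_n (Suc n) f \<longleftrightarrow> (\<forall>x. f field_differentiable at x) \<and> smooth_n n (deriv f)"

text \<open>\<open>smooth_n\<close> and \<open>smooth\<close> are the one-variable counterparts of
  \<open>Ck\<close>: test functions on \<Omega> are built as products, and each partial derivative
  differentiates a single factor.\<close>

definition smooth :: "(real \<Rightarrow> real) \<Rightarrow> bool" where
  "smooth f \<longleftrightarrow> (\<forall>n. smooth_n n f)"

lemma smooth_n_SucI:
  assumes "\<And>x. (f has_field_derivative f' x) (at x)" "smooth_n n f'"
  shows "smooth_n (Suc n) f"
proof -
  have "deriv f = f'" using assms(1) by (auto intro!: ext DERIV_imp_deriv)
  then show ?thesis using assms by (auto simp: field_differentiable_def)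
qed

lemma smooth_n_SucD: "smooth_n (Suc n) f \<Longrightarrow> smooth_n n f"
proof (induction n arbitrary: f)
  case 0
  then show ?case
    by (auto intro!: continuous_at_imp_continuous_on field_differentiable_imp_continuous_at)
qed auto

lemma smooth_n_const: "smooth_n n (\<lambda>_. c)"
proof (induction n arbitrary: c)
  case (Suc n)
  show ?case by (rule smooth_n_SucI[where f' = "\<lambda>_. 0"]) (auto intro: Suc)
qed auto

lemma smooth_n_add: "smooth_n n f \<Longrightarrow> smooth_n n g \<Longrightarrow> smooth_n n (\<lambda>x. f x + g x)"
proof (induction n arbitrary: f g)
  case 0
  then show ?case by (auto intro: continuous_intros)
next
  case (Suc n)
  have "smooth_n n (\<lambda>x. deriv f x + deriv g x)"
    using Suc.prems by (intro Suc.IH) auto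
  moreover have "((\<lambda>x. f x + g x) has_field_derivative deriv f x + deriv g x) (at x)" for x
    using Suc.prems by (auto intro!: derivative_intros simp: field_differentiable_derivI)
  ultimately show ?case by (rule smooth_n_SucI[rotated])
qed

lemma smooth_n_mult: "smooth_n n f \<Longrightarrow> smooth_n n g \<Longrightarrow> smooth_n n (\<lambda>x. f x * g x)"
proof (induction n arbitrary: f g)
  case 0
  then show ?case by (auto intro: continuous_intros)
next
  case (Suc n)
  have "smooth_n n (\<lambda>x. deriv f x * g x + deriv g x * f x)"
    using Suc.prems smooth_n_SucD[of n f] smooth_n_SucD[of n g] by (intro Suc.IH smooth_n_add) auto
  moreover have "((\<lambda>x. f x * g x) has_field_derivative deriv f x * g x + deriv g x * f x) (at x)" for x
    using Suc.prems by (intro DERIV_mult) (auto simp: field_differentiable_derivI)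
  ultimately show ?case by (rule smooth_n_SucI[rotated])
qed

lemma smooth_n_affine: "smooth_n n f \<Longrightarrow> smooth_n n (\<lambda>x. f (c * x + d))"
proof (induction n arbitrary: f)
  case 0
  then show ?case
    by (auto intro!: continuous_intros intro: continuous_on_compose2[of UNIV f])
next
  case (Suc n)
  have "smooth_n n (\<lambda>x. deriv f (c * x + d) * c)"
    using Suc.prems by (intro smooth_n_mult smooth_n_const Suc.IH) auto
  moreover have "((\<lambda>x. f (c * x + d)) has_field_derivative deriv f (c * x + d) * c) (at x)" for x
    using Suc.prems
    by (intro DERIV_chain2[where f = f]) (auto intro!: derivative_eq_intros simp: field_differentiable_derivI)
  ultimately show ?case by (rule smooth_n_SucI[rotated])
qed

text \<open>The classical flat function exp(-1/t) is the case \<open>k = 0\<close>. Differentiation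
  leads from index \<open>k\<close> to \<open>k + 1\<close> and \<open>k + 2\<close>, so with the
  powers of \<open>1 / t\<close> included the family is closed under it, and smoothness follows by
  induction for all \<open>k\<close> at once.\<close>

definition flat_exp :: "nat \<Rightarrow> real \<Rightarrow> real" where
  "flat_exp k t = (if t > 0 then (1 / t) ^ k * exp (- 1 / t) else 0)"

text \<open>Substituting s = 1/t turns the right limit into that of s^k / exp s at infinity.\<close>

lemma flat_exp_tendsto_0: "(flat_exp k \<longlongrightarrow> 0) (at 0)"
proof -
  have "filterlim (\<lambda>t::real. 1 / t) at_top (at_right 0)"
    by (simp add: filterlim_inverse_at_top_right field_simps flip: inverse_eq_divide)
  from filterlim_compose[OF tendsto_power_div_exp_0[of k] this]
  have "((\<lambda>t::real. (1 / t) ^ k * exp (- 1 / t)) \<longlongrightarrow> 0) (at_right 0)"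
    by (simp add: exp_minus divide_inverse)
  then have "(flat_exp k \<longlongrightarrow> 0) (at_right 0)"
    by (rule tendsto_cong[THEN iffD1, rotated])
       (auto simp: flat_exp_def eventually_at_filter)
  moreover have "(flat_exp k \<longlongrightarrow> 0) (at_left 0)"
    by (rule tendsto_eventually) (auto simp: flat_exp_def eventually_at_filter)
  ultimately show ?thesis by (simp add: filterlim_split_at)
qed

lemma flat_exp_derivative:
  "(flat_exp k has_field_derivative flat_exp (k + 2) t - k * flat_exp (k + 1) t) (at t)"
proof (cases t "0::real" rule: linorder_cases)
  case less
  have "((\<lambda>_. 0) has_field_derivative 0) (at t)" by auto
  moreover have "\<forall>\<^sub>F x in nhds t. (0::real) = flat_exp k x"
    using eventually_nhds_in_open[of "{..<0}" t] less
    by (auto elim!: eventually_mono simp: flat_exp_def)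
  ultimately have "(flat_exp k has_field_derivative 0) (at t)"
    by (subst (asm) DERIV_cong_ev) auto
  then show ?thesis using less by (simp add: flat_exp_def)
next
  case equal
  \<comment> \<open>At 0 the difference quotient of \<open>flat_exp k\<close> is
    \<open>flat_exp (Suc k)\<close>, whose limit is already known.\<close>
  have "((\<lambda>h. (flat_exp k (0 + h) - flat_exp k 0) / h) \<longlongrightarrow> 0) (at 0)"
    by (rule tendsto_cong[THEN iffD1, OF _ flat_exp_tendsto_0[of "Suc k"]])
       (auto simp: flat_exp_def eventually_at_filter field_simps)
  then show ?thesis using equal by (simp add: DERIV_def flat_exp_def)
next
  case greater
  have "((\<lambda>t. (1 / t) ^ k * exp (- 1 / t)) has_field_derivative
           flat_exp (k + 2) t - k * flat_exp (k + 1) t) (at t)"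
    using greater
    apply (auto intro!: derivative_eq_intros simp: flat_exp_def)
    \<comment> \<open>The power rule produces the exponent \<open>k - 1\<close>, which is truncated
      for \<open>k = 0\<close>.\<close>
    apply (cases k)
    apply (auto simp: field_simps power2_eq_square)
    done
  moreover have "\<forall>\<^sub>F x in nhds t. (1 / x) ^ k * exp (- 1 / x) = flat_exp k x"
    using eventually_nhds_in_open[of "{0<..}" t] greater
    by (auto elim!: eventually_mono simp: flat_exp_def)
  ultimately show ?thesis
    by (subst (asm) DERIV_cong_ev) auto
qed

lemma smooth_n_flat_exp: "smooth_n n (flat_exp k)"
proof (induction n arbitrary: k)
  case 0
  show ?case
    using flat_exp_derivative[of k] by (auto intro!: continuous_at_imp_continuous_on DERIV_isCont)
next
  case (Suc n)
  have "smooth_n n (\<lambda>t. flat_exp (k + 2) t + (- real k) * flat_exp (k + 1) t)"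
    by (intro smooth_n_add smooth_n_mult smooth_n_const Suc.IH)
  then show ?case
    using flat_exp_derivative[of k] by (intro smooth_n_SucI) auto
qed

text \<open>The two factors are \<open>flat_exp 0\<close> at n (t - a) and at n (b - t), with
  arguments written as \<open>c * x + d\<close> to fit \<open>smooth_n_affine\<close>. Increasing
  \<open>n\<close> sharpens the bump towards the indicator of the open interval.\<close>

definition bump :: "nat \<Rightarrow> real \<Rightarrow> real \<Rightarrow> real \<Rightarrow> real" where
  "bump n a b t = flat_exp 0 (real n * t + - real n * a) * flat_exp 0 (- real n * t + real n * b)"

lemma smooth_bump: "smooth (bump n a b)"
  unfolding smooth_def bump_def by (intro allI smooth_n_mult smooth_n_affine smooth_n_flat_exp)

lemma bump_shift: "bump n (a + h) (b + h) t = bump n a b (t - h)"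
  by (simp add: bump_def algebra_simps)

lemma bump_nonneg: "bump n a b t \<ge> 0" and bump_le_1: "bump n a b t \<le> 1"
  by (auto simp: bump_def flat_exp_def intro!: mult_le_one)

lemma bump_outside: "t \<notin> {a<..<b} \<Longrightarrow> bump n a b t = 0"
proof -
  assume "t \<notin> {a<..<b}"
  then consider "t \<le> a" | "b \<le> t" by force
  then have "n * t + - n * a \<le> 0 \<or> - real n * t + n * b \<le> 0"
    by (cases) (auto simp: mult_left_mono)
  then show ?thesis by (auto simp: bump_def flat_exp_def)
qed

lemma bump_tendsto: "(\<lambda>n. bump n a b t) \<longlonglongrightarrow> indicator {a<..<b} t"
proof (cases "t \<in> {a<..<b}")
  case True
  have *: "(\<lambda>n. flat_exp 0 (real n * c)) \<longlonglongrightarrow> 1" if "c > 0" for c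
  proof -
    have "(\<lambda>n. - (1 / c) * inverse (real n)) \<longlonglongrightarrow> - (1 / c) * 0"
      by (intro tendsto_mult tendsto_const LIMSEQ_inverse_real_of_nat[THEN filterlim_sequentially_Suc[THEN iffD1]])
    from tendsto_exp[OF this] have "(\<lambda>n. exp (- (1 / c) * inverse (real n))) \<longlonglongrightarrow> 1" by simp
    then show ?thesis
      by (rule tendsto_cong[THEN iffD1, rotated])
         (use that in \<open>auto simp: flat_exp_def field_simps intro!: eventually_sequentiallyI[of 1]\<close>)
  qed
  have "(\<lambda>n. flat_exp 0 (real n * (t - a)) * flat_exp 0 (real n * (b - t))) \<longlonglongrightarrow> 1 * 1"
    using True by (intro tendsto_mult *) auto
  then show ?thesis using True by (simp add: bump_def algebra_simps)
qed (simp add: bump_outside)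

lemma smooth_continuous: "smooth f \<Longrightarrow> continuous_on A f"
  by (metis continuous_on_subset smooth_def smooth_n.simps(1) subset_UNIV)

lemma smooth_DERIV: "smooth f \<Longrightarrow> (f has_field_derivative deriv f x) (at x)"
  by (metis field_differentiable_derivI smooth_def smooth_n.simps(2))

lemma smooth_deriv: "smooth f \<Longrightarrow> smooth (deriv f)"
  by (metis smooth_def smooth_n.simps(2))

lemma smooth_antideriv:
  assumes "smooth f" "\<And>x. (F has_field_derivative f x) (at x)"
  shows "smooth F"
proof -
  have "smooth_n (Suc n) F" for n
    using assms smooth_n_SucI[of F f n] by (auto simp: smooth_def)
  then show ?thesis using smooth_n_SucD by (auto simp: smooth_def)
qed

definition tensor_fun :: "('d \<Rightarrow> real \<Rightarrow> real) \<Rightarrow> real ^ 'd \<Rightarrow> real" where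
  "tensor_fun b x = (\<Prod>j\<in>UNIV. b j (x $ j))"

lemma tensor_fun_upd: "tensor_fun (b(i := c)) x = c (x $ i) * (\<Prod>j\<in>UNIV - {i}. b j (x $ j))"
  by (subst tensor_fun_def, subst prod.remove[of _ i]) auto

lemma partial_deriv_tensor_fun:
  fixes b :: "'d::finite \<Rightarrow> real \<Rightarrow> real"
  assumes "\<And>t. (b i has_field_derivative b' t) (at t)"
  shows "partial_deriv i (tensor_fun b) = tensor_fun (b(i := b'))"
proof
  fix x :: "real ^ 'd"
  have "((\<lambda>t. tensor_fun b (x + t *\<^sub>R axis i 1)) has_field_derivative
           tensor_fun (b(i := b')) x) (at 0)"
  proof -
    have "tensor_fun b (x + t *\<^sub>R axis i 1) =
            b i (x $ i + t) * (\<Prod>j\<in>UNIV - {i}. b j (x $ j))" for t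
      using tensor_fun_upd[of b i "b i" "x + t *\<^sub>R axis i 1"] by (simp add: axis_def)
    moreover have "((\<lambda>t. b i (x $ i + t) * (\<Prod>j\<in>UNIV - {i}. b j (x $ j))) has_field_derivative
            b' (x $ i) * (\<Prod>j\<in>UNIV - {i}. b j (x $ j))) (at 0)"
    proof (rule DERIV_cmult_right)
      have "((\<lambda>t. x $ i + t) has_field_derivative 1) (at 0)"
        by (auto intro!: derivative_eq_intros)
      then show "((\<lambda>t. b i (x $ i + t)) has_field_derivative b' (x $ i)) (at 0)"
        using DERIV_chain2[of "b i" "b' (x $ i)" "\<lambda>t. x $ i + t" 0 1 UNIV] assms by simp
    qed
    ultimately show ?thesis by (simp add: tensor_fun_upd)
  qed
  then show "partial_deriv i (tensor_fun b) x = tensor_fun (b(i := b')) x"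
    unfolding partial_deriv_def by (rule DERIV_imp_deriv)
qed

text \<open>Products of smooth factors are closed under partial derivatives, so an induction that
  generalises over \<open>b\<close> never meets another kind of function.\<close>

lemma Ck_tensor_fun:
  fixes b :: "'d::finite \<Rightarrow> real \<Rightarrow> real"
  assumes "\<And>j. smooth (b j)"
  shows "Ck k (tensor_fun b)"
  using assms
proof (induction k arbitrary: b)
  case 0
  have "continuous_on UNIV (\<lambda>x :: real ^ 'd. b j (x $ j))" for j
    by (rule continuous_on_compose2[OF smooth_continuous[of "b j" UNIV]]) (auto intro!: 0 continuous_intros)
  then show ?case by (auto simp: tensor_fun_def[abs_def] intro!: continuous_intros)
next
  case (Suc k)
  have "(\<lambda>x :: real ^ 'd. b j (x $ j)) differentiable (at x)" for j x
  proof -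
    have "(b j) differentiable (at (x $ j))"
      using smooth_DERIV[OF Suc.prems] by (auto simp: real_differentiable_def)
    moreover have "(\<lambda>x :: real ^ 'd. x $ j) differentiable (at x)"
      by (intro bounded_linear_imp_differentiable bounded_linear_vec_nth)
    ultimately show ?thesis
      by (rule differentiable_compose)
  qed
  then obtain D where "((\<lambda>x :: real ^ 'd. b j (x $ j)) has_derivative D j x) (at x)" for j x
    unfolding differentiable_def by metis
  then have "(tensor_fun b has_derivative
      (\<lambda>y. \<Sum>j\<in>UNIV. D j x y * (\<Prod>k\<in>UNIV - {j}. b k (x $ k)))) (at x)" for x
    unfolding tensor_fun_def[abs_def] by (intro has_derivative_prod)
  then have "tensor_fun b differentiable (at x)" for x
    unfolding differentiable_def by blast
  then have "tensor_fun b differentiable_on UNIV"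
    by (simp add: differentiable_on_def)
  moreover have "Ck k (partial_deriv i (tensor_fun b))" for i
  proof -
    have "partial_deriv i (tensor_fun b) = tensor_fun (b(i := deriv (b i)))"
      by (rule partial_deriv_tensor_fun) (simp add: smooth_DERIV Suc.prems)
    then show ?thesis using Suc.prems smooth_deriv by (auto intro!: Suc.IH)
  qed
  ultimately show ?case by simp
qed

lemma tensor_fun_test:
  fixes l u :: "real ^ 'd"
  assumes "\<And>j. smooth (b j)" "\<And>j t. t \<notin> {l $ j..u $ j} \<Longrightarrow> b j t = 0" "cbox l u \<subseteq> \<Omega>"
  shows "tensor_fun b \<in> test_functions \<Omega>"
proof -
  have sub: "closure {x. tensor_fun b x \<noteq> 0} \<subseteq> cbox l u"
  proof (rule closure_minimal)
    show "{x. tensor_fun b x \<noteq> 0} \<subseteq> cbox l u"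
      using assms(2) by (auto simp: tensor_fun_def mem_box_cart) force+
  qed auto
  then have "compact (closure {x. tensor_fun b x \<noteq> 0})"
    using compact_cbox[of l u] compact_closure bounded_subset bounded_cbox closure_subset by (metis)
  with sub show ?thesis
    using assms Ck_tensor_fun[of b] by (auto simp: test_functions_def)
qed

lemma box_bump_tendsto:
  fixes l u :: "real ^ 'd"
  shows "(\<lambda>n. tensor_fun (\<lambda>j. bump n (l $ j) (u $ j)) x) \<longlonglongrightarrow> indicator (box l u) x"
proof -
  have "(\<lambda>n. tensor_fun (\<lambda>j. bump n (l $ j) (u $ j)) x)
          \<longlonglongrightarrow> (\<Prod>j\<in>UNIV. indicator {l $ j<..<u $ j} (x $ j))"
    unfolding tensor_fun_def by (intro tendsto_prod bump_tendsto)
  also have "(\<Prod>j\<in>UNIV. indicator {l $ j<..<u $ j} (x $ j)) = (indicator (box l u) x :: real)"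
  proof (cases "x \<in> box l u")
    case True
    then show ?thesis by (auto simp: mem_box_cart)
  next
    case False
    then obtain j where "x $ j \<notin> {l $ j<..<u $ j}" by (auto simp: mem_box_cart)
    then show ?thesis using False by (auto intro!: exI[of _ j])
  qed
  finally show ?thesis .
qed

section \<open>Weak gradients and box integrals\<close>

lemma continuous_measurable_lebesgue_on:
  fixes g :: "'a::euclidean_space \<Rightarrow> 'b::euclidean_space"
  shows "continuous_on UNIV g \<Longrightarrow> g \<in> borel_measurable (lebesgue_on \<Omega>)"
  by (intro measurable_restrict_space1 measurable_completion) (simp add: borel_measurable_continuous_onI)

lemma integrable_mult_bounded:
  fixes f g :: "'a \<Rightarrow> real"
  assumes "integrable M f" "g \<in> borel_measurable M" "\<And>x. \<bar>g x\<bar> \<le> K"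
  shows "integrable M (\<lambda>x. f x * g x)"
proof (rule Bochner_Integration.integrable_bound)
  show "integrable M (\<lambda>x. K * f x)" using assms by auto
  have "\<bar>f x\<bar> * \<bar>g x\<bar> \<le> \<bar>K\<bar> * \<bar>f x\<bar>" for x
    using assms(3)[of x] by (subst mult.commute) (intro mult_right_mono, auto)
  then show "AE x in M. norm (f x * g x) \<le> norm (K * f x)"
    by (auto simp: abs_mult)
qed (use assms in auto)

lemma tensor_bump_bounds:
  "0 \<le> tensor_fun (\<lambda>j. bump n (l $ j) (u $ j)) x" "tensor_fun (\<lambda>j. bump n (l $ j) (u $ j)) x \<le> 1"
  unfolding tensor_fun_def by (auto intro!: prod_nonneg prod_le_1 bump_nonneg bump_le_1)

lemma tensor_bump_continuous:
  "continuous_on UNIV (tensor_fun (\<lambda>j :: 'd::finite. bump n (a j) (b j)))"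
  using Ck_tensor_fun[of "\<lambda>j. bump n (a j) (b j)" 0] smooth_bump by auto

text \<open>Dominated convergence with bound \<bar>f\<bar>, since the bumps lie between 0 and 1. The
  limit is the indicator of the open box, whose boundary is a null set.\<close>

lemma tensor_bump_integral_tendsto:
  fixes f :: "real ^ 'd \<Rightarrow> real"
  assumes f: "integrable (lebesgue_on \<Omega>) f" and \<Omega>: "open \<Omega>" and sub: "cbox l u \<subseteq> \<Omega>"
  shows "(\<lambda>n. LINT x|lebesgue_on \<Omega>. f x * tensor_fun (\<lambda>j. bump n (l $ j) (u $ j)) x)
           \<longlonglongrightarrow> integral (cbox l u) f"
proof -
  have sub': "box l u \<subseteq> \<Omega>" using sub box_subset_cbox by blast
  have meas [measurable]: "f \<in> borel_measurable (lebesgue_on \<Omega>)" using f by auto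
  have "(\<lambda>n. LINT x|lebesgue_on \<Omega>. f x * tensor_fun (\<lambda>j. bump n (l $ j) (u $ j)) x)
           \<longlonglongrightarrow> (LINT x|lebesgue_on \<Omega>. f x * indicator (box l u) x)"
  proof (rule integral_dominated_convergence)
    show "integrable (lebesgue_on \<Omega>) (\<lambda>x. \<bar>f x\<bar>)" using f by auto
    show "(\<lambda>x. f x * indicator (box l u) x) \<in> borel_measurable (lebesgue_on \<Omega>)"
      by (intro borel_measurable_times meas measurable_restrict_space1 borel_measurable_indicator) auto
    show "(\<lambda>x. f x * tensor_fun (\<lambda>j. bump n (l $ j) (u $ j)) x) \<in> borel_measurable (lebesgue_on \<Omega>)" for n
      by (intro borel_measurable_times meas continuous_measurable_lebesgue_on tensor_bump_continuous)
    show "AE x in lebesgue_on \<Omega>. (\<lambda>n. f x * tensor_fun (\<lambda>j. bump n (l $ j) (u $ j)) x)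
        \<longlonglongrightarrow> f x * indicator (box l u) x"
      by (intro AE_I2 tendsto_mult tendsto_const box_bump_tendsto)
    show "AE x in lebesgue_on \<Omega>. norm (f x * tensor_fun (\<lambda>j. bump n (l $ j) (u $ j)) x) \<le> \<bar>f x\<bar>" for n
      using tensor_bump_bounds[of n l u] by (intro AE_I2) (auto simp: abs_mult intro!: mult_left_le)
  qed
  also have "(LINT x|lebesgue_on \<Omega>. f x * indicator (box l u) x)
      = (LINT x:box l u|lebesgue. f x)"
    unfolding set_lebesgue_integral_def using \<Omega> sub'
    by (subst integral_restrict_space) (auto intro!: Bochner_Integration.integral_cong simp: indicator_def)
  also have "\<dots> = integral (box l u) f"
  proof (rule set_lebesgue_integral_eq_integral)
    have "set_integrable lebesgue \<Omega> f"
      using f \<Omega> by (simp add: set_integrable_def integrable_restrict_space)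
    then show "set_integrable lebesgue (box l u) f"
      by (rule set_integrable_subset) (use sub' in auto)
  qed
  also have "\<dots> = integral (cbox l u) f" by (rule integral_open_interval)
  finally show ?thesis .
qed

lemma cube_in_open:
  fixes x :: "real ^ 'd"
  assumes "open \<Omega>" "x \<in> \<Omega>"
  shows "\<forall>\<^sub>F h in at_right 0. cbox x (x + h *\<^sub>R One) \<subseteq> \<Omega>"
proof -
  obtain e where e: "e > 0" "cball x e \<subseteq> \<Omega>"
    using assms by (auto simp: open_contains_cball)
  have "cbox x (x + h *\<^sub>R One) \<subseteq> \<Omega>" if "0 < h" "h < e / norm (One :: real ^ 'd)" for h
  proof
    fix y assume y: "y \<in> cbox x (x + h *\<^sub>R One)"
    have "norm (y - x) \<le> norm (h *\<^sub>R One :: real ^ 'd)"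
      by (rule norm_le_componentwise)
         (use y in \<open>auto simp: mem_box inner_diff_left inner_add_left abs_if\<close>)
    also have "\<dots> \<le> e" using that by (simp add: pos_less_divide_eq)
    finally show "y \<in> \<Omega>" using e by (auto simp: dist_norm norm_minus_commute)
  qed
  then show ?thesis
    unfolding eventually_at_right_field using e
    by (intro exI[of _ "e / norm (One :: real ^ 'd)"]) (auto simp: field_simps)
qed

text \<open>Lebesgue differentiation with cubes that have \<open>x\<close> as their lower corner. At
  a given \<open>h\<close> the cubes of different points are translates of each other, which is what
  the later comparison of two points uses.\<close>

lemma averages_tendsto:
  fixes f :: "real ^ 'd \<Rightarrow> real"
  assumes f: "integrable (lebesgue_on \<Omega>) f" and \<Omega>: "open \<Omega>"
  shows "\<exists>N. negligible N \<and> (\<forall>x\<in>\<Omega> - N.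
    ((\<lambda>h. integral (cbox x (x + h *\<^sub>R One)) f / h ^ CARD('d)) \<longlongrightarrow> f x) (at_right 0))"
proof -
  \<comment> \<open>The differentiation theorem asks for integrability on every box, including those
    that leave \<Omega>. Extension by zero provides it, and small cubes at \<open>x\<close> do not
    see the extension.\<close>
  define f0 where "f0 = (\<lambda>x. if x \<in> \<Omega> then f x else 0)"
  have "f integrable_on \<Omega>" "f absolutely_integrable_on \<Omega>"
    using f \<Omega> by (auto simp: integrable_on_lebesgue_on set_integrable_def integrable_restrict_space)
  then have "f0 integrable_on UNIV"
    by (simp add: f0_def integrable_restrict_UNIV)
  then have "f0 integrable_on cbox a b" for a b
    by (rule integrable_on_subcbox) auto
  from integrable_ccontinuous_explicit[OF this] obtain N where N: "negligible N" and
    *: "\<And>x e. x \<notin> N \<Longrightarrow> 0 < e \<Longrightarrow> \<exists>d>0. \<forall>h. 0 < h \<and> h < d \<longrightarrow>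
          norm (integral (cbox x (x + h *\<^sub>R One)) f0 /\<^sub>R h ^ DIM(real ^ 'd) - f0 x) < e"
    by metis
  have "((\<lambda>h. integral (cbox x (x + h *\<^sub>R One)) f / h ^ CARD('d)) \<longlongrightarrow> f x) (at_right 0)"
    if x: "x \<in> \<Omega> - N" for x
  proof (rule tendsto_cong[THEN iffD1])
    show "((\<lambda>h. integral (cbox x (x + h *\<^sub>R One)) f0 /\<^sub>R h ^ DIM(real ^ 'd)) \<longlongrightarrow> f x) (at_right 0)"
      unfolding tendsto_iff eventually_at_right_field dist_norm
    proof (intro allI impI)
      fix e :: real assume "e > 0"
      with x *[of x e] obtain d where "d > 0" "\<forall>h. 0 < h \<and> h < d \<longrightarrow>
          norm (integral (cbox x (x + h *\<^sub>R One)) f0 /\<^sub>R h ^ DIM(real ^ 'd) - f0 x) < e" by auto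
      with x show "\<exists>b>0. \<forall>y>0. y < b \<longrightarrow>
          norm (integral (cbox x (x + y *\<^sub>R One)) f0 /\<^sub>R y ^ DIM(real ^ 'd) - f x) < e"
        by (auto simp: f0_def)
    qed
    have "\<forall>\<^sub>F h in at_right 0. cbox x (x + h *\<^sub>R One) \<subseteq> \<Omega>"
      using x by (intro cube_in_open \<Omega>) auto
    then show "\<forall>\<^sub>F h in at_right 0. integral (cbox x (x + h *\<^sub>R One)) f0 /\<^sub>R h ^ DIM(real ^ 'd) =
        integral (cbox x (x + h *\<^sub>R One)) f / h ^ CARD('d)"
    proof (rule eventually_mono)
      fix h assume "cbox x (x + h *\<^sub>R One) \<subseteq> \<Omega>"
      then have "integral (cbox x (x + h *\<^sub>R One)) f0 = integral (cbox x (x + h *\<^sub>R One)) f"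
        by (intro Henstock_Kurzweil_Integration.integral_cong) (auto simp: f0_def)
      then show "integral (cbox x (x + h *\<^sub>R One)) f0 /\<^sub>R h ^ DIM(real ^ 'd) =
          integral (cbox x (x + h *\<^sub>R One)) f / h ^ CARD('d)"
        by (simp add: field_simps)
    qed
  qed
  with N show ?thesis by blast
qed

lemma AE_lebesgue_on_negligible:
  assumes "open \<Omega>" "negligible N" "\<And>x. x \<in> \<Omega> - N \<Longrightarrow> P x"
  shows "AE x in lebesgue_on \<Omega>. P x"
proof -
  have "AE x in lebesgue. x \<notin> N"
    using assms(2) by (intro AE_not_in) (simp add: negligible_iff_null_sets)
  then have "AE x in lebesgue. x \<in> \<Omega> \<longrightarrow> P x"
    by (rule AE_mp) (use assms(3) in auto)
  then show ?thesis
    by (subst AE_restrict_space_iff) (use assms(1) in auto)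
qed

text \<open>Indicators of boxes are limits of test functions, so \<open>f\<close> has integral zero
  over every closed box in \<Omega>. Hence the cube averages, which recover \<open>f\<close> almost
  everywhere, vanish.\<close>

theorem du_Bois_Reymond:
  fixes f :: "real ^ 'd \<Rightarrow> real"
  assumes f: "integrable (lebesgue_on \<Omega>) f" and \<Omega>: "open \<Omega>"
    and zero: "\<And>\<psi>. \<psi> \<in> test_functions \<Omega> \<Longrightarrow> (LINT x|lebesgue_on \<Omega>. f x * \<psi> x) = 0"
  shows "AE x in lebesgue_on \<Omega>. f x = 0"
proof -
  have box0: "integral (cbox l u) f = 0" if "cbox l u \<subseteq> \<Omega>" for l u
  proof (rule LIMSEQ_unique[OF tensor_bump_integral_tendsto[OF f \<Omega> that]])
    have "tensor_fun (\<lambda>j. bump n (l $ j) (u $ j)) \<in> test_functions \<Omega>" for n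
      using that by (intro tensor_fun_test smooth_bump bump_outside) auto
    then show "(\<lambda>n. LINT x|lebesgue_on \<Omega>. f x * tensor_fun (\<lambda>j. bump n (l $ j) (u $ j)) x) \<longlonglongrightarrow> 0"
      by (simp add: zero)
  qed
  obtain N where N: "negligible N" and
    *: "\<And>x. x \<in> \<Omega> - N \<Longrightarrow>
       ((\<lambda>h. integral (cbox x (x + h *\<^sub>R One)) f / h ^ CARD('d)) \<longlongrightarrow> f x) (at_right 0)"
    using averages_tendsto[OF f \<Omega>] by blast
  show ?thesis
  proof (rule AE_lebesgue_on_negligible[OF \<Omega> N])
    fix x assume x: "x \<in> \<Omega> - N"
    have "((\<lambda>h. integral (cbox x (x + h *\<^sub>R One)) f / h ^ CARD('d)) \<longlongrightarrow> 0) (at_right 0)"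
    proof (rule tendsto_eventually)
      have "\<forall>\<^sub>F h in at_right 0. cbox x (x + h *\<^sub>R One) \<subseteq> \<Omega>"
        using x by (intro cube_in_open \<Omega>) auto
      then show "\<forall>\<^sub>F h in at_right 0. integral (cbox x (x + h *\<^sub>R One)) f / h ^ CARD('d) = 0"
        by (rule eventually_mono) (simp add: box0)
    qed
    then show "f x = 0"
      using tendsto_unique[OF trivial_limit_at_right_real *[OF x]] by blast
  qed
qed

section \<open>Translation of boxes under a vanishing weak gradient\<close>

lemma antiderivative_exists:
  fixes b :: "real \<Rightarrow> real"
  assumes "continuous_on UNIV b"
  obtains F where "\<And>x. (F has_field_derivative b x) (at x)"
proof -
  have "\<exists>F. \<forall>x::real. - \<infinity> < ereal x \<longrightarrow> ereal x < \<infinity> \<longrightarrow> (F has_vector_derivative b x) (at x)"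
    using assms by (intro einterval_antiderivative) (auto simp: continuous_on_eq_continuous_at)
  then show ?thesis
    using that by (auto simp: has_real_derivative_iff_has_vector_derivative)
qed

text \<open>A primitive of one bump takes different constant values on its two sides, so it cannot
  have compact support. Its difference with a translate can, and thus may serve as a factor of a
  test function.\<close>

lemma bump_primitive_difference:
  assumes "h > 0"
  obtains B where "smooth B" "\<And>t. (B has_field_derivative bump n (a + h) (b + h) t - bump n a b t) (at t)"
    "\<And>t. t \<notin> {a..b + h} \<Longrightarrow> B t = 0"
proof -
  have "continuous_on UNIV (bump n a b)" by (intro smooth_continuous smooth_bump)
  then obtain F where F: "\<And>x. (F has_field_derivative bump n a b x) (at x)"
    using antiderivative_exists by metis
  define B where "B t = F (t - h) - F t" for t
  have der: "(B has_field_derivative bump n (a + h) (b + h) t - bump n a b t) (at t)" for t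
    unfolding B_def bump_shift
  proof (rule DERIV_diff[OF _ F])
    have "((\<lambda>t. t - h) has_field_derivative 1) (at t)"
      by (auto intro!: derivative_eq_intros)
    then show "((\<lambda>t. F (t - h)) has_field_derivative bump n a b (t - h)) (at t)"
      using DERIV_chain2[of F "bump n a b (t - h)" "\<lambda>t. t - h" t 1 UNIV] F by simp
  qed
  have "smooth_n k (\<lambda>t. bump n (a + h) (b + h) t + (- 1) * bump n a b t)" for k
    using smooth_bump by (intro smooth_n_add smooth_n_mult smooth_n_const) (auto simp: smooth_def)
  then have "smooth (\<lambda>t. bump n (a + h) (b + h) t - bump n a b t)"
    by (simp add: smooth_def)
  then have "smooth B" using der by (rule smooth_antideriv)
  moreover have "B t = 0" if t: "t \<notin> {a..b + h}" for t
  proof -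
    \<comment> \<open>By the mean value theorem \<open>B t\<close> is \<open>- h\<close> times the
      bump at some \<open>z\<close> between \<open>t - h\<close> and \<open>t\<close>; for
      \<open>t\<close> outside \<open>{a..b + h}\<close> this \<open>z\<close> misses
      \<open>{a<..<b}\<close>.\<close>
    have "\<exists>z. t - h < z \<and> z < t \<and> F t - F (t - h) = (t - (t - h)) * bump n a b z"
      using assms by (intro MVT2) (auto simp: F)
    then obtain z where "t - h < z" "z < t" "F t - F (t - h) = h * bump n a b z" by auto
    moreover from this t have "z \<notin> {a<..<b}" by auto
    ultimately show ?thesis by (simp add: B_def bump_outside)
  qed
  ultimately show ?thesis using der that by blast
qed

text \<open>Replacing the \<open>i\<close>-th factor of a product bump by the primitive from
  \<open>bump_primitive_difference\<close> gives a test function whose \<open>i\<close>-th partial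
  derivative is the shifted bump minus the original one. So \<open>f\<close> has the same integral
  against both, and letting \<open>n\<close> grow turns bumps into boxes. The box in the last
  assumption is the region swept by the shift, which contains the support.\<close>

lemma box_integral_shift:
  fixes f :: "real ^ 'd \<Rightarrow> real"
  assumes f: "integrable (lebesgue_on \<Omega>) f" and \<Omega>: "open \<Omega>"
    and zero: "\<And>\<psi> i. \<psi> \<in> test_functions \<Omega> \<Longrightarrow> (LINT x|lebesgue_on \<Omega>. f x * partial_deriv i \<psi> x) = 0"
    and h: "h > 0" and sub: "cbox l (u + h *\<^sub>R axis i 1) \<subseteq> \<Omega>"
  shows "integral (cbox (l + h *\<^sub>R axis i 1) (u + h *\<^sub>R axis i 1)) f = integral (cbox l u) f"
proof -
  let ?e = "h *\<^sub>R axis i 1 :: real ^ 'd"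
  let ?P = "\<lambda>l u n. tensor_fun (\<lambda>j. bump n (l $ j) (u $ j)) :: real ^ 'd \<Rightarrow> real"
  have sub1: "cbox l u \<subseteq> \<Omega>" and sub2: "cbox (l + ?e) (u + ?e) \<subseteq> \<Omega>"
  proof -
    have e: "0 \<le> ?e $ k" for k using h by (simp add: axis_def)
    have "x $ k \<le> u $ k + ?e $ k" if "x $ k \<le> u $ k" for x :: "real ^ 'd" and k
      using that e[of k] by linarith
    moreover have "l $ k \<le> x $ k" if "l $ k + ?e $ k \<le> x $ k" for x :: "real ^ 'd" and k
      using that e[of k] by linarith
    ultimately have "cbox l u \<subseteq> cbox l (u + ?e)" "cbox (l + ?e) (u + ?e) \<subseteq> cbox l (u + ?e)"
      unfolding subset_iff mem_box_cart vector_add_component by blast+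
    with sub show "cbox l u \<subseteq> \<Omega>" "cbox (l + ?e) (u + ?e) \<subseteq> \<Omega>" by auto
  qed
  have "(LINT x|lebesgue_on \<Omega>. f x * ?P (l + ?e) (u + ?e) n x) = (LINT x|lebesgue_on \<Omega>. f x * ?P l u n x)" for n
  proof -
    obtain B where B: "smooth B"
      "\<And>t. (B has_field_derivative bump n (l $ i + h) (u $ i + h) t - bump n (l $ i) (u $ i) t) (at t)"
      "\<And>t. t \<notin> {l $ i..u $ i + h} \<Longrightarrow> B t = 0"
      using bump_primitive_difference[OF h] by metis
    define b where "b = (\<lambda>j. bump n (l $ j) (u $ j))(i := B)"
    have "tensor_fun b \<in> test_functions \<Omega>"
    proof (rule tensor_fun_test[OF _ _ sub])
      show "smooth (b j)" for j by (simp add: b_def B smooth_bump)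
      show "b j t = 0" if "t \<notin> {l $ j..(u + ?e) $ j}" for j t
        using that B(3) by (auto simp: b_def axis_def intro!: bump_outside)
    qed
    from zero[OF this, of i] have
      "(LINT x|lebesgue_on \<Omega>. f x * tensor_fun (b(i := \<lambda>t. bump n (l $ i + h) (u $ i + h) t - bump n (l $ i) (u $ i) t)) x) = 0"
      by (subst (asm) partial_deriv_tensor_fun) (auto simp: b_def B(2))
    moreover have "tensor_fun (b(i := \<lambda>t. bump n (l $ i + h) (u $ i + h) t - bump n (l $ i) (u $ i) t)) x
        = ?P (l + ?e) (u + ?e) n x - ?P l u n x" for x
    proof -
      have "?P (l + ?e) (u + ?e) n = tensor_fun ((\<lambda>j. bump n (l $ j) (u $ j))(i := bump n (l $ i + h) (u $ i + h)))"
        by (intro arg_cong[of _ _ tensor_fun] ext) (auto simp: axis_def)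
      moreover have "?P l u n = tensor_fun ((\<lambda>j. bump n (l $ j) (u $ j))(i := bump n (l $ i) (u $ i)))"
        by (intro arg_cong[of _ _ tensor_fun] ext) auto
      ultimately show ?thesis
        by (simp add: b_def tensor_fun_upd left_diff_distrib del: fun_upd_triv)
    qed
    ultimately have "(LINT x|lebesgue_on \<Omega>. f x * ?P (l + ?e) (u + ?e) n x - f x * ?P l u n x) = 0"
      by (simp add: right_diff_distrib)
    moreover have int: "integrable (lebesgue_on \<Omega>) (\<lambda>x. f x * ?P l u n x)" for l u
      by (rule integrable_mult_bounded[OF f, where K = 1])
         (auto intro!: continuous_measurable_lebesgue_on tensor_bump_continuous simp: tensor_bump_bounds)
    ultimately show ?thesis
      using Bochner_Integration.integral_diff[OF int[of "l + ?e" "u + ?e"] int[of l u]] by linarith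
  qed
  with tensor_bump_integral_tendsto[OF f \<Omega> sub2]
  have "(\<lambda>n. LINT x|lebesgue_on \<Omega>. f x * ?P l u n x)
      \<longlonglongrightarrow> integral (cbox (l + ?e) (u + ?e)) f" by (simp only:)
  from LIMSEQ_unique[OF this tensor_bump_integral_tendsto[OF f \<Omega> sub1]] show ?thesis .
qed

lemma cbox_mono:
  fixes a :: "real ^ 'd"
  shows "p \<in> cbox a b \<Longrightarrow> q \<in> cbox a b \<Longrightarrow> cbox p q \<subseteq> cbox a b"
  unfolding subset_iff mem_box_cart by (meson order_trans)

text \<open>\<open>box_integral_shift\<close> moves boxes forward only; a backward move is the
  forward move of the other box. All corners lie in \<open>cbox a b\<close>, hence the swept region
  lies in \<Omega>.\<close>

lemma box_integral_shift_component:
  fixes f :: "real ^ 'd \<Rightarrow> real" and p q :: "real ^ 'd"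
  assumes f: "integrable (lebesgue_on \<Omega>) f" and \<Omega>: "open \<Omega>"
    and zero: "\<And>\<psi> i. \<psi> \<in> test_functions \<Omega> \<Longrightarrow> (LINT x|lebesgue_on \<Omega>. f x * partial_deriv i \<psi> x) = 0"
    and sub: "cbox a b \<subseteq> \<Omega>"
    and pq: "p \<in> cbox a b" "p + e \<in> cbox a b" "q \<in> cbox a b" "q + e \<in> cbox a b"
    and eq: "q = p + h *\<^sub>R axis i 1"
  shows "integral (cbox p (p + e)) f = integral (cbox q (q + e)) f"
proof (cases h "0::real" rule: linorder_cases)
  case less
  then have "integral (cbox (q + (- h) *\<^sub>R axis i 1) (q + e + (- h) *\<^sub>R axis i 1)) f = integral (cbox q (q + e)) f"
  proof (intro box_integral_shift[OF f \<Omega> zero])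
    have "q + e + (- h) *\<^sub>R axis i 1 = p + e" by (simp add: eq)
    moreover have "cbox q (p + e) \<subseteq> \<Omega>" using cbox_mono[OF pq(3,2)] sub by (rule subset_trans)
    ultimately show "cbox q (q + e + (- h) *\<^sub>R axis i 1) \<subseteq> \<Omega>"
      by (simp only:)
  qed auto
  then show ?thesis by (simp add: eq)
next
  case greater
  then have "integral (cbox (p + h *\<^sub>R axis i 1) (p + e + h *\<^sub>R axis i 1)) f = integral (cbox p (p + e)) f"
  proof (intro box_integral_shift[OF f \<Omega> zero])
    have "p + e + h *\<^sub>R axis i 1 = q + e" by (simp add: eq)
    moreover have "cbox p (q + e) \<subseteq> \<Omega>" using cbox_mono[OF pq(1,4)] sub by (rule subset_trans)
    ultimately show "cbox p (p + e + h *\<^sub>R axis i 1) \<subseteq> \<Omega>"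
      by (simp only:)
  qed auto
  then show ?thesis by (simp add: eq algebra_simps)
qed (simp add: eq)

text \<open>Coordinates of \<open>p\<close> are replaced by those of \<open>q\<close> one at a time.
  Every intermediate corner mixes coordinates of two points of \<open>cbox a b\<close> and so stays
  in it, as does its translate by \<open>e\<close>.\<close>

lemma box_integral_translate:
  fixes f :: "real ^ 'd \<Rightarrow> real" and p q :: "real ^ 'd"
  assumes f: "integrable (lebesgue_on \<Omega>) f" and \<Omega>: "open \<Omega>"
    and zero: "\<And>\<psi> i. \<psi> \<in> test_functions \<Omega> \<Longrightarrow> (LINT x|lebesgue_on \<Omega>. f x * partial_deriv i \<psi> x) = 0"
    and sub: "cbox a b \<subseteq> \<Omega>"
    and pq: "p \<in> cbox a b" "p + e \<in> cbox a b" "q \<in> cbox a b" "q + e \<in> cbox a b"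
  shows "integral (cbox p (p + e)) f = integral (cbox q (q + e)) f"
proof -
  have "integral (cbox p (p + e)) f = integral (cbox q (q + e)) f"
    if "finite S" "\<forall>j. j \<notin> S \<longrightarrow> p $ j = q $ j" "p \<in> cbox a b" "p + e \<in> cbox a b" for S :: "'d set" and p
    using that
  proof (induction S arbitrary: p rule: finite_induct)
    case empty
    then have "p = q" by (simp add: vec_eq_iff)
    then show ?case by simp
  next
    case (insert i S)
    define p' where "p' = (\<chi> j. if j = i then q $ i else p $ j)"
    have p': "p' \<in> cbox a b" "p' + e \<in> cbox a b"
      using insert.prems pq by (auto simp: p'_def mem_box_cart)
    have "p' = p + (q $ i - p $ i) *\<^sub>R axis i 1"
      by (simp add: p'_def vec_eq_iff axis_def)
    then have "integral (cbox p (p + e)) f = integral (cbox p' (p' + e)) f"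
      using insert.prems p' by (intro box_integral_shift_component[OF f \<Omega> zero sub])
    also have "\<dots> = integral (cbox q (q + e)) f"
      using insert.prems p' by (intro insert.IH) (auto simp: p'_def)
    finally show ?case .
  qed
  from this[of UNIV p] pq show ?thesis by auto
qed

text \<open>Equal small cubes at two points of a box in \<Omega> carry equal integrals, so off a
  null set the averages force equal values of \<open>f\<close>. Connectedness glues the local
  constants together.\<close>

theorem weak_gradient_zero_imp_const:
  fixes f :: "real ^ 'd \<Rightarrow> real"
  assumes f: "integrable (lebesgue_on \<Omega>) f" and \<Omega>: "open \<Omega>" "connected \<Omega>"
    and zero: "\<And>\<psi> i. \<psi> \<in> test_functions \<Omega> \<Longrightarrow> (LINT x|lebesgue_on \<Omega>. f x * partial_deriv i \<psi> x) = 0"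
  obtains c where "AE x in lebesgue_on \<Omega>. f x = c"
proof -
  obtain N where N: "negligible N" and
    avg: "\<And>x. x \<in> \<Omega> - N \<Longrightarrow>
       ((\<lambda>h. integral (cbox x (x + h *\<^sub>R One)) f / h ^ CARD('d)) \<longlongrightarrow> f x) (at_right 0)"
    using averages_tendsto[OF f \<Omega>(1)] by blast
  have local: "f x = f y" if sub: "cbox a b \<subseteq> \<Omega>" and xy: "x \<in> box a b - N" "y \<in> box a b - N" for a b x y
  proof -
    have mem: "x \<in> \<Omega> - N" "y \<in> \<Omega> - N" using xy sub box_subset_cbox by blast+
    have ev: "\<forall>\<^sub>F h in at_right 0. cbox x (x + h *\<^sub>R One) \<subseteq> box a b"
      "\<forall>\<^sub>F h in at_right 0. cbox y (y + h *\<^sub>R One) \<subseteq> box a b"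
      using xy by (auto intro!: cube_in_open open_box)
    have pos: "\<forall>\<^sub>F h in at_right 0. (h::real) > 0" by (rule eventually_at_right_less)
    have "\<forall>\<^sub>F h in at_right 0. integral (cbox x (x + h *\<^sub>R One)) f / h ^ CARD('d)
            = integral (cbox y (y + h *\<^sub>R One)) f / h ^ CARD('d)"
      using ev pos
    proof eventually_elim
      case (elim h)
      have top: "z + h *\<^sub>R One \<in> cbox z (z + h *\<^sub>R One)" for z :: "real ^ 'd"
        using elim by (simp add: mem_box inner_add_left)
      have "x \<in> cbox a b" "y \<in> cbox a b" "x + h *\<^sub>R One \<in> cbox a b" "y + h *\<^sub>R One \<in> cbox a b"
        using elim xy top box_subset_cbox by blast+
      then show ?case using box_integral_translate[OF f \<Omega>(1) zero sub, of x "h *\<^sub>R One" y] by simp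
    qed
    from tendsto_cong[THEN iffD1, OF this avg[OF mem(1)]] avg[OF mem(2)] show ?thesis
      using tendsto_unique[OF trivial_limit_at_right_real] by blast
  qed
  have "\<forall>x\<in>\<Omega>. \<exists>c U. open U \<and> x \<in> U \<and> (\<forall>y\<in>U - N. f y = c)"
  proof
    fix x assume "x \<in> \<Omega>"
    with \<Omega> obtain a b where ab: "cbox a b \<subseteq> \<Omega>" "x \<in> box a b" using open_contains_cbox by metis
    have "\<not> negligible (box a b)" using ab by (intro open_not_negligible) auto
    then obtain z where "z \<in> box a b - N" using N negligible_subset by blast
    then have "\<forall>y\<in>box a b - N. f y = f z" using local[OF ab(1)] by blast
    then show "\<exists>c U. open U \<and> x \<in> U \<and> (\<forall>y\<in>U - N. f y = c)" using ab open_box by blast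
  qed
  \<comment> \<open>\<open>c\<close> has a value at every point of \<Omega>, including the
    exceptional points in \<open>N\<close>, so the connectedness argument is run on \<open>c\<close>
    instead of \<open>f\<close>.\<close>
  then obtain c U where cU: "\<And>x. x \<in> \<Omega> \<Longrightarrow> open (U x)" "\<And>x. x \<in> \<Omega> \<Longrightarrow> x \<in> U x"
    "\<And>x y. x \<in> \<Omega> \<Longrightarrow> y \<in> U x - N \<Longrightarrow> f y = c x" by metis
  have c_eq: "c x = c y" if "x \<in> \<Omega>" "y \<in> \<Omega> \<inter> U x" for x y
  proof -
    have "open (U x \<inter> U y)" "y \<in> U x \<inter> U y" using that cU by auto
    \<comment> \<open>A nonempty open overlap contains a point outside \<open>N\<close>, where
      \<open>f\<close> equals both constants.\<close>
    then have "\<not> negligible (U x \<inter> U y)" by (intro open_not_negligible) auto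
    then have "\<not> U x \<inter> U y \<subseteq> N" using N negligible_subset by blast
    then obtain z where "z \<in> U x \<inter> U y" "z \<notin> N" by blast
    with cU(3)[of x z] cU(3)[of y z] that show ?thesis by auto
  qed
  have const: "c x = c y" if "x \<in> \<Omega>" "y \<in> \<Omega>" for x y
  proof (rule connected_equivalence_relation[OF \<Omega>(2) that])
    fix a assume a: "a \<in> \<Omega>"
    show "\<exists>T. openin (top_of_set \<Omega>) T \<and> a \<in> T \<and> (\<forall>x\<in>T. c a = c x)"
      using a cU c_eq by (intro exI[of _ "\<Omega> \<inter> U a"]) (auto simp: openin_open_Int)
  qed auto
  show ?thesis
  proof (cases "\<Omega> = {}")
    case True
    then have "AE x in lebesgue_on \<Omega>. f x = 0" by (intro AE_I2) simp
    then show ?thesis by (rule that)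
  next
    case False
    then obtain x0 where x0: "x0 \<in> \<Omega>" by auto
    have "AE x in lebesgue_on \<Omega>. f x = c x0"
    proof (rule AE_lebesgue_on_negligible[OF \<Omega>(1) N])
      fix x assume x: "x \<in> \<Omega> - N"
      then have "f x = c x" using cU(2,3)[of x] by blast
      then show "f x = c x0" using const[OF _ x0, of x] x by simp
    qed
    then show ?thesis by (rule that)
  qed
qed

section \<open>Test functions\<close>

lemma test_function_continuous:
  assumes "\<psi> \<in> test_functions \<Omega>"
  shows "continuous_on UNIV \<psi>" "continuous_on UNIV (partial_deriv i \<psi>)" "\<psi> differentiable_on UNIV"
proof -
  have "Ck 0 \<psi>" "Ck (Suc 0) \<psi>" using assms by (simp_all add: test_functions_def del: Ck.simps)
  then show "continuous_on UNIV \<psi>" "continuous_on UNIV (partial_deriv i \<psi>)" "\<psi> differentiable_on UNIV"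
    by auto
qed

text \<open>\<open>partial_deriv\<close> is defined by a derivative at parameter 0; the mean value
  theorem along a coordinate line needs it at every parameter \<open>s\<close>.\<close>

lemma partial_deriv_DERIV:
  assumes "\<psi> \<in> test_functions \<Omega>"
  shows "((\<lambda>t. \<psi> (x + t *\<^sub>R axis i 1)) has_field_derivative partial_deriv i \<psi> (x + s *\<^sub>R axis i 1)) (at s)"
proof -
  have diff: "\<psi> differentiable (at y)" for y
    using test_function_continuous(3)[OF assms] by (simp add: differentiable_on_def)
  have line: "(\<lambda>t. y + t *\<^sub>R axis i 1) differentiable (at s)" for y :: "real ^ 'a" and s
    by (intro differentiable_add differentiable_const bounded_linear_imp_differentiable
        bounded_linear_scaleR_left)
  have "(\<lambda>t. \<psi> ((x + s *\<^sub>R axis i 1) + t *\<^sub>R axis i 1)) differentiable (at 0)"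
    by (rule differentiable_compose[OF diff line])
  then obtain D where D: "((\<lambda>t. \<psi> ((x + s *\<^sub>R axis i 1) + t *\<^sub>R axis i 1)) has_field_derivative D) (at 0)"
    by (auto simp: real_differentiable_def)
  then have "D = partial_deriv i \<psi> (x + s *\<^sub>R axis i 1)"
    unfolding partial_deriv_def by (metis DERIV_imp_deriv)
  with D DERIV_shift[of "\<lambda>t. \<psi> (x + t *\<^sub>R axis i 1)" D 0 s] show ?thesis
    by (simp add: algebra_simps)
qed

lemma test_function_outside:
  assumes "\<psi> \<in> test_functions \<Omega>" "x \<notin> closure {x. \<psi> x \<noteq> 0}"
  shows "\<psi> x = 0" "partial_deriv i \<psi> x = 0"
proof -
  let ?K = "closure {x. \<psi> x \<noteq> 0}"
  show "\<psi> x = 0" using assms closure_subset[of "{x. \<psi> x \<noteq> 0}"] by blast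
  have "((\<lambda>t. x + t *\<^sub>R axis i 1) \<longlongrightarrow> x + 0 *\<^sub>R axis i 1) (nhds 0)"
    by (intro tendsto_intros filterlim_ident)
  then have "\<forall>\<^sub>F t in nhds 0. x + t *\<^sub>R axis i 1 \<in> - ?K"
    using assms by (intro topological_tendstoD) auto
  then have "\<forall>\<^sub>F t in nhds 0. \<psi> (x + t *\<^sub>R axis i 1) = 0"
    by (rule eventually_mono) (use closure_subset[of "{x. \<psi> x \<noteq> 0}"] in blast)
  then have "deriv (\<lambda>t. \<psi> (x + t *\<^sub>R axis i 1)) 0 = deriv (\<lambda>_. 0) 0"
    by (intro deriv_cong_ev) auto
  then show "partial_deriv i \<psi> x = 0"
    by (simp add: partial_deriv_def)
qed

lemma continuous_compact_support_bounded:
  fixes h :: "'a::euclidean_space \<Rightarrow> real"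
  assumes "continuous_on UNIV h" "compact K" "\<And>x. x \<notin> K \<Longrightarrow> h x = 0"
  obtains B where "B \<ge> 0" "\<And>x. \<bar>h x\<bar> \<le> B"
proof -
  have "bounded (h ` K)"
    using assms by (intro compact_imp_bounded compact_continuous_image) (auto intro: continuous_on_subset)
  then obtain B where "\<And>x. x \<in> K \<Longrightarrow> \<bar>h x\<bar> \<le> B" by (auto simp: bounded_iff)
  then have "\<bar>h x\<bar> \<le> max B 0" for x using assms(3)[of x] by (cases "x \<in> K") (auto simp: le_max_iff_disj)
  then show ?thesis using that[of "max B 0"] by auto
qed

lemma test_function_bounded:
  assumes "\<psi> \<in> test_functions \<Omega>"
  shows "\<exists>B\<ge>0. (\<forall>x. \<bar>\<psi> x\<bar> \<le> B) \<and> (\<forall>x. \<bar>partial_deriv i \<psi> x\<bar> \<le> B)"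
proof -
  have K: "compact (closure {x. \<psi> x \<noteq> 0})" using assms by (simp add: test_functions_def)
  obtain B where B: "\<And>x. \<bar>\<psi> x\<bar> \<le> B"
    using continuous_compact_support_bounded[OF test_function_continuous(1)[OF assms] K] test_function_outside(1)[OF assms] by metis
  obtain B' where B': "B' \<ge> 0" "\<And>x. \<bar>partial_deriv i \<psi> x\<bar> \<le> B'"
    using continuous_compact_support_bounded[OF test_function_continuous(2)[OF assms] K] test_function_outside(2)[OF assms] by metis
  show ?thesis
    using B B' by (intro exI[of _ "max B B'"]) (auto simp: le_max_iff_disj)
qed

lemma lborel_integral_translate:
  fixes g :: "'a::euclidean_space \<Rightarrow> real"
  assumes "g \<in> borel_measurable borel"
  shows "(LINT x|lborel. g (c + x)) = (LINT x|lborel. g x)"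
  using integral_distr[of "(+) c" lborel borel g] assms lborel_distr_plus[of c] by simp

lemma lborel_integrable_translate:
  fixes g :: "'a::euclidean_space \<Rightarrow> real"
  assumes "integrable lborel g"
  shows "integrable lborel (\<lambda>x. g (c + x))"
  using integrable_distr[of "(+) c" lborel borel g] assms lborel_distr_plus[of c] by simp

text \<open>Forward difference quotients have integral zero by translation invariance and converge
  dominatedly to the partial derivative. This gives functions equal to 1 on \<Omega> the weak
  gradient zero.\<close>

lemma integral_partial_deriv_test:
  fixes \<psi> :: "real ^ 'd \<Rightarrow> real"
  assumes \<psi>: "\<psi> \<in> test_functions \<Omega>" and \<Omega>: "open \<Omega>"
  shows "(LINT x|lebesgue_on \<Omega>. partial_deriv i \<psi> x) = 0"
proof -
  let ?K = "closure {x. \<psi> x \<noteq> 0}" and ?D = "partial_deriv i \<psi>"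
  have K: "compact ?K" "?K \<subseteq> \<Omega>" using \<psi> by (simp_all add: test_functions_def)
  have cont: "continuous_on UNIV \<psi>" "continuous_on UNIV ?D" using test_function_continuous[OF \<psi>] by auto
  have [measurable]: "\<psi> \<in> borel_measurable borel" "?D \<in> borel_measurable borel"
    using cont by (auto intro: borel_measurable_continuous_onI)
  obtain B where B: "B \<ge> 0" "\<And>x. \<bar>\<psi> x\<bar> \<le> B" "\<And>x. \<bar>?D x\<bar> \<le> B"
    using test_function_bounded[OF \<psi>] by blast
  obtain r where r: "\<And>x. x \<in> ?K \<Longrightarrow> norm x \<le> r"
    using compact_imp_bounded[OF K(1)] by (auto simp: bounded_iff)
  have fin: "integrable lborel (\<lambda>x. B * indicator (cball 0 s :: (real ^ 'd) set) x)" for s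
    using emeasure_lborel_cball_finite[of "0 :: real ^ 'd" s]
    by (intro integrable_mult_right integrable_real_indicator) simp_all
  have int: "integrable lborel \<psi>"
  proof (rule Bochner_Integration.integrable_bound[OF fin[of r]])
    have "\<bar>\<psi> x\<bar> \<le> B * indicator (cball 0 r) x" for x
      using B(2)[of x] r[of x] test_function_outside(1)[OF \<psi>, of x] by (cases "x \<in> ?K") (auto simp: indicator_def)
    then show "AE x in lborel. norm (\<psi> x) \<le> norm (B * indicator (cball 0 r) x)"
      using B(1) by (auto simp: abs_mult)
  qed auto
  \<comment> \<open>The increment 1/(n+1) is at most 1, and by the mean value theorem
    \<open>Q n x\<close> is a value of the partial derivative at distance less than 1 from
    \<open>x\<close>; hence the dominating ball of radius \<open>r + 1\<close>.\<close>
  define Q where "Q n x = real (Suc n) * (\<psi> (inverse (real (Suc n)) *\<^sub>R axis i 1 + x) - \<psi> x)" for n x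
  have zero: "(LINT x|lborel. Q n x) = 0" for n
    using int lborel_integrable_translate[OF int]
    by (simp add: Q_def lborel_integral_translate del: of_nat_Suc)
  have "(\<lambda>n. LINT x|lborel. Q n x) \<longlonglongrightarrow> (LINT x|lborel. ?D x)"
  proof (rule integral_dominated_convergence[OF _ _ fin[of "r + 1"]])
    show "AE x in lborel. (\<lambda>n. Q n x) \<longlonglongrightarrow> ?D x"
    proof (rule AE_I2)
      fix x :: "real ^ 'd"
      have "((\<lambda>h. (\<psi> (x + h *\<^sub>R axis i 1) - \<psi> x) / h) \<longlongrightarrow> ?D x) (at 0)"
        using partial_deriv_DERIV[OF \<psi>, of x i 0] by (simp add: DERIV_def)
      moreover have "filterlim (\<lambda>n. inverse (real (Suc n))) (at 0) sequentially"
        by (intro filterlim_atI LIMSEQ_inverse_real_of_nat) auto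
      ultimately have "(\<lambda>n. (\<psi> (x + inverse (real (Suc n)) *\<^sub>R axis i 1) - \<psi> x) / inverse (real (Suc n))) \<longlonglongrightarrow> ?D x"
        by (rule filterlim_compose)
      then show "(\<lambda>n. Q n x) \<longlonglongrightarrow> ?D x"
        by (simp add: Q_def field_simps del: of_nat_Suc)
    qed
    show "AE x in lborel. norm (Q n x) \<le> B * indicator (cball 0 (r + 1)) x" for n
    proof (rule AE_I2)
      fix x :: "real ^ 'd"
      let ?h = "inverse (real (Suc n))"
      have h: "0 < ?h" "?h \<le> 1" by (auto simp: inverse_le_1_iff)
      obtain z where z: "0 < z" "z < ?h" "\<psi> (x + ?h *\<^sub>R axis i 1) - \<psi> (x + 0 *\<^sub>R axis i 1) = (?h - 0) * ?D (x + z *\<^sub>R axis i 1)"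
        using MVT2[OF h(1), of "\<lambda>t. \<psi> (x + t *\<^sub>R axis i 1)" "\<lambda>t. ?D (x + t *\<^sub>R axis i 1)"]
          partial_deriv_DERIV[OF \<psi>] by blast
      then have Q: "Q n x = ?D (x + z *\<^sub>R axis i 1)"
        by (simp add: Q_def add.commute field_simps del: of_nat_Suc)
      show "norm (Q n x) \<le> B * indicator (cball 0 (r + 1)) x"
      proof (cases "x + z *\<^sub>R axis i 1 \<in> ?K")
        case True
        have "norm x \<le> norm (x + z *\<^sub>R axis i 1) + norm (z *\<^sub>R axis i (1::real))"
          using norm_triangle_ineq4[of "x + z *\<^sub>R axis i 1" "z *\<^sub>R axis i 1"] by simp
        also have "\<dots> \<le> r + 1" using r[OF True] z h by (simp add: norm_axis_1)
        finally show ?thesis using B(3) Q by simp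
      next
        case False
        then show ?thesis using B(1) Q test_function_outside(2)[OF \<psi> False] by simp
      qed
    qed
  qed (auto simp: Q_def)
  then have "(LINT x|lborel. ?D x) = 0"
    by (simp add: zero LIMSEQ_unique)
  then have "(LINT x|lebesgue. ?D x) = 0"
    by (subst integral_completion) auto
  moreover have "(LINT x|lebesgue_on \<Omega>. ?D x) = (LINT x|lebesgue. ?D x)"
  proof -
    have "?D x = 0" if "x \<notin> \<Omega>" for x
      using that K test_function_outside(2)[OF \<psi>] by blast
    then show ?thesis
      using \<Omega> by (subst integral_restrict_space)
        (auto intro!: Bochner_Integration.integral_cong simp: indicator_def)
  qed
  ultimately show ?thesis by simp
qed

section \<open>Square-integrable functions and weak gradients on a bounded domain\<close>

locale bounded_domain =
  fixes \<Omega> :: "(real ^ 'd) set"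
  assumes open_\<Omega>: "open \<Omega>" and bounded_\<Omega>: "bounded \<Omega>" and connected_\<Omega>: "connected \<Omega>"
    and nonempty_\<Omega>: "\<Omega> \<noteq> {}"
begin

abbreviation \<L> :: "(real ^ 'd) measure" where "\<L> \<equiv> lebesgue_on \<Omega>"

lemma \<Omega>_lmeasurable: "\<Omega> \<in> lmeasurable"
  using open_\<Omega> bounded_\<Omega> by (rule lmeasurable_open[rotated])

lemma integrable_const_\<L>: "integrable \<L> (\<lambda>_. c :: 'b :: euclidean_space)"
  using \<Omega>_lmeasurable finite_measure_lebesgue_on by (intro finite_measure.integrable_const)

lemma L2_measurable: "f \<in> L2 \<Omega> \<Longrightarrow> f \<in> borel_measurable \<L>"
  by (simp add: L2_def)

lemma L2_sq_integrable: "f \<in> L2 \<Omega> \<Longrightarrow> integrable \<L> (\<lambda>x. (norm (f x))\<^sup>2)"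
  by (simp add: L2_def)

lemma L2_I:
  assumes "f \<in> borel_measurable \<L>" "integrable \<L> g" "\<And>x. (norm (f x))\<^sup>2 \<le> g x"
  shows "f \<in> L2 \<Omega>"
  unfolding L2_def
proof (intro CollectI conjI assms)
  show "integrable \<L> (\<lambda>x. (norm (f x))\<^sup>2)"
    by (rule Bochner_Integration.integrable_bound[OF assms(2)])
       (use assms in \<open>auto intro!: order_trans[OF assms(3)]\<close>)
qed

lemma L2_const: "(\<lambda>_. c) \<in> L2 \<Omega>"
  by (rule L2_I[OF _ integrable_const_\<L>[of "(norm c)\<^sup>2"]]) auto

text \<open>Constants are integrable on the bounded \<Omega>, so linear growth preserves square
  integrability. Compositions with \<open>T\<close> and with the derivatives of \<Psi>c and \<Psi>e
  enter \<open>L2\<close> this way.\<close>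

lemma L2_affine_bound:
  fixes f :: "real ^ 'd \<Rightarrow> 'b::euclidean_space" and g :: "real ^ 'd \<Rightarrow> 'c::euclidean_space"
  assumes "f \<in> borel_measurable \<L>" "g \<in> L2 \<Omega>" "\<And>x. norm (f x) \<le> a + b * norm (g x)"
  shows "f \<in> L2 \<Omega>"
proof (rule L2_I[OF assms(1)])
  show "integrable \<L> (\<lambda>x. 2 * a\<^sup>2 + 2 * b\<^sup>2 * (norm (g x))\<^sup>2)"
    by (intro Bochner_Integration.integrable_add integrable_const_\<L> integrable_mult_right L2_sq_integrable assms(2))
  show "(norm (f x))\<^sup>2 \<le> 2 * a\<^sup>2 + 2 * b\<^sup>2 * (norm (g x))\<^sup>2" for x
  proof -
    have "(norm (f x))\<^sup>2 \<le> (a + b * norm (g x))\<^sup>2" using assms(3) by (intro power_mono) auto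
    also have "\<dots> \<le> 2 * a\<^sup>2 + 2 * (b * norm (g x))\<^sup>2"
      using sum_squares_bound[of a "b * norm (g x)"] by (simp add: power2_sum)
    finally show ?thesis by (simp add: power_mult_distrib)
  qed
qed

lemma L2_add: "f \<in> L2 \<Omega> \<Longrightarrow> g \<in> L2 \<Omega> \<Longrightarrow> (\<lambda>x. f x + g x :: 'b::euclidean_space) \<in> L2 \<Omega>"
proof (rule L2_I)
  assume fg: "f \<in> L2 \<Omega>" "g \<in> L2 \<Omega>"
  show "(\<lambda>x. f x + g x) \<in> borel_measurable \<L>"
    using fg by (intro borel_measurable_add L2_measurable)
  show "integrable \<L> (\<lambda>x. 2 * (norm (f x))\<^sup>2 + 2 * (norm (g x))\<^sup>2)"
    using fg by (intro Bochner_Integration.integrable_add integrable_mult_right L2_sq_integrable)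
  show "(norm (f x + g x))\<^sup>2 \<le> 2 * (norm (f x))\<^sup>2 + 2 * (norm (g x))\<^sup>2" for x
  proof -
    have "(norm (f x + g x))\<^sup>2 \<le> (norm (f x) + norm (g x))\<^sup>2"
      by (intro power_mono norm_triangle_ineq) auto
    also have "\<dots> \<le> 2 * (norm (f x))\<^sup>2 + 2 * (norm (g x))\<^sup>2"
      using sum_squares_bound[of "norm (f x)" "norm (g x)"] by (simp add: power2_sum)
    finally show ?thesis .
  qed
qed

lemma L2_bounded_linear:
  fixes A :: "'b::euclidean_space \<Rightarrow> 'c::euclidean_space"
  assumes "bounded_linear A" "f \<in> L2 \<Omega>"
  shows "(\<lambda>x. A (f x)) \<in> L2 \<Omega>"
proof -
  obtain K where "\<And>x. norm (A x) \<le> norm x * K" using bounded_linear.bounded[OF assms(1)] by blast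
  moreover have "(\<lambda>x. A (f x)) \<in> borel_measurable \<L>"
    using assms by (intro borel_measurable_continuous_on[of A] linear_continuous_on L2_measurable)
  ultimately show ?thesis
    using L2_affine_bound[OF _ assms(2), of "\<lambda>x. A (f x)" 0 K] by (simp add: mult.commute)
qed

lemma L2_scaleR: "f \<in> L2 \<Omega> \<Longrightarrow> (\<lambda>x. c *\<^sub>R f x :: 'b::euclidean_space) \<in> L2 \<Omega>"
  by (rule L2_bounded_linear[OF bounded_linear_scaleR_right])

lemma L2_cmult: "f \<in> L2 \<Omega> \<Longrightarrow> (\<lambda>x. c * f x :: real) \<in> L2 \<Omega>"
  using L2_scaleR[of f c] by simp

lemma L2_diff: "f \<in> L2 \<Omega> \<Longrightarrow> g \<in> L2 \<Omega> \<Longrightarrow> (\<lambda>x. f x - g x :: 'b::euclidean_space) \<in> L2 \<Omega>"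
  using L2_add[of f "\<lambda>x. (- 1) *\<^sub>R g x"] L2_scaleR[of g "- 1"] by simp

lemma L2_norm:
  fixes f :: "real ^ 'd \<Rightarrow> 'b::euclidean_space"
  assumes "f \<in> L2 \<Omega>"
  shows "(\<lambda>x. norm (f x)) \<in> L2 \<Omega>"
proof (rule L2_affine_bound[OF _ assms])
  show "(\<lambda>x. norm (f x)) \<in> borel_measurable \<L>"
    using L2_measurable[OF assms] borel_measurable_norm by (rule measurable_compose)
  show "norm (norm (f x)) \<le> 0 + 1 * norm (f x)" for x by simp
qed

lemma integrable_inner:
  fixes f g :: "real ^ 'd \<Rightarrow> 'b::euclidean_space"
  assumes "f \<in> L2 \<Omega>" "g \<in> L2 \<Omega>"
  shows "integrable \<L> (\<lambda>x. f x \<bullet> g x)"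
proof (rule Bochner_Integration.integrable_bound)
  show "integrable \<L> (\<lambda>x. (norm (f x))\<^sup>2 + (norm (g x))\<^sup>2)"
    using assms by (intro Bochner_Integration.integrable_add L2_sq_integrable)
  show "(\<lambda>x. f x \<bullet> g x) \<in> borel_measurable \<L>"
    using assms by (intro borel_measurable_inner L2_measurable)
  have "\<bar>f x \<bullet> g x\<bar> \<le> (norm (f x))\<^sup>2 + (norm (g x))\<^sup>2" for x
  proof -
    have "\<bar>f x \<bullet> g x\<bar> \<le> norm (f x) * norm (g x)" by (rule Cauchy_Schwarz_ineq2)
    also have "\<dots> \<le> (norm (f x))\<^sup>2 + (norm (g x))\<^sup>2"
    proof -
      have "0 \<le> norm (f x) * norm (g x)" by simp
      then show ?thesis using sum_squares_bound[of "norm (f x)" "norm (g x)"] by linarith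
    qed
    finally show ?thesis .
  qed
  then show "AE x in \<L>. norm (f x \<bullet> g x) \<le> norm ((norm (f x))\<^sup>2 + (norm (g x))\<^sup>2)"
    by (auto intro!: AE_I2)
qed

lemma integrable_mult_L2: "f \<in> L2 \<Omega> \<Longrightarrow> g \<in> L2 \<Omega> \<Longrightarrow> integrable \<L> (\<lambda>x. f x * g x :: real)"
  using integrable_inner[of f g] by simp

lemma L2_integrable: "f \<in> L2 \<Omega> \<Longrightarrow> integrable \<L> (f :: _ \<Rightarrow> real)"
  using integrable_mult_L2[OF _ L2_const, of f 1] by simp

lemma l2_inner_commute: "l2_inner \<Omega> f g = l2_inner \<Omega> g f"
  by (simp add: l2_inner_def inner_commute)

lemma l2_inner_add_left:
  "f \<in> L2 \<Omega> \<Longrightarrow> g \<in> L2 \<Omega> \<Longrightarrow> h \<in> L2 \<Omega> \<Longrightarrow>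
    l2_inner \<Omega> (\<lambda>x. f x + g x) h = l2_inner \<Omega> f h + l2_inner \<Omega> g h"
  by (simp add: l2_inner_def inner_add_left integrable_inner)

lemma l2_inner_scaleR_left: "l2_inner \<Omega> (\<lambda>x. c *\<^sub>R f x) h = c * l2_inner \<Omega> f h"
  by (simp add: l2_inner_def)

lemma l2_inner_cmult_left: "l2_inner \<Omega> (\<lambda>x. c * f x) h = c * l2_inner \<Omega> f h"
  using l2_inner_scaleR_left[of c f h] by simp

lemma l2_inner_diff_left:
  "f \<in> L2 \<Omega> \<Longrightarrow> g \<in> L2 \<Omega> \<Longrightarrow> h \<in> L2 \<Omega> \<Longrightarrow>
    l2_inner \<Omega> (\<lambda>x. f x - g x) h = l2_inner \<Omega> f h - l2_inner \<Omega> g h"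
  by (simp add: l2_inner_def inner_diff_left integrable_inner)

lemma l2_inner_add_right:
  "f \<in> L2 \<Omega> \<Longrightarrow> g \<in> L2 \<Omega> \<Longrightarrow> h \<in> L2 \<Omega> \<Longrightarrow>
    l2_inner \<Omega> h (\<lambda>x. f x + g x) = l2_inner \<Omega> h f + l2_inner \<Omega> h g"
  by (simp add: l2_inner_def inner_add_right integrable_inner)

lemma l2_inner_scaleR_right: "l2_inner \<Omega> h (\<lambda>x. c *\<^sub>R f x) = c * l2_inner \<Omega> h f"
  by (simp add: l2_inner_def)

lemma l2_inner_cmult_right: "l2_inner \<Omega> h (\<lambda>x. c * f x) = c * l2_inner \<Omega> h f"
  using l2_inner_scaleR_right[of h c f] by simp

lemma l2_inner_cong_AE:
  assumes "AE x in \<L>. f x = f' x" "AE x in \<L>. g x = g' x"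
    and "f \<in> L2 \<Omega>" "f' \<in> L2 \<Omega>" "g \<in> L2 \<Omega>" "g' \<in> L2 \<Omega>"
  shows "l2_inner \<Omega> f g = l2_inner \<Omega> f' g'"
  unfolding l2_inner_def
proof (rule integral_cong_AE)
  show "AE x in \<L>. f x \<bullet> g x = f' x \<bullet> g' x" using assms(1,2) by eventually_elim simp
qed (use assms in \<open>auto intro!: borel_measurable_inner intro: L2_measurable\<close>)

lemma l2_inner_nonneg: "l2_inner \<Omega> f f \<ge> 0"
  unfolding l2_inner_def by (intro Bochner_Integration.integral_nonneg) auto

lemma l2_inner_eq_0_imp:
  assumes "f \<in> L2 \<Omega>" "l2_inner \<Omega> f f = 0"
  shows "AE x in \<L>. f x = 0"
proof -
  have "AE x in \<L>. f x \<bullet> f x = 0"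
    using assms integrable_inner[OF assms(1,1)] unfolding l2_inner_def
    by (subst (asm) integral_nonneg_eq_0_iff_AE) auto
  then show ?thesis by eventually_elim simp
qed

lemma test_function_L2:
  assumes "\<psi> \<in> test_functions \<Omega>"
  shows "\<psi> \<in> L2 \<Omega>" "partial_deriv i \<psi> \<in> L2 \<Omega>"
proof -
  obtain B where "\<And>x. \<bar>\<psi> x\<bar> \<le> B" "\<And>x. \<bar>partial_deriv i \<psi> x\<bar> \<le> B"
    using test_function_bounded[OF assms] by blast
  then show "\<psi> \<in> L2 \<Omega>" "partial_deriv i \<psi> \<in> L2 \<Omega>"
    using test_function_continuous[OF assms]
    by (auto intro!: L2_affine_bound[OF _ L2_const[of "0::real"], where a = B]
        continuous_measurable_lebesgue_on)
qed

lemma L2_nth: "g \<in> L2 \<Omega> \<Longrightarrow> (\<lambda>x. g x $ i :: real) \<in> L2 \<Omega>"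
  by (rule L2_bounded_linear[OF bounded_linear_vec_nth])

section \<open>Weak gradients up to null sets\<close>

lemma H1_L2: "f \<in> H1 \<Omega> \<Longrightarrow> f \<in> L2 \<Omega>"
  by (simp add: H1_def)

lemma
  assumes "f \<in> H1 \<Omega>"
  shows grad_L2: "grad \<Omega> f \<in> L2 \<Omega>" and grad_weak: "is_weak_gradient \<Omega> f (grad \<Omega> f)"
proof -
  have "\<exists>g. g \<in> L2 \<Omega> \<and> is_weak_gradient \<Omega> f g" using assms by (auto simp: H1_def)
  then have "grad \<Omega> f \<in> L2 \<Omega> \<and> is_weak_gradient \<Omega> f (grad \<Omega> f)"
    unfolding grad_def by (rule someI_ex)
  then show "grad \<Omega> f \<in> L2 \<Omega>" "is_weak_gradient \<Omega> f (grad \<Omega> f)" by auto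
qed

text \<open>Each component of \<open>g - h\<close> integrates to zero against every test function,
  so \<open>du_Bois_Reymond\<close> applies componentwise.\<close>

lemma weak_gradient_unique:
  assumes "is_weak_gradient \<Omega> f g" "is_weak_gradient \<Omega> f h" "g \<in> L2 \<Omega>" "h \<in> L2 \<Omega>"
  shows "AE x in \<L>. g x = h x"
proof -
  have "AE x in \<L>. g x $ i - h x $ i = 0" for i
  proof (rule du_Bois_Reymond[OF _ open_\<Omega>])
    show "integrable \<L> (\<lambda>x. g x $ i - h x $ i)"
      using assms by (intro Bochner_Integration.integrable_diff L2_integrable L2_nth)
    fix \<psi> assume \<psi>: "\<psi> \<in> test_functions \<Omega>"
    have "(LINT x|\<L>. g x $ i * \<psi> x) = (LINT x|\<L>. h x $ i * \<psi> x)"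
      using assms(1,2)[unfolded is_weak_gradient_def, rule_format, OF \<psi>, of i] by linarith
    then show "(LINT x|\<L>. (g x $ i - h x $ i) * \<psi> x) = 0"
      using assms \<psi> by (simp add: left_diff_distrib integrable_mult_L2 L2_nth test_function_L2)
  qed
  then have "AE x in \<L>. \<forall>i. g x $ i - h x $ i = 0"
    by (subst AE_all_countable) auto
  then show ?thesis by eventually_elim (simp add: vec_eq_iff)
qed

lemma weak_gradient_lincomb:
  assumes "f \<in> L2 \<Omega>" "g \<in> L2 \<Omega>" "df \<in> L2 \<Omega>" "dg \<in> L2 \<Omega>"
    and "is_weak_gradient \<Omega> f df" "is_weak_gradient \<Omega> g dg"
  shows "is_weak_gradient \<Omega> (\<lambda>x. f x + c * g x) (\<lambda>x. df x + c *\<^sub>R dg x)"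
  unfolding is_weak_gradient_def
proof (intro ballI allI)
  fix \<psi> i assume \<psi>: "\<psi> \<in> test_functions \<Omega>"
  let ?D = "partial_deriv i \<psi>"
  have "(LINT x|\<L>. (f x + c * g x) * ?D x) = (LINT x|\<L>. f x * ?D x + c * (g x * ?D x))"
    by (simp add: algebra_simps)
  also have "\<dots> = (LINT x|\<L>. f x * ?D x) + c * (LINT x|\<L>. g x * ?D x)"
    using assms \<psi> by (simp add: integrable_mult_L2 test_function_L2)
  also have "\<dots> = - ((LINT x|\<L>. df x $ i * \<psi> x) + c * (LINT x|\<L>. dg x $ i * \<psi> x))"
    using assms(5,6) \<psi> by (simp add: is_weak_gradient_def)
  also have "(LINT x|\<L>. df x $ i * \<psi> x) + c * (LINT x|\<L>. dg x $ i * \<psi> x)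
      = (LINT x|\<L>. df x $ i * \<psi> x + c * (dg x $ i * \<psi> x))"
    using assms \<psi> by (simp add: integrable_mult_L2 test_function_L2 L2_nth)
  finally show "(LINT x|\<L>. (f x + c * g x) * ?D x) = - (LINT x|\<L>. (df x + c *\<^sub>R dg x) $ i * \<psi> x)"
    by (simp add: algebra_simps)
qed

text \<open>\<open>grad\<close> is chosen for each function separately, so linearity is not built
  in. Uniqueness yields it almost everywhere, and \<open>l2_inner_cong_AE\<close> carries it into
  inner products.\<close>

lemma
  assumes "f \<in> H1 \<Omega>" "g \<in> H1 \<Omega>"
  shows H1_lincomb: "(\<lambda>x. f x + c * g x) \<in> H1 \<Omega>"
    and grad_lincomb: "AE x in \<L>. grad \<Omega> (\<lambda>x. f x + c * g x) x = grad \<Omega> f x + c *\<^sub>R grad \<Omega> g x"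
proof -
  note fg = H1_L2[OF assms(1)] H1_L2[OF assms(2)] grad_L2[OF assms(1)] grad_L2[OF assms(2)]
  have w: "is_weak_gradient \<Omega> (\<lambda>x. f x + c * g x) (\<lambda>x. grad \<Omega> f x + c *\<^sub>R grad \<Omega> g x)"
    by (rule weak_gradient_lincomb[OF fg grad_weak[OF assms(1)] grad_weak[OF assms(2)]])
  have L: "(\<lambda>x. grad \<Omega> f x + c *\<^sub>R grad \<Omega> g x) \<in> L2 \<Omega>"
    by (rule L2_add[OF fg(3) L2_scaleR[OF fg(4)]])
  have "(\<lambda>x. f x + c * g x) \<in> L2 \<Omega>"
    by (rule L2_add[OF fg(1) L2_cmult[OF fg(2)]])
  with w L show H1: "(\<lambda>x. f x + c * g x) \<in> H1 \<Omega>"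
    unfolding H1_def by blast
  show "AE x in \<L>. grad \<Omega> (\<lambda>x. f x + c * g x) x = grad \<Omega> f x + c *\<^sub>R grad \<Omega> g x"
    by (rule weak_gradient_unique[OF grad_weak[OF H1] w grad_L2[OF H1] L])
qed

lemma grad_one:
  assumes "v \<in> H1 \<Omega>" "\<And>x. x \<in> \<Omega> \<Longrightarrow> v x = 1"
  shows "AE x in \<L>. grad \<Omega> v x = 0"
proof (rule weak_gradient_unique)
  show "is_weak_gradient \<Omega> v (\<lambda>_. 0)"
    unfolding is_weak_gradient_def
  proof (intro ballI allI)
    fix \<psi> i assume \<psi>: "\<psi> \<in> test_functions \<Omega>"
    have "(LINT x|\<L>. v x * partial_deriv i \<psi> x) = (LINT x|\<L>. partial_deriv i \<psi> x)"
      by (intro Bochner_Integration.integral_cong refl) (simp add: assms(2))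
    then show "(LINT x|\<L>. v x * partial_deriv i \<psi> x) = - (LINT x|\<L>. 0 $ i * \<psi> x)"
      using integral_partial_deriv_test[OF \<psi> open_\<Omega>] by simp
  qed
qed (use assms in \<open>auto intro: grad_weak grad_L2 L2_const\<close>)

lemma grad_zero_imp_const:
  assumes "f \<in> H1 \<Omega>" "AE x in \<L>. grad \<Omega> f x = 0"
  obtains c where "AE x in \<L>. f x = c"
proof (rule weak_gradient_zero_imp_const[OF _ open_\<Omega> connected_\<Omega>])
  show "integrable \<L> f" using assms by (intro L2_integrable H1_L2)
  fix \<psi> i assume \<psi>: "\<psi> \<in> test_functions \<Omega>"
  have "(LINT x|\<L>. grad \<Omega> f x $ i * \<psi> x) = 0"
  proof (rule integral_eq_zero_AE)
    show "AE x in \<L>. grad \<Omega> f x $ i * \<psi> x = 0" using assms(2) by eventually_elim simp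
  qed
  then show "(LINT x|\<L>. f x * partial_deriv i \<psi> x) = 0"
    using grad_weak[OF assms(1)] \<psi> by (simp add: is_weak_gradient_def)
qed

end

section \<open>Representers and discrete dual norms\<close>

lemma fin_dim_space_lincomb:
  assumes "fin_dim_space V" "f \<in> V" "g \<in> V"
  shows "(\<lambda>x. f x + c *\<^sub>R g x) \<in> V"
proof -
  obtain B where V: "V = {\<lambda>x. \<Sum>b\<in>B. c b *\<^sub>R b x |c. True}"
    using assms(1) by (auto simp: fin_dim_space_def)
  obtain cf cg where f: "f = (\<lambda>x. \<Sum>b\<in>B. cf b *\<^sub>R b x)" and g: "g = (\<lambda>x. \<Sum>b\<in>B. cg b *\<^sub>R b x)"
    using assms V by auto
  have "(\<lambda>x. f x + c *\<^sub>R g x) = (\<lambda>x. \<Sum>b\<in>B. (cf b + c * cg b) *\<^sub>R b x)"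
    by (simp add: f g scaleR_add_left sum.distrib scaleR_sum_right)
  then show ?thesis unfolding V by (intro CollectI exI[of _ "\<lambda>b. cf b + c * cg b"] conjI TrueI)
qed

text \<open>Semi-definite on purpose: in the application \<open>a\<close> is a gradient energy, for
  which constants are null.\<close>

locale semi_inner_space =
  fixes V :: "('a \<Rightarrow> real) set" and a :: "('a \<Rightarrow> real) \<Rightarrow> ('a \<Rightarrow> real) \<Rightarrow> real"
  assumes fin_dim: "fin_dim_space V"
    and sym: "f \<in> V \<Longrightarrow> g \<in> V \<Longrightarrow> a f g = a g f"
    and lin: "f \<in> V \<Longrightarrow> g \<in> V \<Longrightarrow> h \<in> V \<Longrightarrow> a (\<lambda>x. f x + c * g x) h = a f h + c * a g h"
    and nonneg: "f \<in> V \<Longrightarrow> a f f \<ge> 0"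
begin

lemma lincomb: "f \<in> V \<Longrightarrow> g \<in> V \<Longrightarrow> (\<lambda>x. f x + c * g x) \<in> V"
  using fin_dim_space_lincomb[OF fin_dim, of f g c] by simp

lemma zero_mem: "(\<lambda>x. 0) \<in> V"
proof -
  obtain B :: "('a \<Rightarrow> real) set" where V: "V = {\<lambda>x. \<Sum>b\<in>B. c b *\<^sub>R b x |c. True}"
    using fin_dim by (auto simp: fin_dim_space_def)
  show ?thesis unfolding V by (auto intro!: exI[of _ "\<lambda>_. 0"])
qed

lemma lin_right: "f \<in> V \<Longrightarrow> g \<in> V \<Longrightarrow> h \<in> V \<Longrightarrow> a h (\<lambda>x. f x + c * g x) = a h f + c * a h g"
  using lin[of f g h c] sym lincomb by simp

lemma quadratic:
  assumes "f \<in> V" "g \<in> V"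
  shows "a (\<lambda>x. f x + t * g x) (\<lambda>x. f x + t * g x) = a f f + 2 * t * a f g + t\<^sup>2 * a g g"
  using assms sym[of f g] by (simp add: lin lin_right lincomb power2_eq_square algebra_simps)

lemma Cauchy_Schwarz:
  assumes "f \<in> V" "g \<in> V"
  shows "(a f g)\<^sup>2 \<le> a f f * a g g"
proof (cases "a g g = 0")
  case True
  have *: "0 \<le> a f f + 2 * t * a f g" for t
    using nonneg[OF lincomb[OF assms, of t]] quadratic[OF assms, of t] True by simp
  have "a f g = 0"
  proof (rule ccontr)
    assume "a f g \<noteq> 0"
    \<comment> \<open>This \<open>t\<close> makes the affine expression
      \<open>a f f + 2 * t * a f g\<close> equal to -1.\<close>
    then have "2 * (- (a f f + 1) / (2 * a f g)) * a f g = - (a f f + 1)" by (simp add: field_simps)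
    then show False using *[of "- (a f f + 1) / (2 * a f g)"] by linarith
  qed
  then show ?thesis using True by simp
next
  case False
  then have pos: "a g g > 0" using nonneg[OF assms(2)] by simp
  \<comment> \<open>The nonnegative quadratic in \<open>t\<close> is evaluated at its
    minimiser.\<close>
  have "0 \<le> a f f + 2 * (- a f g / a g g) * a f g + (- a f g / a g g)\<^sup>2 * a g g"
    using nonneg[OF lincomb[OF assms]] quadratic[OF assms] by metis
  also have "\<dots> = a f f - (a f g)\<^sup>2 / a g g"
    using pos by (simp add: field_simps power2_eq_square)
  finally show ?thesis using pos by (simp add: field_simps)
qed

lemma abs_le_sqrt: "f \<in> V \<Longrightarrow> g \<in> V \<Longrightarrow> \<bar>a f g\<bar> \<le> sqrt (a f f) * sqrt (a g g)"
  by (metis Cauchy_Schwarz real_sqrt_abs real_sqrt_le_iff real_sqrt_mult)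

lemma null_left: "f \<in> V \<Longrightarrow> g \<in> V \<Longrightarrow> a f f = 0 \<Longrightarrow> a f g = 0"
  using Cauchy_Schwarz[of f g] by simp

definition linear_on :: "(('a \<Rightarrow> real) \<Rightarrow> real) \<Rightarrow> bool" where
  "linear_on s \<longleftrightarrow> (\<forall>f\<in>V. \<forall>g\<in>V. \<forall>c. s (\<lambda>x. f x + c * g x) = s f + c * s g)"

lemma linear_onD: "linear_on s \<Longrightarrow> f \<in> V \<Longrightarrow> g \<in> V \<Longrightarrow> s (\<lambda>x. f x + c * g x) = s f + c * s g"
  by (simp add: linear_on_def)

lemma linear_on_zero: "linear_on s \<Longrightarrow> s (\<lambda>x. 0) = 0"
  using linear_onD[of s "\<lambda>x. 0" "\<lambda>x. 0" 1] zero_mem by simp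

lemma sum_mem_linear:
  assumes "finite F" "F \<subseteq> V" "linear_on s"
  shows "(\<lambda>x. \<Sum>b\<in>F. c b * b x) \<in> V \<and> s (\<lambda>x. \<Sum>b\<in>F. c b * b x) = (\<Sum>b\<in>F. c b * s b)"
  using assms(1,2)
proof (induction F rule: finite_induct)
  case empty
  then show ?case using zero_mem linear_on_zero[OF assms(3)] by simp
next
  case (insert b F)
  have "(\<lambda>x. \<Sum>b\<in>insert b F. c b * b x) = (\<lambda>x. (\<Sum>b\<in>F. c b * b x) + c b * b x)"
    using insert by (simp add: add.commute)
  then show ?case using insert lincomb linear_onD[OF assms(3)] by simp
qed

lemma linear_on_left: "f \<in> V \<Longrightarrow> linear_on (a f)"
  by (simp add: linear_on_def lin_right)

text \<open>Gram--Schmidt step: a new vector whose part orthogonal to the previous span is null needs no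
  correction of the representer, because \<open>s\<close> vanishes on that part.\<close>

lemma Riesz_span:
  assumes "finite F" "F \<subseteq> V" "linear_on s" "\<And>l. l \<in> V \<Longrightarrow> a l l = 0 \<Longrightarrow> s l = 0"
  shows "\<exists>c. \<forall>b\<in>F. a (\<lambda>x. \<Sum>b\<in>F. c b * b x) b = s b"
  using assms
proof (induction F arbitrary: s rule: finite_induct)
  case empty
  then show ?case by simp
next
  case (insert b0 F)
  let ?S = "\<lambda>c x. \<Sum>b\<in>F. c b * b x"
  have F: "finite F" "F \<subseteq> V" "b0 \<in> V" using insert by auto
  have SV: "?S c \<in> V" for c using sum_mem_linear[OF F(1,2) linear_on_left[OF zero_mem]] by auto
  have S_lin: "t (?S c) = (\<Sum>b\<in>F. c b * t b)" if "linear_on t" for t c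
    using sum_mem_linear[OF F(1,2) that] by auto
  obtain cw where cw: "\<And>b. b \<in> F \<Longrightarrow> a (?S cw) b = s b"
    using insert.IH[OF F(2) insert.prems(2,3)] by auto
  \<comment> \<open>\<open>?S cp\<close> plays the role of the orthogonal projection of
    \<open>b0\<close> onto the span of \<open>F\<close>. It comes from the induction hypothesis for
    the functional \<open>a b0\<close>, which is why \<open>s\<close> is generalised; the null
    condition holds by Cauchy-Schwarz.\<close>
  obtain cp where cp: "\<And>b. b \<in> F \<Longrightarrow> a (?S cp) b = a b0 b"
  proof -
    have "a b0 l = 0" if "l \<in> V" "a l l = 0" for l
      using null_left[OF that(1) F(3) that(2)] sym[OF F(3) that(1)] by simp
    from insert.IH[OF F(2) linear_on_left[OF F(3)] this] that show ?thesis by auto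
  qed
  define q where "q = (\<lambda>x. b0 x + (- 1) * ?S cp x)"
  have qV: "q \<in> V" unfolding q_def by (intro lincomb F SV)
  have q_orth: "a q b = 0" if "b \<in> F" for b
    using that F SV[of cp] cp[OF that] unfolding q_def by (subst lin) auto
  have q_orth_S: "a q (?S c) = 0" for c
    using S_lin[OF linear_on_left[OF qV], of c] q_orth by simp
  have S_q: "a (?S c) q = 0" for c
    using q_orth_S[of c] sym[OF qV SV[of c]] by simp
  have b0: "t b0 = t q + t (?S cp)" if "linear_on t" for t
    using linear_onD[OF that F(3) SV[of cp], of "- 1"] by (simp add: q_def)
  have S_s: "a (?S cw) (?S cp) = s (?S cp)"
    using S_lin[OF insert.prems(2), of cp] S_lin[OF linear_on_left[OF SV[of cw]], of cp] cw by simp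
  define k where "k = (if a q q = 0 then 0 else s q / a q q)"
  have kq: "k * a q q = s q"
    using insert.prems(3)[OF qV] by (auto simp: k_def)
  define w where "w = (\<lambda>x. ?S cw x + k * q x)"
  have wV: "w \<in> V" unfolding w_def by (intro lincomb SV qV)
  have w_left: "a w l = a (?S cw) l + k * a q l" if "l \<in> V" for l
    unfolding w_def by (rule lin[OF SV qV that])
  have wF: "a w b = s b" if "b \<in> F" for b
    using w_left[of b] that F cw q_orth by auto
  have "a w b0 = a w q + a w (?S cp)" by (rule b0[OF linear_on_left[OF wV]])
  also have "\<dots> = s q + s (?S cp)"
    using w_left[OF qV] w_left[OF SV] S_q q_orth_S S_s kq by simp
  also have "\<dots> = s b0" by (rule b0[OF insert.prems(2), symmetric])
  finally have wb0: "a w b0 = s b0" .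
  \<comment> \<open>The coefficients of \<open>w\<close> over \<open>insert b0 F\<close>, after
    expanding \<open>q\<close> as \<open>b0\<close> minus \<open>?S cp\<close>.\<close>
  define c where "c = (\<lambda>b. if b = b0 then k else cw b - k * cp b)"
  have "(\<Sum>b\<in>F. c b * b x) = ?S cw x - k * ?S cp x" for x
    using insert.hyps(2) unfolding sum_distrib_left sum_subtractf[symmetric]
    by (intro sum.cong) (auto simp: c_def algebra_simps)
  then have "w = (\<lambda>x. \<Sum>b\<in>insert b0 F. c b * b x)"
    using insert.hyps by (simp add: w_def q_def c_def algebra_simps fun_eq_iff)
  then show ?case using wF wb0 by (metis insertE)
qed

lemma Riesz:
  assumes "linear_on s" "\<And>l. l \<in> V \<Longrightarrow> a l l = 0 \<Longrightarrow> s l = 0"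
  obtains w where "w \<in> V" "\<And>l. l \<in> V \<Longrightarrow> a w l = s l"
proof -
  obtain B where B: "finite B" and V: "V = {\<lambda>x. \<Sum>b\<in>B. c b *\<^sub>R b x |c. True}"
    using fin_dim by (auto simp: fin_dim_space_def)
  \<comment> \<open>\<open>B\<close> spans \<open>V\<close> but may be linearly dependent; each
    member is the combination with coefficient 1 at itself.\<close>
  have sub: "B \<subseteq> V"
  proof
    fix b assume "b \<in> B"
    then have "(\<Sum>b'\<in>B. if b' = b then b' x else 0) = b x" for x
      using B by simp
    moreover have "(\<Sum>b'\<in>B. (if b' = b then 1 else 0) *\<^sub>R b' x) = (\<Sum>b'\<in>B. if b' = b then b' x else 0)" for x
      by (intro sum.cong) auto
    ultimately have "b = (\<lambda>x. \<Sum>b'\<in>B. (if b' = b then 1 else 0) *\<^sub>R b' x)"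
      by (simp only:)
    then show "b \<in> V"
      unfolding V by (intro CollectI exI[of _ "\<lambda>b'. if b' = b then 1 else 0"] conjI TrueI)
  qed
  from Riesz_span[OF B sub assms] obtain c where c: "\<And>b. b \<in> B \<Longrightarrow> a (\<lambda>x. \<Sum>b\<in>B. c b * b x) b = s b"
    by auto
  let ?w = "\<lambda>x. \<Sum>b\<in>B. c b * b x"
  have w: "?w \<in> V" using sum_mem_linear[OF B sub assms(1)] by auto
  have "a ?w l = s l" if l: "l \<in> V" for l
  proof -
    obtain d where "l = (\<lambda>x. \<Sum>b\<in>B. d b * b x)" using l V by auto
    then show ?thesis
      using sum_mem_linear[OF B sub assms(1)] sum_mem_linear[OF B sub linear_on_left[OF w]] c by simp
  qed
  with w show ?thesis by (rule that)
qed

end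

locale fe_space = bounded_domain \<Omega> for \<Omega> :: "(real ^ 'd) set" +
  fixes V :: "(real ^ 'd \<Rightarrow> real) set" and y :: real
  assumes conforming: "conforming_H1 \<Omega> V" and y_pos: "y > 0"
begin

lemma V_H1: "f \<in> V \<Longrightarrow> f \<in> H1 \<Omega>" and V_fin_dim: "fin_dim_space V"
  using conforming by (auto simp: conforming_H1_def)

lemma V_L2: "f \<in> V \<Longrightarrow> f \<in> L2 \<Omega>" and V_grad_L2: "f \<in> V \<Longrightarrow> grad \<Omega> f \<in> L2 \<Omega>"
  by (simp_all add: H1_L2 grad_L2 V_H1)

definition en :: "(real ^ 'd \<Rightarrow> real) \<Rightarrow> (real ^ 'd \<Rightarrow> real) \<Rightarrow> real" where
  "en f g = l2_inner \<Omega> (\<lambda>x. y *\<^sub>R grad \<Omega> f x) (grad \<Omega> g)"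

lemma en_alt: "en f g = y * l2_inner \<Omega> (grad \<Omega> f) (grad \<Omega> g)"
  by (simp add: en_def l2_inner_scaleR_left)

lemma l2_inner_grad_lincomb:
  assumes "f \<in> H1 \<Omega>" "g \<in> H1 \<Omega>" "h \<in> L2 \<Omega>"
  shows "l2_inner \<Omega> (grad \<Omega> (\<lambda>x. f x + c * g x)) h = l2_inner \<Omega> (grad \<Omega> f) h + c * l2_inner \<Omega> (grad \<Omega> g) h"
proof -
  note L = grad_L2[OF assms(1)] grad_L2[OF assms(2)] grad_L2[OF H1_lincomb[OF assms(1,2)]]
  have "l2_inner \<Omega> (grad \<Omega> (\<lambda>x. f x + c * g x)) h = l2_inner \<Omega> (\<lambda>x. grad \<Omega> f x + c *\<^sub>R grad \<Omega> g x) h"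
    by (rule l2_inner_cong_AE[OF grad_lincomb[OF assms(1,2)] _ L(3) L2_add[OF L(1) L2_scaleR[OF L(2)]] assms(3,3)]) simp
  also have "\<dots> = l2_inner \<Omega> (grad \<Omega> f) h + c * l2_inner \<Omega> (grad \<Omega> g) h"
    using l2_inner_add_left[OF L(1) L2_scaleR[OF L(2)] assms(3)] by (simp add: l2_inner_scaleR_left)
  finally show ?thesis .
qed

sublocale semi_inner_space V en
proof
  show "en (\<lambda>x. f x + c * g x) h = en f h + c * en g h" if "f \<in> V" "g \<in> V" "h \<in> V" for f g h c
    using that by (simp add: en_alt l2_inner_grad_lincomb V_H1 V_grad_L2 algebra_simps)
  show "en f g = en g f" for f g by (simp add: en_alt l2_inner_commute)
  show "en f f \<ge> 0" for f using y_pos by (simp add: en_alt l2_inner_nonneg)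
qed (rule V_fin_dim)

text \<open>\<open>V\<close> is only known to contain a function that equals 1 on \<Omega>; off
  \<Omega> its values are arbitrary.\<close>

definition one :: "real ^ 'd \<Rightarrow> real" where
  "one = (SOME v. v \<in> V \<and> (\<forall>x\<in>\<Omega>. v x = 1))"

lemma one_mem: "one \<in> V" and one_eq: "x \<in> \<Omega> \<Longrightarrow> one x = 1"
proof -
  have "\<exists>v. v \<in> V \<and> (\<forall>x\<in>\<Omega>. v x = 1)" using conforming by (auto simp: conforming_H1_def)
  then have "one \<in> V \<and> (\<forall>x\<in>\<Omega>. one x = 1)" unfolding one_def by (rule someI_ex)
  then show "one \<in> V" "x \<in> \<Omega> \<Longrightarrow> one x = 1" by auto
qed

lemma l2_inner_one: "l2_inner \<Omega> f one = (LINT x|\<L>. f x)"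
  unfolding l2_inner_def by (intro Bochner_Integration.integral_cong) (auto simp: one_eq)

lemma integral_one_pos: "(LINT x|\<L>. one x) > 0"
proof -
  have "(LINT x|\<L>. one x) = (LINT x|\<L>. 1)"
    by (intro Bochner_Integration.integral_cong) (auto simp: one_eq)
  also have "\<dots> = measure lebesgue \<Omega>"
    using open_\<Omega> by (simp add: measure_restrict_space)
  also have "\<dots> > 0"
    using open_not_negligible[OF open_\<Omega> nonempty_\<Omega>] \<Omega>_lmeasurable
    by (simp add: negligible_iff_measure zero_less_measure_iff)
  finally show ?thesis .
qed

lemma en_one: "l \<in> V \<Longrightarrow> en one l = 0"
proof -
  assume l: "l \<in> V"
  have "AE x in \<L>. grad \<Omega> one x = 0"
    by (rule grad_one[OF V_H1[OF one_mem] one_eq])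
  then have "l2_inner \<Omega> (grad \<Omega> one) (grad \<Omega> l) = l2_inner \<Omega> (\<lambda>_. 0) (grad \<Omega> l)"
    using l by (intro l2_inner_cong_AE V_grad_L2 one_mem L2_const) auto
  then show ?thesis by (simp add: en_alt l2_inner_def)
qed

lemma en_null_imp_const:
  assumes "f \<in> V" "en f f = 0"
  obtains c where "AE x in \<L>. f x = c"
proof -
  have "AE x in \<L>. grad \<Omega> f x = 0"
    using assms y_pos by (intro l2_inner_eq_0_imp V_grad_L2) (auto simp: en_alt)
  with V_H1[OF assms(1)] show ?thesis using grad_zero_imp_const that by blast
qed

text \<open>The compatibility condition of \<open>Riesz\<close>: null functions are constant almost
  everywhere, and a mean-free \<open>\<rho>\<close> annihilates constants. This is where the
  mean-value constraints enter.\<close>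

lemma l2_inner_en_null:
  assumes "f \<in> V" "en f f = 0" "\<rho> \<in> L2 \<Omega>" "(LINT x|\<L>. \<rho> x) = 0"
  shows "l2_inner \<Omega> \<rho> f = 0"
proof -
  obtain c where "AE x in \<L>. f x = c" using en_null_imp_const[OF assms(1,2)] by blast
  then have "l2_inner \<Omega> \<rho> f = l2_inner \<Omega> \<rho> (\<lambda>_. c)"
    using V_L2[OF assms(1)] assms(3) by (intro l2_inner_cong_AE L2_const) auto
  also have "\<dots> = 0" using assms by (simp add: l2_inner_def)
  finally show ?thesis .
qed

lemma linear_on_l2_inner: "\<rho> \<in> L2 \<Omega> \<Longrightarrow> linear_on (l2_inner \<Omega> \<rho>)"
  unfolding linear_on_def
  by (auto simp: l2_inner_add_right[OF V_L2 L2_cmult[OF V_L2]] l2_inner_cmult_right)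

text \<open>\<open>w\<close> solves the discrete Neumann problem -div(y grad w) = \<rho>. Testing
  with all of \<open>V\<close>, constants included, is the form in which the evolution equations
  arrive.\<close>

definition represents :: "(real ^ 'd \<Rightarrow> real) \<Rightarrow> (real ^ 'd \<Rightarrow> real) \<Rightarrow> bool" where
  "represents w \<rho> \<longleftrightarrow> w \<in> V \<and> (\<forall>l\<in>V. en w l = l2_inner \<Omega> \<rho> l)"

lemma represents_exists:
  assumes "\<rho> \<in> L2 \<Omega>" "(LINT x|\<L>. \<rho> x) = 0"
  obtains w where "represents w \<rho>"
proof -
  have "\<exists>w. represents w \<rho>"
    unfolding represents_def
    using Riesz[OF linear_on_l2_inner[OF assms(1)] l2_inner_en_null[OF _ _ assms]] by metis
  then show ?thesis using that by blast
qed

text \<open>Two representers differ by a function of zero energy, that is by a constant almost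
  everywhere, which a mean-free \<open>\<eta>\<close> does not see.\<close>

lemma represents_unique:
  assumes "represents w \<rho>" "represents w' \<rho>" "\<eta> \<in> V" "(LINT x|\<L>. \<eta> x) = 0"
  shows "l2_inner \<Omega> w \<eta> = l2_inner \<Omega> w' \<eta>"
proof -
  let ?d = "\<lambda>x. w x + (- 1) * w' x"
  have V: "w \<in> V" "w' \<in> V" "?d \<in> V"
    using assms lincomb[of w w' "- 1"] by (auto simp: represents_def)
  have "en ?d ?d = en w ?d + (- 1) * en w' ?d" by (rule lin[OF V])
  also have "\<dots> = 0" using assms V by (simp add: represents_def)
  finally have "l2_inner \<Omega> \<eta> ?d = 0"
    by (intro l2_inner_en_null V V_L2 assms)
  moreover have "l2_inner \<Omega> \<eta> ?d = l2_inner \<Omega> \<eta> w + (- 1) * l2_inner \<Omega> \<eta> w'"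
    by (rule linear_onD[OF linear_on_l2_inner[OF V_L2[OF assms(3)]] V(1,2)])
  ultimately show ?thesis
    using l2_inner_commute[of \<eta> w] l2_inner_commute[of \<eta> w'] by linarith
qed

lemma weighted_norm_eq: "weighted_norm \<Omega> y l = sqrt (en l l)"
proof -
  have "l2_inner \<Omega> (\<lambda>x. sqrt y *\<^sub>R grad \<Omega> l x) (\<lambda>x. sqrt y *\<^sub>R grad \<Omega> l x) = en l l"
    unfolding l2_inner_scaleR_left l2_inner_scaleR_right en_alt using y_pos by simp
  then show ?thesis by (simp add: weighted_norm_def l2_norm_def)
qed

text \<open>Cauchy-Schwarz bounds every quotient by the energy norm of \<open>w\<close>. The bound
  is attained at \<open>w\<close> shifted to mean zero, because adding a constant changes no
  energy.\<close>

lemma dual_norm_eq: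
  assumes "represents w \<rho>"
  shows "(dual_norm \<Omega> y V (l2_inner \<Omega> \<rho>))\<^sup>2 = en w w"
proof -
  let ?N = "sqrt (en w w)"
  let ?X = "insert 0 {l2_inner \<Omega> \<rho> l / weighted_norm \<Omega> y l |l. l \<in> mean_zero \<Omega> V \<and> weighted_norm \<Omega> y l \<noteq> 0}"
  have w: "w \<in> V" "\<And>l. l \<in> V \<Longrightarrow> en w l = l2_inner \<Omega> \<rho> l" using assms by (auto simp: represents_def)
  have "Sup ?X = ?N"
  proof (rule cSup_eq_maximum)
    define k where "k = - ((LINT x|\<L>. w x) / (LINT x|\<L>. one x))"
    define w0 where "w0 = (\<lambda>x. w x + k * one x)"
    have w0V: "w0 \<in> V" unfolding w0_def by (intro lincomb w one_mem)
    have "(LINT x|\<L>. w0 x) = (LINT x|\<L>. w x) + k * (LINT x|\<L>. one x)"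
      using w one_mem by (simp add: w0_def L2_integrable V_L2)
    then have mz: "w0 \<in> mean_zero \<Omega> V" using w0V integral_one_pos by (simp add: mean_zero_def k_def)
    have e: "en w w0 = en w w" "en w0 w0 = en w w"
      using en_one[OF w(1)] en_one[OF w0V] w(1) w0V one_mem sym[of w one] sym[of w w0]
      by (auto simp: w0_def lin_right lin lincomb)
    \<comment> \<open>If \<open>w\<close> has zero energy there is no admissible quotient at
      \<open>w0\<close>, and the maximum is the inserted 0.\<close>
    show "?N \<in> ?X"
    proof (cases "en w w = 0")
      case False
      then have "?N = l2_inner \<Omega> \<rho> w0 / weighted_norm \<Omega> y w0"
        using w(2)[OF w0V] e nonneg[OF w(1)] by (simp add: weighted_norm_eq real_div_sqrt)
      moreover have "weighted_norm \<Omega> y w0 \<noteq> 0" using False e nonneg[OF w(1)] by (simp add: weighted_norm_eq)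
      ultimately show ?thesis using mz by blast
    qed simp
    show "r \<le> ?N" if "r \<in> ?X" for r
    proof -
      from that consider "r = 0" | l where "l \<in> V" "weighted_norm \<Omega> y l \<noteq> 0" "r = l2_inner \<Omega> \<rho> l / weighted_norm \<Omega> y l"
        by (auto simp: mean_zero_def)
      then show ?thesis
      proof cases
        case 1
        then show ?thesis using nonneg[OF w(1)] by simp
      next
        case 2
        then have pos: "sqrt (en l l) > 0" using nonneg[of l] by (simp add: weighted_norm_eq)
        have "l2_inner \<Omega> \<rho> l \<le> ?N * sqrt (en l l)"
          using abs_le_sqrt[OF w(1) 2(1)] w(2)[OF 2(1)] by simp
        then show ?thesis using pos 2(3) by (simp add: weighted_norm_eq divide_le_eq)
      qed
    qed
  qed
  then show ?thesis using nonneg[OF w(1)] by (simp add: dual_norm_def)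
qed

end

locale fe_step = fe_space \<Omega> V y for \<Omega> :: "(real ^ 'd) set" and V y +
  fixes v_old S :: "real ^ 'd \<Rightarrow> real" and \<tau> :: real
  assumes v_old: "v_old \<in> V" and S: "S \<in> L2 \<Omega>" and \<tau>: "\<tau> > 0"
begin

definition residual :: "(real ^ 'd \<Rightarrow> real) \<Rightarrow> real ^ 'd \<Rightarrow> real" where
  "residual z = (\<lambda>x. z x - v_old x - \<tau> * S x)"

lemma residual_L2: "z \<in> V \<Longrightarrow> residual z \<in> L2 \<Omega>"
  unfolding residual_def
  by (rule L2_diff[OF L2_diff[OF V_L2 V_L2[OF v_old]] L2_cmult[OF S]])

lemma l2_inner_residual:
  assumes "z \<in> V" "l \<in> L2 \<Omega>"
  shows "l2_inner \<Omega> (residual z) l = l2_inner \<Omega> (\<lambda>x. z x - v_old x) l - \<tau> * l2_inner \<Omega> S l"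
  using l2_inner_diff_left[OF L2_diff[OF V_L2[OF assms(1)] V_L2[OF v_old]] L2_cmult[OF S] assms(2), of \<tau>]
  by (simp only: residual_def l2_inner_cmult_left)

text \<open>Multiplied by \<open>\<tau>\<close>, the constraint says that the residual has mean
  zero, which is the condition under which a representer was constructed.\<close>

lemma affine_space_iff: "z \<in> affine_space \<Omega> V \<tau> v_old S \<longleftrightarrow> z \<in> V \<and> (LINT x|\<L>. residual z x) = 0"
proof (cases "z \<in> V")
  case True
  have "(LINT x|\<L>. residual z x) = (LINT x|\<L>. z x - v_old x) - \<tau> * (LINT x|\<L>. S x)"
    using L2_integrable[OF L2_diff[OF V_L2[OF True] V_L2[OF v_old]]] L2_integrable[OF S]
    by (simp add: residual_def)
  moreover have "(LINT x|\<L>. (z x - v_old x) / \<tau>) = (LINT x|\<L>. z x - v_old x) / \<tau>"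
    by simp
  ultimately show ?thesis using True \<tau> by (auto simp: affine_space_def field_simps)
qed (simp add: affine_space_def)

lemma affine_space_add:
  assumes "z \<in> affine_space \<Omega> V \<tau> v_old S" "\<eta> \<in> V" "(LINT x|\<L>. \<eta> x) = 0"
  shows "(\<lambda>x. z x + t * \<eta> x) \<in> affine_space \<Omega> V \<tau> v_old S"
proof -
  have z: "z \<in> V" "(LINT x|\<L>. residual z x) = 0" using assms affine_space_iff by auto
  have "residual (\<lambda>x. z x + t * \<eta> x) = (\<lambda>x. residual z x + t * \<eta> x)"
    by (simp add: residual_def algebra_simps)
  then show ?thesis
    using z assms lincomb[OF z(1) assms(2), of t] L2_integrable[OF residual_L2[OF z(1)]] L2_integrable[OF V_L2[OF assms(2)]]
    by (simp add: affine_space_iff)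
qed

text \<open>The factor \<open>1 *\<close> presents \<open>z'\<close> as the point
  \<open>t = 1\<close> on the line through \<open>z\<close> in direction
  \<open>\<eta>\<close>.\<close>

lemma affine_space_diff:
  assumes "z \<in> affine_space \<Omega> V \<tau> v_old S" "z' \<in> affine_space \<Omega> V \<tau> v_old S"
  obtains \<eta> where "\<eta> \<in> V" "(LINT x|\<L>. \<eta> x) = 0" "z' = (\<lambda>x. z x + 1 * \<eta> x)"
proof -
  define \<eta> where "\<eta> = (\<lambda>x. z' x + (- 1) * z x)"
  have z: "z \<in> V" "(LINT x|\<L>. residual z x) = 0" "z' \<in> V" "(LINT x|\<L>. residual z' x) = 0"
    using assms affine_space_iff by auto
  have "(LINT x|\<L>. \<eta> x) = (LINT x|\<L>. residual z' x - residual z x)"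
    by (simp add: \<eta>_def residual_def)
  also have "\<dots> = 0"
    using z L2_integrable[OF residual_L2] by simp
  finally have "(LINT x|\<L>. \<eta> x) = 0" .
  moreover have "\<eta> \<in> V" unfolding \<eta>_def by (rule lincomb[OF z(3,1)])
  moreover have "z' = (\<lambda>x. z x + 1 * \<eta> x)" by (simp add: \<eta>_def)
  ultimately show ?thesis by (intro that)
qed

text \<open>Representers depend linearly on the residual: if \<open>p\<close> represents
  \<open>\<eta>\<close>, then \<open>w\<close> plus \<open>t\<close> times \<open>p\<close>
  represents the residual at parameter \<open>t\<close>. Its energy is quadratic in
  \<open>t\<close>, with mixed term \<open>en w p\<close>, equal to (w, \<eta>) by symmetry, and
  with \<open>k\<close> being \<open>en p p\<close>.\<close>

lemma dual_norm_variation: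
  assumes "z \<in> affine_space \<Omega> V \<tau> v_old S" "represents w (residual z)" "\<eta> \<in> V" "(LINT x|\<L>. \<eta> x) = 0"
  obtains k where "k \<ge> 0" "\<And>t. (dual_norm \<Omega> y V (l2_inner \<Omega> (residual (\<lambda>x. z x + t * \<eta> x))))\<^sup>2
      = (dual_norm \<Omega> y V (l2_inner \<Omega> (residual z)))\<^sup>2 + 2 * t * l2_inner \<Omega> w \<eta> + t\<^sup>2 * k"
proof -
  have z: "z \<in> V" using assms affine_space_iff by auto
  obtain p where p: "represents p \<eta>"
    using represents_exists[OF V_L2[OF assms(3)] assms(4)] by blast
  have V: "w \<in> V" "p \<in> V" using assms p by (auto simp: represents_def)
  have wp: "en w p = l2_inner \<Omega> w \<eta>"
    using sym[OF V] p V by (simp add: represents_def l2_inner_commute)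
  have "(dual_norm \<Omega> y V (l2_inner \<Omega> (residual (\<lambda>x. z x + t * \<eta> x))))\<^sup>2
      = (dual_norm \<Omega> y V (l2_inner \<Omega> (residual z)))\<^sup>2 + 2 * t * l2_inner \<Omega> w \<eta> + t\<^sup>2 * en p p" for t
  proof -
    have res: "residual (\<lambda>x. z x + t * \<eta> x) = (\<lambda>x. residual z x + t * \<eta> x)"
      by (simp add: residual_def algebra_simps)
    have "represents (\<lambda>x. w x + t * p x) (residual (\<lambda>x. z x + t * \<eta> x))"
      unfolding represents_def res
    proof (intro conjI ballI lincomb V)
      fix l assume l: "l \<in> V"
      show "en (\<lambda>x. w x + t * p x) l = l2_inner \<Omega> (\<lambda>x. residual z x + t * \<eta> x) l"
        using lin[OF V l, of t] p assms(2) l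
          l2_inner_add_left[OF residual_L2[OF z] L2_cmult[OF V_L2[OF assms(3)]] V_L2[OF l], of t]
        by (simp add: represents_def l2_inner_cmult_left)
    qed
    from dual_norm_eq[OF this] dual_norm_eq[OF assms(2)] quadratic[OF V, of t] wp
    show ?thesis by simp
  qed
  with nonneg[OF V(2)] show ?thesis by (rule that)
qed

definition evolution :: "(real ^ 'd \<Rightarrow> real) \<Rightarrow> (real ^ 'd \<Rightarrow> real) \<Rightarrow> bool" where
  "evolution z \<mu> \<longleftrightarrow> (\<forall>\<eta>\<in>V. l2_inner \<Omega> (\<lambda>x. z x - v_old x) \<eta>
     + \<tau> * l2_inner \<Omega> (\<lambda>x. y *\<^sub>R grad \<Omega> \<mu> x) (grad \<Omega> \<eta>) - \<tau> * l2_inner \<Omega> S \<eta> = 0)"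

lemma evolution_iff:
  assumes "z \<in> V" "\<mu> \<in> V"
  shows "evolution z \<mu> \<longleftrightarrow> represents (\<lambda>x. - \<tau> * \<mu> x) (residual z)"
proof -
  have m: "(\<lambda>x. - \<tau> * \<mu> x) \<in> V" using lincomb[OF zero_mem assms(2), of "- \<tau>"] by simp
  have "en (\<lambda>x. - \<tau> * \<mu> x) l = - \<tau> * en \<mu> l" if "l \<in> V" for l
    using lin[OF zero_mem assms(2) that, of "- \<tau>"] null_left[OF zero_mem that]
      lin[OF zero_mem zero_mem that, of 1] by simp
  then have "l2_inner \<Omega> (\<lambda>x. z x - v_old x) l + \<tau> * en \<mu> l - \<tau> * l2_inner \<Omega> S l = 0
      \<longleftrightarrow> en (\<lambda>x. - \<tau> * \<mu> x) l = l2_inner \<Omega> (residual z) l" if "l \<in> V" for l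
    using that l2_inner_residual[OF assms(1) V_L2[OF that]] by auto
  then show ?thesis
    using m by (simp add: evolution_def represents_def en_def[symmetric])
qed

text \<open>Testing with \<open>one\<close> removes the gradient term and leaves the mean of the
  residual.\<close>

lemma evolution_imp_affine:
  assumes "z \<in> V" "\<mu> \<in> V" "evolution z \<mu>"
  shows "z \<in> affine_space \<Omega> V \<tau> v_old S"
proof -
  have r: "represents (\<lambda>x. - \<tau> * \<mu> x) (residual z)" using evolution_iff assms by simp
  then have "l2_inner \<Omega> (residual z) one = en (\<lambda>x. - \<tau> * \<mu> x) one"
    using one_mem by (simp add: represents_def)
  also have "\<dots> = 0" using r sym[OF _ one_mem] en_one by (simp add: represents_def)
  finally show ?thesis using assms by (simp add: affine_space_iff l2_inner_one)
qed

text \<open>The potential is the representer scaled by \<open>- 1 / \<tau>\<close>; the additive constant left free by the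
  mean-value constraint is fixed by testing with a constant.\<close>

lemma stationary_iff:
  assumes z: "z \<in> affine_space \<Omega> V \<tau> v_old S" and w: "represents w (residual z)" and D: "linear_on D"
  shows "(\<forall>\<eta>\<in>V. (LINT x|\<L>. \<eta> x) = 0 \<longrightarrow> l2_inner \<Omega> w \<eta> / \<tau> + D \<eta> = 0) \<longleftrightarrow>
    (\<exists>\<mu>\<in>V. evolution z \<mu> \<and> (\<forall>\<eta>\<in>V. l2_inner \<Omega> \<mu> \<eta> - D \<eta> = 0))" (is "?L \<longleftrightarrow> ?R")
proof
  have zV: "z \<in> V" using z affine_space_iff by auto
  have wV: "w \<in> V" using w by (simp add: represents_def)
  {
    assume ?R
    then obtain \<mu> where \<mu>: "\<mu> \<in> V" "evolution z \<mu>" "\<And>\<eta>. \<eta> \<in> V \<Longrightarrow> l2_inner \<Omega> \<mu> \<eta> = D \<eta>" by auto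
    show ?L
    proof (intro ballI impI)
      fix \<eta> assume \<eta>: "\<eta> \<in> V" "(LINT x|\<L>. \<eta> x) = 0"
      have "l2_inner \<Omega> w \<eta> = l2_inner \<Omega> (\<lambda>x. - \<tau> * \<mu> x) \<eta>"
        using w \<mu>(2) evolution_iff[OF zV \<mu>(1)] \<eta> by (intro represents_unique) auto
      also have "\<dots> = - \<tau> * D \<eta>" using \<mu>(3)[OF \<eta>(1)] by (simp only: l2_inner_cmult_left)
      finally show "l2_inner \<Omega> w \<eta> / \<tau> + D \<eta> = 0" using \<tau> by (simp add: field_simps)
    qed
  }
  {
    assume L: ?L
    let ?m = "LINT x|\<L>. one x"
    define c where "c = (D one + l2_inner \<Omega> w one / \<tau>) / ?m"
    define \<mu> where "\<mu> = (\<lambda>x. c * one x + (- 1 / \<tau>) * w x)"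
    have cV: "(\<lambda>x. c * one x) \<in> V" using lincomb[OF zero_mem one_mem, of c] by simp
    have \<mu>V: "\<mu> \<in> V" unfolding \<mu>_def by (rule lincomb[OF cV wV])
    have \<mu>_inner: "l2_inner \<Omega> \<mu> \<eta> = c * l2_inner \<Omega> one \<eta> - l2_inner \<Omega> w \<eta> / \<tau>" if "\<eta> \<in> V" for \<eta>
      using l2_inner_add_left[OF V_L2[OF cV] L2_cmult[OF V_L2[OF wV]] V_L2[OF that], of "- 1 / \<tau>"]
      by (simp only: \<mu>_def l2_inner_cmult_left) simp
    have "evolution z \<mu>"
    proof -
      have eq: "(\<lambda>x. - \<tau> * \<mu> x) = (\<lambda>x. w x + (- \<tau> * c) * one x)"
        using \<tau> by (simp add: \<mu>_def algebra_simps)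
      have "represents (\<lambda>x. - \<tau> * \<mu> x) (residual z)"
        unfolding represents_def eq
      proof (intro conjI ballI lincomb wV one_mem)
        fix l assume l: "l \<in> V"
        show "en (\<lambda>x. w x + (- \<tau> * c) * one x) l = l2_inner \<Omega> (residual z) l"
          using lin[OF wV one_mem l, of "- \<tau> * c"] en_one[OF l] w l by (simp add: represents_def)
      qed
      then show ?thesis using evolution_iff[OF zV \<mu>V] by simp
    qed
    moreover have "l2_inner \<Omega> \<mu> \<eta> - D \<eta> = 0" if \<eta>: "\<eta> \<in> V" for \<eta>
    proof -
      have lin\<mu>: "linear_on (\<lambda>\<eta>. l2_inner \<Omega> \<mu> \<eta>)" using \<mu>V by (intro linear_on_l2_inner V_L2)
      \<comment> \<open>A test function splits into a mean-free part, governed by the assumption,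
        and a multiple of \<open>one\<close>, governed by the choice of \<open>c\<close>.\<close>
      define k where "k = (LINT x|\<L>. \<eta> x) / ?m"
      define \<eta>0 where "\<eta>0 = (\<lambda>x. \<eta> x + (- k) * one x)"
      have \<eta>0: "\<eta>0 \<in> V" unfolding \<eta>0_def by (rule lincomb[OF \<eta> one_mem])
      have "(LINT x|\<L>. \<eta>0 x) = (LINT x|\<L>. \<eta> x) + (- k) * ?m"
        using L2_integrable[OF V_L2[OF \<eta>]] L2_integrable[OF V_L2[OF one_mem]] by (simp add: \<eta>0_def)
      then have mean: "(LINT x|\<L>. \<eta>0 x) = 0" using integral_one_pos by (simp add: k_def)
      have "l2_inner \<Omega> w \<eta>0 / \<tau> + D \<eta>0 = 0" using L \<eta>0 mean by blast
      moreover have "l2_inner \<Omega> one \<eta>0 = 0"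
        using mean l2_inner_one[of \<eta>0] l2_inner_commute[of one \<eta>0] by simp
      ultimately have "l2_inner \<Omega> \<mu> \<eta>0 = D \<eta>0"
        using \<mu>_inner[OF \<eta>0] by simp
      moreover have "l2_inner \<Omega> \<mu> one = D one"
        using \<mu>_inner[OF one_mem] l2_inner_one[of one] integral_one_pos by (simp add: c_def)
      moreover have "l2_inner \<Omega> \<mu> \<eta>0 = l2_inner \<Omega> \<mu> \<eta> + (- k) * l2_inner \<Omega> \<mu> one"
        unfolding \<eta>0_def by (rule linear_onD[OF lin\<mu> \<eta> one_mem])
      moreover have "D \<eta>0 = D \<eta> + (- k) * D one"
        unfolding \<eta>0_def by (rule linear_onD[OF D \<eta> one_mem])
      ultimately show ?thesis by simp
    qed
    ultimately show ?R using \<mu>V by blast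
  }
qed

end

section \<open>First variation of the energy\<close>

text \<open>The last assumption bounds the difference quotients by \<open>K\<close>, so dominated
  convergence applies along every sequence of parameters tending to 0.\<close>

lemma DERIV_integral_dominated:
  fixes F :: "real \<Rightarrow> 'a \<Rightarrow> real"
  assumes int: "\<And>t. \<bar>t\<bar> \<le> 1 \<Longrightarrow> integrable N (F t)"
    and der: "\<And>x. ((\<lambda>t. F t x) has_field_derivative F' x) (at 0)"
    and meas: "F' \<in> borel_measurable N"
    and K: "integrable N K" "\<And>t x. \<bar>t\<bar> \<le> 1 \<Longrightarrow> \<bar>F t x - F 0 x\<bar> \<le> \<bar>t\<bar> * K x"
  shows "((\<lambda>t. LINT x|N. F t x) has_field_derivative (LINT x|N. F' x)) (at 0)"
  unfolding DERIV_def tendsto_at_iff_sequentially comp_def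
proof (intro allI impI)
  fix X :: "nat \<Rightarrow> real" assume X0: "\<forall>n. X n \<in> UNIV - {0}" and X: "X \<longlonglongrightarrow> 0"
  \<comment> \<open>Bounds are available for \<bar>t\<bar> \<le> 1 only; terms with a larger
    parameter are set to 0, which the limit ignores.\<close>
  define s where "s n x = (if \<bar>X n\<bar> \<le> 1 then (F (X n) x - F 0 x) / X n else 0)" for n x
  have "\<forall>\<^sub>F n in sequentially. dist (X n) 0 < 1" using X by (rule tendstoD) simp
  then have ev: "\<forall>\<^sub>F n in sequentially. \<bar>X n\<bar> \<le> 1" by eventually_elim simp
  have K0: "0 \<le> K x" for x using K(2)[of 1 x] by (auto intro: order_trans[OF abs_ge_zero])
  have "(\<lambda>n. LINT x|N. s n x) \<longlonglongrightarrow> (LINT x|N. F' x)"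
  proof (rule integral_dominated_convergence[OF meas _ K(1)])
    show "s n \<in> borel_measurable N" for n
      using borel_measurable_integrable[OF int[of "X n"]] borel_measurable_integrable[OF int[of 0]]
      by (cases "\<bar>X n\<bar> \<le> 1") (simp_all add: s_def[abs_def])
    show "AE x in N. (\<lambda>n. s n x) \<longlonglongrightarrow> F' x"
    proof (rule AE_I2)
      fix x
      have "((\<lambda>h. (F (0 + h) x - F 0 x) / h) \<longlongrightarrow> F' x) (at 0)"
        using der[of x] by (simp add: DERIV_def)
      then have "(\<lambda>n. (F (0 + X n) x - F 0 x) / X n) \<longlonglongrightarrow> F' x"
        using X0 X unfolding tendsto_at_iff_sequentially comp_def by blast
      then show "(\<lambda>n. s n x) \<longlonglongrightarrow> F' x"
        by (rule Lim_transform_eventually) (use ev in \<open>eventually_elim, simp add: s_def\<close>)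
    qed
    show "AE x in N. norm (s n x) \<le> K x" for n
    proof (rule AE_I2)
      fix x
      show "norm (s n x) \<le> K x"
      proof (cases "\<bar>X n\<bar> \<le> 1")
        case True
        moreover have "X n \<noteq> 0" using X0 by simp
        ultimately show ?thesis
          using K(2)[OF True, of x] by (simp add: s_def abs_divide divide_le_eq mult.commute)
      qed (simp add: s_def K0)
    qed
  qed
  then show "(\<lambda>n. ((LINT x|N. F (0 + X n) x) - (LINT x|N. F 0 x)) / X n) \<longlonglongrightarrow> (LINT x|N. F' x)"
    by (rule Lim_transform_eventually) (use ev in \<open>eventually_elim, simp add: s_def int\<close>)
qed

lemma bounded_linear_tensor_apply: "bounded_linear (tensor_apply C)"
  unfolding linear_conv_bounded_linear[symmetric]
  by (intro linearI)
     (simp_all add: tensor_apply_def vec_eq_iff sum.distrib algebra_simps sum_distrib_left)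

text \<open>The major symmetry of \<open>C\<close> exchanges the index pairs (i,j) and (k,l), once
  the sums are swapped accordingly.\<close>

lemma tensor_apply_symmetric:
  fixes a b :: "real ^ 'd ^ 'd"
  assumes "elasticity_symmetries C"
  shows "a \<bullet> tensor_apply C b = tensor_apply C a \<bullet> b"
proof -
  have sym: "C $ i $ j $ k $ l = C $ k $ l $ i $ j" for i j k l
    using assms by (simp add: elasticity_symmetries_def)
  have "a \<bullet> tensor_apply C b
      = (\<Sum>i\<in>UNIV. \<Sum>j\<in>UNIV. \<Sum>k\<in>UNIV. \<Sum>l\<in>UNIV. a $ i $ j * (C $ i $ j $ k $ l * b $ k $ l))"
    by (simp add: inner_vec_def tensor_apply_def sum_distrib_left)
  also have "\<dots> = (\<Sum>i\<in>UNIV. \<Sum>k\<in>UNIV. \<Sum>j\<in>UNIV. \<Sum>l\<in>UNIV. a $ i $ j * (C $ i $ j $ k $ l * b $ k $ l))"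
    by (rule sum.cong[OF refl], rule sum.swap)
  also have "\<dots> = (\<Sum>k\<in>UNIV. \<Sum>i\<in>UNIV. \<Sum>j\<in>UNIV. \<Sum>l\<in>UNIV. a $ i $ j * (C $ i $ j $ k $ l * b $ k $ l))"
    by (rule sum.swap)
  also have "\<dots> = (\<Sum>k\<in>UNIV. \<Sum>i\<in>UNIV. \<Sum>l\<in>UNIV. \<Sum>j\<in>UNIV. a $ i $ j * (C $ i $ j $ k $ l * b $ k $ l))"
    by (rule sum.cong[OF refl], rule sum.cong[OF refl], rule sum.swap)
  also have "\<dots> = (\<Sum>k\<in>UNIV. \<Sum>l\<in>UNIV. \<Sum>i\<in>UNIV. \<Sum>j\<in>UNIV. a $ i $ j * (C $ i $ j $ k $ l * b $ k $ l))"
    by (rule sum.cong[OF refl], rule sum.swap)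
  also have "\<dots> = (\<Sum>k\<in>UNIV. \<Sum>l\<in>UNIV. \<Sum>i\<in>UNIV. \<Sum>j\<in>UNIV. (C $ k $ l $ i $ j * a $ i $ j) * b $ k $ l)"
    using sym by (intro sum.cong refl) (simp add: algebra_simps)
  also have "\<dots> = tensor_apply C a \<bullet> b"
    by (simp add: inner_vec_def tensor_apply_def sum_distrib_right)
  finally show ?thesis .
qed

context bounded_domain
begin

lemma L2_sum: "finite I \<Longrightarrow> (\<And>i. i \<in> I \<Longrightarrow> g i \<in> L2 \<Omega>) \<Longrightarrow> (\<lambda>x. \<Sum>i\<in>I. g i x :: 'b::euclidean_space) \<in> L2 \<Omega>"
proof (induction I rule: finite_induct)
  case empty
  then show ?case using L2_const[of "0::'b"] by simp
next
  case (insert i I)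
  then show ?case using L2_add[of "g i" "\<lambda>x. \<Sum>i\<in>I. g i x"] by simp
qed

lemma L2_vec:
  fixes g :: "'n::finite \<Rightarrow> real ^ 'd \<Rightarrow> 'b::euclidean_space"
  assumes "\<And>i. g i \<in> L2 \<Omega>"
  shows "(\<lambda>x. \<chi> i. g i x) \<in> L2 \<Omega>"
proof -
  have "bounded_linear (\<lambda>y :: 'b. axis i y)" for i :: 'n
    unfolding linear_conv_bounded_linear[symmetric]
    by (intro linearI) (simp_all add: axis_def vec_eq_iff)
  then have "(\<lambda>x. \<Sum>i\<in>UNIV. axis i (g i x)) \<in> L2 \<Omega>"
    by (intro L2_sum finite L2_bounded_linear[OF _ assms])
  moreover have "(\<lambda>x. \<Sum>i\<in>UNIV. axis i (g i x)) = (\<lambda>x. \<chi> i. g i x)"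
    by (simp add: fun_eq_iff vec_eq_iff axis_def if_distrib cong: if_cong)
  ultimately show ?thesis by simp
qed

definition H1_vec :: "(real ^ 'd \<Rightarrow> real ^ 'd) set" where
  "H1_vec = {u. \<forall>i. (\<lambda>x. u x $ i) \<in> H1 \<Omega>}"

lemma H10_vec_subset: "H10_vec \<Omega> \<subseteq> H1_vec"
  by (auto simp: H10_vec_def H1_vec_def H10_def)

lemma H1_vec_L2: "u \<in> H1_vec \<Longrightarrow> u \<in> L2 \<Omega>"
  using L2_vec[of "\<lambda>i x. u x $ i"] by (simp add: H1_vec_def H1_L2)

lemma vgrad_L2: "u \<in> H1_vec \<Longrightarrow> vgrad \<Omega> u \<in> L2 \<Omega>"
  unfolding vgrad_def[abs_def] by (intro L2_vec grad_L2) (simp add: H1_vec_def)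

lemma vgrad_lincomb:
  assumes "u \<in> H1_vec" "v \<in> H1_vec"
  shows "AE x in \<L>. vgrad \<Omega> (\<lambda>x. u x + t *\<^sub>R v x) x = vgrad \<Omega> u x + t *\<^sub>R vgrad \<Omega> v x"
proof -
  have "AE x in \<L>. grad \<Omega> (\<lambda>x. u x $ i + t * v x $ i) x
      = grad \<Omega> (\<lambda>x. u x $ i) x + t *\<^sub>R grad \<Omega> (\<lambda>x. v x $ i) x" for i
    using assms by (intro grad_lincomb) (auto simp: H1_vec_def)
  then have "AE x in \<L>. \<forall>i. grad \<Omega> (\<lambda>x. u x $ i + t * v x $ i) x
      = grad \<Omega> (\<lambda>x. u x $ i) x + t *\<^sub>R grad \<Omega> (\<lambda>x. v x $ i) x"
    by (subst AE_all_countable) auto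
  then show ?thesis by eventually_elim (simp add: vgrad_def vec_eq_iff)
qed

lemma H1_vec_lincomb: "u \<in> H1_vec \<Longrightarrow> v \<in> H1_vec \<Longrightarrow> (\<lambda>x. u x + t *\<^sub>R v x) \<in> H1_vec"
  by (simp add: H1_vec_def H1_lincomb)

lemma bounded_linear_sym: "bounded_linear (\<lambda>A :: real ^ 'd ^ 'd. (1/2) *\<^sub>R (A + transpose A))"
  unfolding linear_conv_bounded_linear[symmetric]
  by (intro linearI) (simp_all add: transpose_def vec_eq_iff algebra_simps)

lemma bounded_linear_trace: "bounded_linear (trace :: real ^ 'd ^ 'd \<Rightarrow> real)"
  unfolding linear_conv_bounded_linear[symmetric]
  by (intro linearI) (simp_all add: trace_def sum.distrib sum_distrib_left)

lemma strain_L2: "u \<in> H1_vec \<Longrightarrow> strain \<Omega> u \<in> L2 \<Omega>"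
  unfolding strain_def[abs_def] by (intro L2_bounded_linear[OF bounded_linear_sym] vgrad_L2)

lemma dvg_L2: "u \<in> H1_vec \<Longrightarrow> dvg \<Omega> u \<in> L2 \<Omega>"
  unfolding dvg_def[abs_def] by (intro L2_bounded_linear[OF bounded_linear_trace] vgrad_L2)

lemma strain_lincomb:
  assumes "u \<in> H1_vec" "v \<in> H1_vec"
  shows "AE x in \<L>. strain \<Omega> (\<lambda>x. u x + t *\<^sub>R v x) x = strain \<Omega> u x + t *\<^sub>R strain \<Omega> v x"
  using vgrad_lincomb[OF assms, of t]
  by eventually_elim (simp add: strain_def transpose_def vec_eq_iff algebra_simps)

lemma dvg_lincomb:
  assumes "u \<in> H1_vec" "v \<in> H1_vec"
  shows "AE x in \<L>. dvg \<Omega> (\<lambda>x. u x + t *\<^sub>R v x) x = dvg \<Omega> u x + t * dvg \<Omega> v x"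
  using vgrad_lincomb[OF assms, of t]
  by eventually_elim (simp add: dvg_def trace_def sum.distrib sum_distrib_left)

lemma DERIV_l2_inner_quadratic:
  fixes f g :: "real ^ 'd \<Rightarrow> 'b::euclidean_space"
  assumes "f \<in> L2 \<Omega>" "g \<in> L2 \<Omega>"
  shows "((\<lambda>t. l2_inner \<Omega> (\<lambda>x. f x + t *\<^sub>R g x) (\<lambda>x. f x + t *\<^sub>R g x))
    has_field_derivative 2 * l2_inner \<Omega> f g) (at 0)"
proof -
  have "l2_inner \<Omega> (\<lambda>x. f x + t *\<^sub>R g x) (\<lambda>x. f x + t *\<^sub>R g x)
      = l2_inner \<Omega> f f + 2 * t * l2_inner \<Omega> f g + t\<^sup>2 * l2_inner \<Omega> g g" for t
    using assms l2_inner_commute[of g f]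
    by (simp add: l2_inner_add_left l2_inner_add_right L2_add L2_scaleR l2_inner_scaleR_left
        l2_inner_scaleR_right power2_eq_square algebra_simps)
  then show ?thesis by (auto intro!: derivative_eq_intros)
qed

lemma L2_lipschitz:
  fixes g :: "real \<Rightarrow> 'b::euclidean_space"
  assumes "L-lipschitz_on UNIV g" "v \<in> L2 \<Omega>"
  shows "(\<lambda>x. g (v x)) \<in> L2 \<Omega>"
proof (rule L2_affine_bound[OF _ assms(2)])
  show "(\<lambda>x. g (v x)) \<in> borel_measurable \<L>"
    using assms by (intro borel_measurable_continuous_on[of g] lipschitz_on_continuous_on L2_measurable)
  show "norm (g (v x)) \<le> norm (g 0) + L * norm (v x)" for x
    using lipschitz_onD[OF assms(1), of "v x" 0] norm_triangle_ineq2[of "g (v x)" "g 0"]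
    by (simp add: dist_norm)
qed

end

text \<open>A fixed sequence of quotients is what both measurability and the Lipschitz bound of the
  derivative are read off from.\<close>

lemma vector_derivative_quotient_tendsto:
  fixes g :: "real \<Rightarrow> 'b::real_normed_vector"
  assumes "g differentiable at s"
  shows "(\<lambda>n. (g (s + inverse (real (Suc n))) - g s) /\<^sub>R inverse (real (Suc n)))
           \<longlonglongrightarrow> vector_derivative g (at s)"
proof -
  have "(g has_vector_derivative vector_derivative g (at s)) (at s)"
    using assms by (simp add: vector_derivative_works[symmetric])
  then have "((\<lambda>h. norm (g (s + h) - g s - h *\<^sub>R vector_derivative g (at s)) / norm h) \<longlongrightarrow> 0) (at 0)"
    by (simp add: has_vector_derivative_def has_derivative_at)
  moreover have "norm (g (s + h) - g s - h *\<^sub>R vector_derivative g (at s)) / norm h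
      = norm ((g (s + h) - g s) /\<^sub>R h - vector_derivative g (at s))" if "h \<noteq> 0" for h
  proof -
    have "(g (s + h) - g s) /\<^sub>R h - vector_derivative g (at s)
        = (g (s + h) - g s - h *\<^sub>R vector_derivative g (at s)) /\<^sub>R h"
      using that by (simp add: scaleR_diff_right)
    then show ?thesis by (simp add: divide_inverse mult.commute)
  qed
  ultimately have "((\<lambda>h. norm ((g (s + h) - g s) /\<^sub>R h - vector_derivative g (at s))) \<longlongrightarrow> 0) (at 0)"
    by (elim Lim_transform_eventually) (auto simp: eventually_at_filter)
  then have "((\<lambda>h. (g (s + h) - g s) /\<^sub>R h) \<longlongrightarrow> vector_derivative g (at s)) (at 0)"
    by (rule LIM_zero_cancel[OF tendsto_norm_zero_cancel])
  moreover have "filterlim (\<lambda>n. inverse (real (Suc n))) (at 0) sequentially"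
    by (intro filterlim_atI LIMSEQ_inverse_real_of_nat) auto
  ultimately show ?thesis by (rule filterlim_compose)
qed

text \<open>The derivative may be discontinuous, but it is a pointwise limit of continuous
  quotients.\<close>

lemma vector_derivative_measurable:
  fixes g :: "real \<Rightarrow> 'b::euclidean_space"
  assumes "\<And>s. g differentiable at s"
  shows "(\<lambda>s. vector_derivative g (at s)) \<in> borel_measurable borel"
proof (rule borel_measurable_LIMSEQ_metric)
  have "continuous_on UNIV g"
    using assms by (intro differentiable_imp_continuous_on) (simp add: differentiable_on_def)
  then have [measurable]: "g \<in> borel_measurable borel" by (rule borel_measurable_continuous_onI)
  show "(\<lambda>s. (g (s + inverse (real (Suc n))) - g s) /\<^sub>R inverse (real (Suc n))) \<in> borel_measurable borel" for n
    by measurable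
  show "(\<lambda>n. (g (s + inverse (real (Suc n))) - g s) /\<^sub>R inverse (real (Suc n)))
           \<longlonglongrightarrow> vector_derivative g (at s)" for s
    by (rule vector_derivative_quotient_tendsto[OF assms])
qed

lemma vector_derivative_lipschitz_bound:
  fixes g :: "real \<Rightarrow> 'b::real_normed_vector"
  assumes "g differentiable at s" "L-lipschitz_on UNIV g"
  shows "norm (vector_derivative g (at s)) \<le> L"
proof (rule tendsto_upperbound[OF tendsto_norm[OF vector_derivative_quotient_tendsto[OF assms(1)]]])
  have bound: "norm ((g (s + h) - g s) /\<^sub>R h) \<le> L" if "h > 0" for h
    using lipschitz_onD[OF assms(2), of "s + h" s] that
    by (simp add: dist_norm divide_simps mult.commute)
  then show "\<forall>\<^sub>F n in sequentially. norm ((g (s + inverse (real (Suc n))) - g s) /\<^sub>R inverse (real (Suc n))) \<le> L"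
    by (intro always_eventually allI bound) simp
qed auto

locale material = bounded_domain \<Omega> for \<Omega> :: "(real ^ 'd) set" +
  fixes \<gamma> ell M \<alpha> LT L\<Psi> :: real and C :: "real ^ 'd ^ 'd ^ 'd ^ 'd" and T :: "real \<Rightarrow> real ^ 'd ^ 'd"
    and \<Psi>c :: "real \<Rightarrow> real"
  assumes symC: "elasticity_symmetries C"
    and T_lip: "LT-lipschitz_on UNIV T" and T_diff: "\<And>s. T differentiable at s"
    and \<Psi>c_diff: "\<And>s. \<Psi>c differentiable at s" and \<Psi>c_lip: "L\<Psi>-lipschitz_on UNIV (deriv \<Psi>c)"
begin

definition elastic where "elastic \<phi> u x = strain \<Omega> u x - T (\<phi> x)"
definition volumetric where "volumetric u \<theta> x = \<theta> x - \<alpha> * dvg \<Omega> u x" for \<theta> x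

abbreviation T' where "T' s \<equiv> vector_derivative T (at s)"

lemma elastic_L2: "u \<in> H1_vec \<Longrightarrow> \<phi> \<in> L2 \<Omega> \<Longrightarrow> elastic \<phi> u \<in> L2 \<Omega>"
  unfolding elastic_def[abs_def] by (rule L2_diff[OF strain_L2 L2_lipschitz[OF T_lip]])

lemma volumetric_L2: "u \<in> H1_vec \<Longrightarrow> \<theta> \<in> L2 \<Omega> \<Longrightarrow> volumetric u \<theta> \<in> L2 \<Omega>"
  unfolding volumetric_def[abs_def] by (rule L2_diff[OF _ L2_cmult[OF dvg_L2]])

lemma C_L2: "A \<in> L2 \<Omega> \<Longrightarrow> (\<lambda>x. tensor_apply C (A x)) \<in> L2 \<Omega>"
  by (rule L2_bounded_linear[OF bounded_linear_tensor_apply])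

lemma T'_bound: "norm (T' s) \<le> LT"
  by (rule vector_derivative_lipschitz_bound[OF T_diff T_lip])

lemma coupling_L2:
  assumes "\<phi> \<in> L2 \<Omega>" "A \<in> L2 \<Omega>"
  shows "(\<lambda>x. T' (\<phi> x) \<bullet> A x) \<in> L2 \<Omega>"
proof (rule L2_affine_bound[OF _ assms(2)])
  show "(\<lambda>x. T' (\<phi> x) \<bullet> A x) \<in> borel_measurable \<L>"
    using assms by (intro borel_measurable_inner L2_measurable
        measurable_compose[OF L2_measurable vector_derivative_measurable[OF T_diff]])
  show "norm (T' (\<phi> x) \<bullet> A x) \<le> 0 + LT * norm (A x)" for x
    using Cauchy_Schwarz_ineq2[of "T' (\<phi> x)" "A x"] mult_right_mono[OF T'_bound norm_ge_zero, of "\<phi> x" "A x"]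
    by simp
qed

lemma \<Psi>c_DERIV: "(\<Psi>c has_field_derivative deriv \<Psi>c s) (at s)"
  using \<Psi>c_diff[of s] by (metis DERIV_imp_deriv real_differentiable_def)

text \<open>Mean value theorem and Lipschitz bound of the derivative. With \<open>s = 0\<close> it
  gives the quadratic growth of \<Psi>c, with general \<open>s\<close> the domination for
  differentiating its integral.\<close>

lemma \<Psi>c_increment: "\<bar>\<Psi>c (s + h) - \<Psi>c s\<bar> \<le> \<bar>h\<bar> * (\<bar>deriv \<Psi>c s\<bar> + L\<Psi> * \<bar>h\<bar>)"
proof (cases "h = 0")
  case False
  have "\<exists>z. \<bar>z - s\<bar> \<le> \<bar>h\<bar> \<and> \<Psi>c (s + h) - \<Psi>c s = h * deriv \<Psi>c z"
  proof (cases "h > 0")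
    case True
    then obtain z where "s < z" "z < s + h" "\<Psi>c (s + h) - \<Psi>c s = (s + h - s) * deriv \<Psi>c z"
      using MVT2[of s "s + h" \<Psi>c "deriv \<Psi>c"] \<Psi>c_DERIV by auto
    then show ?thesis by (intro exI[of _ z]) auto
  next
    case neg: False
    then obtain z where "s + h < z" "z < s" "\<Psi>c s - \<Psi>c (s + h) = (s - (s + h)) * deriv \<Psi>c z"
      using MVT2[of "s + h" s \<Psi>c "deriv \<Psi>c"] \<Psi>c_DERIV False by auto
    then show ?thesis by (intro exI[of _ z]) (auto simp: algebra_simps)
  qed
  then obtain z where z: "\<bar>z - s\<bar> \<le> \<bar>h\<bar>" "\<Psi>c (s + h) - \<Psi>c s = h * deriv \<Psi>c z" by auto
  have "\<bar>deriv \<Psi>c z - deriv \<Psi>c s\<bar> \<le> L\<Psi> * \<bar>z - s\<bar>"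
    using lipschitz_onD[OF \<Psi>c_lip, of z s] by (simp add: dist_real_def)
  also have "\<dots> \<le> L\<Psi> * \<bar>h\<bar>"
    using z(1) lipschitz_on_nonneg[OF \<Psi>c_lip] by (rule mult_left_mono)
  finally have "\<bar>deriv \<Psi>c z\<bar> \<le> \<bar>deriv \<Psi>c s\<bar> + L\<Psi> * \<bar>h\<bar>" by linarith
  then show ?thesis unfolding z(2) abs_mult by (intro mult_left_mono) auto
qed simp

lemma \<Psi>c'_L2: "\<phi> \<in> L2 \<Omega> \<Longrightarrow> (\<lambda>x. deriv \<Psi>c (\<phi> x)) \<in> L2 \<Omega>"
  by (rule L2_lipschitz[OF \<Psi>c_lip])

lemma abs_L2: "f \<in> L2 \<Omega> \<Longrightarrow> (\<lambda>x. \<bar>f x :: real\<bar>) \<in> L2 \<Omega>"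
  using L2_norm[of f] by simp

lemma \<Psi>c_integrable:
  assumes "\<phi> \<in> L2 \<Omega>"
  shows "integrable \<L> (\<lambda>x. \<Psi>c (\<phi> x))"
proof (rule Bochner_Integration.integrable_bound)
  show "integrable \<L> (\<lambda>x. \<bar>\<Psi>c 0\<bar> + \<bar>\<phi> x\<bar> * (\<bar>deriv \<Psi>c 0\<bar> + L\<Psi> * \<bar>\<phi> x\<bar>))"
    using assms
    by (intro Bochner_Integration.integrable_add integrable_const_\<L> integrable_mult_L2 abs_L2 L2_add L2_const L2_cmult)
  have "continuous_on UNIV \<Psi>c"
    using \<Psi>c_DERIV by (auto intro!: continuous_at_imp_continuous_on DERIV_isCont)
  then show "(\<lambda>x. \<Psi>c (\<phi> x)) \<in> borel_measurable \<L>"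
    using assms by (intro borel_measurable_continuous_on[of \<Psi>c] L2_measurable)
  have "\<bar>\<Psi>c (\<phi> x)\<bar> \<le> \<bar>\<Psi>c 0\<bar> + \<bar>\<phi> x\<bar> * (\<bar>deriv \<Psi>c 0\<bar> + L\<Psi> * \<bar>\<phi> x\<bar>)" for x
    using \<Psi>c_increment[of 0 "\<phi> x"] by simp
  then show "AE x in \<L>. norm (\<Psi>c (\<phi> x)) \<le> norm (\<bar>\<Psi>c 0\<bar> + \<bar>\<phi> x\<bar> * (\<bar>deriv \<Psi>c 0\<bar> + L\<Psi> * \<bar>\<phi> x\<bar>))"
    by (intro AE_I2) (simp add: order_trans[OF _ abs_ge_self])
qed

lemma \<Psi>c_integral_DERIV:
  assumes \<phi>: "\<phi> \<in> L2 \<Omega>" and \<eta>: "\<eta> \<in> L2 \<Omega>"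
  shows "((\<lambda>t. LINT x|\<L>. \<Psi>c (\<phi> x + t * \<eta> x)) has_field_derivative
           l2_inner \<Omega> (\<lambda>x. deriv \<Psi>c (\<phi> x)) \<eta>) (at 0)"
  unfolding l2_inner_def inner_real_def
proof (rule DERIV_integral_dominated)
  show "integrable \<L> (\<lambda>x. \<Psi>c (\<phi> x + t * \<eta> x))" for t
    using \<phi> \<eta> by (intro \<Psi>c_integrable L2_add L2_cmult)
  show "((\<lambda>t. \<Psi>c (\<phi> x + t * \<eta> x)) has_field_derivative deriv \<Psi>c (\<phi> x) * \<eta> x) (at 0)" for x
  proof -
    have "((\<lambda>t. \<phi> x + t * \<eta> x) has_field_derivative \<eta> x) (at 0)"
      by (auto intro!: derivative_eq_intros)
    then show ?thesis
      using DERIV_chain2[of \<Psi>c "deriv \<Psi>c (\<phi> x)" "\<lambda>t. \<phi> x + t * \<eta> x" 0 "\<eta> x" UNIV] \<Psi>c_DERIV[of "\<phi> x"]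
      by simp
  qed
  show "(\<lambda>x. deriv \<Psi>c (\<phi> x) * \<eta> x) \<in> borel_measurable \<L>"
    by (rule borel_measurable_integrable[OF integrable_mult_L2[OF \<Psi>c'_L2[OF \<phi>] \<eta>]])
  show "integrable \<L> (\<lambda>x. \<bar>\<eta> x\<bar> * (\<bar>deriv \<Psi>c (\<phi> x)\<bar> + L\<Psi> * \<bar>\<eta> x\<bar>))"
    by (rule integrable_mult_L2[OF abs_L2[OF \<eta>] L2_add[OF abs_L2[OF \<Psi>c'_L2[OF \<phi>]] L2_cmult[OF abs_L2[OF \<eta>]]]])
  show "\<bar>\<Psi>c (\<phi> x + t * \<eta> x) - \<Psi>c (\<phi> x + 0 * \<eta> x)\<bar> \<le> \<bar>t\<bar> * (\<bar>\<eta> x\<bar> * (\<bar>deriv \<Psi>c (\<phi> x)\<bar> + L\<Psi> * \<bar>\<eta> x\<bar>))"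
    if t: "\<bar>t\<bar> \<le> 1" for t x
  proof -
    have "\<bar>t\<bar> * \<bar>\<eta> x\<bar> \<le> 1 * \<bar>\<eta> x\<bar>" using t by (intro mult_right_mono) auto
    then have "L\<Psi> * \<bar>t * \<eta> x\<bar> \<le> L\<Psi> * \<bar>\<eta> x\<bar>"
      using lipschitz_on_nonneg[OF \<Psi>c_lip] by (intro mult_left_mono) (auto simp: abs_mult)
    then have "\<bar>t * \<eta> x\<bar> * (\<bar>deriv \<Psi>c (\<phi> x)\<bar> + L\<Psi> * \<bar>t * \<eta> x\<bar>)
        \<le> \<bar>t * \<eta> x\<bar> * (\<bar>deriv \<Psi>c (\<phi> x)\<bar> + L\<Psi> * \<bar>\<eta> x\<bar>)"
      by (intro mult_left_mono) auto
    with \<Psi>c_increment[of "\<phi> x" "t * \<eta> x"] show ?thesis by (simp add: abs_mult mult.assoc)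
  qed
qed

text \<open>By the symmetry of \<open>C\<close>, the derivative of A : C A is 2 A' : C A with A' =
  S' - \<eta> T'(\<phi>). Domination comes from the Lipschitz bound of \<open>T\<close>, which
  controls increments directly.\<close>

lemma elastic_DERIV:
  assumes \<phi>: "\<phi> \<in> L2 \<Omega>" and \<eta>: "\<eta> \<in> L2 \<Omega>" and S: "S \<in> L2 \<Omega>" "S' \<in> L2 \<Omega>"
  defines "A \<equiv> \<lambda>t x. S x + t *\<^sub>R S' x - T (\<phi> x + t * \<eta> x)"
  shows "((\<lambda>t. l2_inner \<Omega> (A t) (\<lambda>x. tensor_apply C (A t x))) has_field_derivative
           2 * (l2_inner \<Omega> (\<lambda>x. tensor_apply C (S x - T (\<phi> x))) S'
              - l2_inner \<Omega> (\<lambda>x. T' (\<phi> x) \<bullet> tensor_apply C (S x - T (\<phi> x))) \<eta>)) (at 0)"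
proof -
  have A_L2: "A t \<in> L2 \<Omega>" for t
    unfolding A_def by (rule L2_diff[OF L2_add[OF S(1) L2_scaleR[OF S(2)]] L2_lipschitz[OF T_lip L2_add[OF \<phi> L2_cmult[OF \<eta>]]]])
  let ?C = "tensor_apply C"
  let ?F' = "\<lambda>x. 2 * (?C (S x - T (\<phi> x)) \<bullet> S' x - (T' (\<phi> x) \<bullet> ?C (S x - T (\<phi> x))) * \<eta> x)"
  have A0: "A 0 = (\<lambda>x. S x - T (\<phi> x))" by (simp add: A_def)
  note CA = C_L2[OF A_L2[of 0], unfolded A0]
  note int = integrable_inner[OF CA S(2)] integrable_mult_L2[OF coupling_L2[OF \<phi> CA] \<eta>]
  obtain K where K: "K \<ge> 0" "\<And>a. norm (?C a) \<le> norm a * K"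
    using bounded_linear.nonneg_bounded[OF bounded_linear_tensor_apply[of C]] by blast
  define D where "D x = norm (S' x) + LT * \<bar>\<eta> x\<bar>" for x
  have D_L2: "D \<in> L2 \<Omega>"
    unfolding D_def[abs_def] by (rule L2_add[OF L2_norm[OF S(2)] L2_cmult[OF abs_L2[OF \<eta>]]])
  have D0: "D x \<ge> 0" for x using lipschitz_on_nonneg[OF T_lip] by (simp add: D_def)
  have A_diff: "norm (A t x - A 0 x) \<le> \<bar>t\<bar> * D x" for t x
  proof -
    have "A t x - A 0 x = t *\<^sub>R S' x - (T (\<phi> x + t * \<eta> x) - T (\<phi> x))" by (simp add: A_def)
    then have "norm (A t x - A 0 x) \<le> norm (t *\<^sub>R S' x) + norm (T (\<phi> x + t * \<eta> x) - T (\<phi> x))"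
      using norm_triangle_ineq4 by metis
    also have "norm (T (\<phi> x + t * \<eta> x) - T (\<phi> x)) \<le> LT * \<bar>t * \<eta> x\<bar>"
      using lipschitz_onD[OF T_lip, of "\<phi> x + t * \<eta> x" "\<phi> x"] by (simp add: dist_norm)
    finally show ?thesis by (simp add: D_def abs_mult algebra_simps)
  qed
  have "((\<lambda>t. LINT x|\<L>. A t x \<bullet> ?C (A t x)) has_field_derivative (LINT x|\<L>. ?F' x)) (at 0)"
  proof (rule DERIV_integral_dominated)
    show "integrable \<L> (\<lambda>x. A t x \<bullet> ?C (A t x))" for t by (rule integrable_inner[OF A_L2 C_L2[OF A_L2]])
    show "((\<lambda>t. A t x \<bullet> ?C (A t x)) has_field_derivative ?F' x) (at 0)" for x
    proof -
      have "((\<lambda>t. \<phi> x + t * \<eta> x) has_field_derivative \<eta> x) (at 0)"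
        by (auto intro!: derivative_eq_intros)
      moreover have "(T has_vector_derivative T' (\<phi> x)) (at (\<phi> x + 0 * \<eta> x))"
        using T_diff[of "\<phi> x"] by (simp add: vector_derivative_works[symmetric])
      ultimately have "((T \<circ> (\<lambda>t. \<phi> x + t * \<eta> x)) has_vector_derivative \<eta> x *\<^sub>R T' (\<phi> x)) (at 0)"
        unfolding has_real_derivative_iff_has_vector_derivative by (rule vector_diff_chain_at)
      then have "((\<lambda>t. A t x) has_vector_derivative S' x - \<eta> x *\<^sub>R T' (\<phi> x)) (at 0)"
        unfolding A_def comp_def by (auto intro!: derivative_eq_intros)
      then have der: "((\<lambda>t. A t x) has_derivative (\<lambda>h. h *\<^sub>R (S' x - \<eta> x *\<^sub>R T' (\<phi> x)))) (at 0)"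
        by (simp add: has_vector_derivative_def)
      have "((\<lambda>t. A t x \<bullet> ?C (A t x)) has_derivative
          (\<lambda>h. A 0 x \<bullet> ?C (h *\<^sub>R (S' x - \<eta> x *\<^sub>R T' (\<phi> x))) + (h *\<^sub>R (S' x - \<eta> x *\<^sub>R T' (\<phi> x))) \<bullet> ?C (A 0 x))) (at 0)"
        by (rule has_derivative_inner[OF der bounded_linear.has_derivative[OF bounded_linear_tensor_apply der]])
      moreover have "A 0 x \<bullet> ?C (h *\<^sub>R (S' x - \<eta> x *\<^sub>R T' (\<phi> x))) + (h *\<^sub>R (S' x - \<eta> x *\<^sub>R T' (\<phi> x))) \<bullet> ?C (A 0 x)
          = ?F' x * h" for h
        unfolding tensor_apply_symmetric[OF symC, of "A 0 x"]
        by (simp add: A0 inner_diff_right inner_diff_left inner_commute[of "S' x"]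
              inner_commute[of "T' (\<phi> x)"] algebra_simps)
      ultimately show ?thesis by (simp only: has_field_derivative_def)
    qed
    show "?F' \<in> borel_measurable \<L>"
      by (intro borel_measurable_integrable integrable_mult_right Bochner_Integration.integrable_diff int)
    show "integrable \<L> (\<lambda>x. K * (D x * (D x + 2 * norm (A 0 x))))"
      by (rule integrable_mult_right[OF integrable_mult_L2[OF D_L2 L2_add[OF D_L2 L2_cmult[OF L2_norm[OF A_L2]]]]])
    show "\<bar>A t x \<bullet> ?C (A t x) - A 0 x \<bullet> ?C (A 0 x)\<bar> \<le> \<bar>t\<bar> * (K * (D x * (D x + 2 * norm (A 0 x))))"
      if t: "\<bar>t\<bar> \<le> 1" for t x
    proof -
      let ?d = "A t x - A 0 x"
      \<comment> \<open>Equal mixed terms allow the factorisation (A_t - A_0) : C (A_t + A_0), whose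
        first factor carries the required \<bar>t\<bar>; writing A_t + A_0 as (A_t - A_0) + 2 A_0
        bounds the second one uniformly in \<open>t\<close>.\<close>
      have "A t x \<bullet> ?C (A 0 x) = A 0 x \<bullet> ?C (A t x)"
        using tensor_apply_symmetric[OF symC, of "A t x" "A 0 x"] by (simp add: inner_commute)
      then have "A t x \<bullet> ?C (A t x) - A 0 x \<bullet> ?C (A 0 x) = ?d \<bullet> ?C (A t x + A 0 x)"
        unfolding linear_add[OF bounded_linear.linear[OF bounded_linear_tensor_apply[of C]]]
        by (simp add: inner_diff_left inner_add_right)
      then have "\<bar>A t x \<bullet> ?C (A t x) - A 0 x \<bullet> ?C (A 0 x)\<bar> \<le> norm ?d * norm (?C (A t x + A 0 x))"
        by (simp add: Cauchy_Schwarz_ineq2)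
      also have "\<dots> \<le> (\<bar>t\<bar> * D x) * ((D x + 2 * norm (A 0 x)) * K)"
      proof (intro mult_mono A_diff)
        have "A t x + A 0 x = ?d + 2 *\<^sub>R A 0 x" by (simp add: scaleR_2)
        then have "norm (A t x + A 0 x) \<le> norm ?d + 2 * norm (A 0 x)"
          using norm_triangle_ineq[of ?d "2 *\<^sub>R A 0 x"] by (metis norm_scaleR abs_numeral)
        also have "norm ?d \<le> D x"
          using A_diff[of t x] mult_right_mono[OF t D0[of x]] by simp
        finally have "norm (A t x + A 0 x) * K \<le> (D x + 2 * norm (A 0 x)) * K"
          using K(1) by (intro mult_right_mono) auto
        then show "norm (?C (A t x + A 0 x)) \<le> (D x + 2 * norm (A 0 x)) * K"
          using K(2)[of "A t x + A 0 x"] by linarith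
      qed (use D0 in auto)
      finally show ?thesis by (simp add: algebra_simps)
    qed
  qed
  moreover have "(LINT x|\<L>. ?F' x) = 2 * (l2_inner \<Omega> (\<lambda>x. ?C (S x - T (\<phi> x))) S'
              - l2_inner \<Omega> (\<lambda>x. T' (\<phi> x) \<bullet> ?C (S x - T (\<phi> x))) \<eta>)"
    using int by (simp add: l2_inner_def)
  ultimately show ?thesis by (simp add: l2_inner_def)
qed

lemma energy_eq:
  assumes "\<phi> \<in> H1 \<Omega>" "u \<in> H1_vec" "\<theta> \<in> L2 \<Omega>"
  shows "energy_c \<Omega> \<gamma> ell M \<alpha> C T \<Psi>c \<phi> u \<theta> =
    \<gamma> * ell / 2 * l2_inner \<Omega> (grad \<Omega> \<phi>) (grad \<Omega> \<phi>)
    + 1/2 * l2_inner \<Omega> (elastic \<phi> u) (\<lambda>x. tensor_apply C (elastic \<phi> u x))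
    + M / 2 * l2_inner \<Omega> (volumetric u \<theta>) (volumetric u \<theta>) + \<gamma> / ell * (LINT x|\<L>. \<Psi>c (\<phi> x))"
proof -
  note E = elastic_L2[OF assms(2) H1_L2[OF assms(1)]]
  note int = integrable_inner[OF grad_L2[OF assms(1)] grad_L2[OF assms(1)]] integrable_inner[OF E C_L2[OF E]]
    integrable_inner[OF volumetric_L2[OF assms(2,3)] volumetric_L2[OF assms(2,3)]]
  have "(LINT x|\<L>. \<gamma> * ell / 2 * (norm (grad \<Omega> \<phi> x))\<^sup>2
      + 1/2 * ((strain \<Omega> u x - T (\<phi> x)) \<bullet> tensor_apply C (strain \<Omega> u x - T (\<phi> x)))
      + M / 2 * (\<theta> x - \<alpha> * dvg \<Omega> u x)\<^sup>2)
    = (LINT x|\<L>. \<gamma> * ell / 2 * (grad \<Omega> \<phi> x \<bullet> grad \<Omega> \<phi> x) + 1/2 * (elastic \<phi> u x \<bullet> tensor_apply C (elastic \<phi> u x))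
      + M / 2 * (volumetric u \<theta> x \<bullet> volumetric u \<theta> x))"
    unfolding power2_norm_eq_inner by (simp add: elastic_def volumetric_def power2_eq_square)
  also have "\<dots> = \<gamma> * ell / 2 * (LINT x|\<L>. grad \<Omega> \<phi> x \<bullet> grad \<Omega> \<phi> x)
      + 1/2 * (LINT x|\<L>. elastic \<phi> u x \<bullet> tensor_apply C (elastic \<phi> u x))
      + M / 2 * (LINT x|\<L>. volumetric u \<theta> x \<bullet> volumetric u \<theta> x)"
    using int by (simp only: Bochner_Integration.integral_add Bochner_Integration.integrable_add
        integrable_mult_right integral_mult_right_zero)
  finally show ?thesis by (simp add: energy_c_def l2_inner_def)
qed

text \<open>Gradient, strain and divergence are affine along the line only almost everywhere, with
  an exceptional set depending on \<open>t\<close>. The energy is therefore first rewritten with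
  explicit affine integrands for each \<open>t\<close> and then differentiated term by term.\<close>

theorem energy_DERIV:
  assumes \<phi>: "\<phi> \<in> H1 \<Omega>" "\<eta> \<in> H1 \<Omega>" and u: "u \<in> H1_vec" "v \<in> H1_vec" and \<theta>: "\<theta> \<in> L2 \<Omega>" "\<zeta> \<in> L2 \<Omega>"
  shows "((\<lambda>t. energy_c \<Omega> \<gamma> ell M \<alpha> C T \<Psi>c (\<lambda>x. \<phi> x + t * \<eta> x) (\<lambda>x. u x + t *\<^sub>R v x) (\<lambda>x. \<theta> x + t * \<zeta> x))
    has_field_derivative
      (\<gamma> * (ell * l2_inner \<Omega> (grad \<Omega> \<phi>) (grad \<Omega> \<eta>) + 1 / ell * l2_inner \<Omega> (\<lambda>x. deriv \<Psi>c (\<phi> x)) \<eta>)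
        - l2_inner \<Omega> (\<lambda>x. T' (\<phi> x) \<bullet> tensor_apply C (elastic \<phi> u x)) \<eta>)
      + (l2_inner \<Omega> (\<lambda>x. tensor_apply C (elastic \<phi> u x)) (strain \<Omega> v) - M * \<alpha> * l2_inner \<Omega> (volumetric u \<theta>) (dvg \<Omega> v))
      + M * l2_inner \<Omega> (volumetric u \<theta>) \<zeta>) (at 0)"
proof -
  note L = H1_L2[OF \<phi>(1)] H1_L2[OF \<phi>(2)] grad_L2[OF \<phi>(1)] grad_L2[OF \<phi>(2)] strain_L2[OF u(1)] strain_L2[OF u(2)]
  let ?A = "\<lambda>t x. strain \<Omega> u x + t *\<^sub>R strain \<Omega> v x - T (\<phi> x + t * \<eta> x)"
  let ?f = "\<lambda>x. \<zeta> x - \<alpha> * dvg \<Omega> v x"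
  have f_L2: "?f \<in> L2 \<Omega>" by (rule L2_diff[OF \<theta>(2) L2_cmult[OF dvg_L2[OF u(2)]]])
  have eq: "energy_c \<Omega> \<gamma> ell M \<alpha> C T \<Psi>c (\<lambda>x. \<phi> x + t * \<eta> x) (\<lambda>x. u x + t *\<^sub>R v x) (\<lambda>x. \<theta> x + t * \<zeta> x)
    = \<gamma> * ell / 2 * l2_inner \<Omega> (\<lambda>x. grad \<Omega> \<phi> x + t *\<^sub>R grad \<Omega> \<eta> x) (\<lambda>x. grad \<Omega> \<phi> x + t *\<^sub>R grad \<Omega> \<eta> x)
    + 1/2 * l2_inner \<Omega> (?A t) (\<lambda>x. tensor_apply C (?A t x))
    + M / 2 * l2_inner \<Omega> (\<lambda>x. volumetric u \<theta> x + t *\<^sub>R ?f x) (\<lambda>x. volumetric u \<theta> x + t *\<^sub>R ?f x)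
    + \<gamma> / ell * (LINT x|\<L>. \<Psi>c (\<phi> x + t * \<eta> x))" for t
  proof -
    note mem = H1_lincomb[OF \<phi>, of t] H1_vec_lincomb[OF u, of t] L2_add[OF \<theta>(1) L2_cmult[OF \<theta>(2)], of t]
    note L' = L2_add[OF L(3) L2_scaleR[OF L(4)], of t] L2_add[OF volumetric_L2[OF u(1) \<theta>(1)] L2_scaleR[OF f_L2], of t]
      L2_diff[OF L2_add[OF L(5) L2_scaleR[OF L(6)]] L2_lipschitz[OF T_lip H1_L2[OF mem(1)]], of t]
    note E = elastic_L2[OF mem(2) H1_L2[OF mem(1)]]
    have "AE x in \<L>. elastic (\<lambda>x. \<phi> x + t * \<eta> x) (\<lambda>x. u x + t *\<^sub>R v x) x = ?A t x"
      using strain_lincomb[OF u, of t] by eventually_elim (simp add: elastic_def)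
    moreover from this have "AE x in \<L>. tensor_apply C (elastic (\<lambda>x. \<phi> x + t * \<eta> x) (\<lambda>x. u x + t *\<^sub>R v x) x) = tensor_apply C (?A t x)"
      by eventually_elim simp
    ultimately have e1: "l2_inner \<Omega> (elastic (\<lambda>x. \<phi> x + t * \<eta> x) (\<lambda>x. u x + t *\<^sub>R v x))
          (\<lambda>x. tensor_apply C (elastic (\<lambda>x. \<phi> x + t * \<eta> x) (\<lambda>x. u x + t *\<^sub>R v x) x))
        = l2_inner \<Omega> (?A t) (\<lambda>x. tensor_apply C (?A t x))"
      by (rule l2_inner_cong_AE[OF _ _ E L'(3) C_L2[OF E] C_L2[OF L'(3)]])
    have "AE x in \<L>. volumetric (\<lambda>x. u x + t *\<^sub>R v x) (\<lambda>x. \<theta> x + t * \<zeta> x) x = volumetric u \<theta> x + t *\<^sub>R ?f x"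
      using dvg_lincomb[OF u, of t] by eventually_elim (simp add: volumetric_def algebra_simps)
    then have e2: "l2_inner \<Omega> (volumetric (\<lambda>x. u x + t *\<^sub>R v x) (\<lambda>x. \<theta> x + t * \<zeta> x)) (volumetric (\<lambda>x. u x + t *\<^sub>R v x) (\<lambda>x. \<theta> x + t * \<zeta> x))
        = l2_inner \<Omega> (\<lambda>x. volumetric u \<theta> x + t *\<^sub>R ?f x) (\<lambda>x. volumetric u \<theta> x + t *\<^sub>R ?f x)"
      by (rule l2_inner_cong_AE[OF _ _ volumetric_L2[OF mem(2,3)] L'(2) volumetric_L2[OF mem(2,3)] L'(2)]) fact
    have e3: "l2_inner \<Omega> (grad \<Omega> (\<lambda>x. \<phi> x + t * \<eta> x)) (grad \<Omega> (\<lambda>x. \<phi> x + t * \<eta> x))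
        = l2_inner \<Omega> (\<lambda>x. grad \<Omega> \<phi> x + t *\<^sub>R grad \<Omega> \<eta> x) (\<lambda>x. grad \<Omega> \<phi> x + t *\<^sub>R grad \<Omega> \<eta> x)"
      by (rule l2_inner_cong_AE[OF grad_lincomb[OF \<phi>] grad_lincomb[OF \<phi>] grad_L2[OF mem(1)] L'(1) grad_L2[OF mem(1)] L'(1)])
    show ?thesis unfolding energy_eq[OF mem] e1 e2 e3 ..
  qed
  have volumetric_f: "l2_inner \<Omega> (volumetric u \<theta>) ?f = l2_inner \<Omega> (volumetric u \<theta>) \<zeta> - \<alpha> * l2_inner \<Omega> (volumetric u \<theta>) (dvg \<Omega> v)"
    using l2_inner_diff_left[OF \<theta>(2) L2_cmult[OF dvg_L2[OF u(2)]] volumetric_L2[OF u(1) \<theta>(1)], of \<alpha>]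
    by (simp only: l2_inner_commute[of "volumetric u \<theta>"] l2_inner_cmult_left)
  show ?thesis
    unfolding eq
    by (rule DERIV_cong[OF DERIV_add[OF DERIV_add[OF DERIV_add[OF
        DERIV_cmult[OF DERIV_l2_inner_quadratic[OF L(3,4)]] DERIV_cmult[OF elastic_DERIV[OF L(1,2,5,6)]]]
        DERIV_cmult[OF DERIV_l2_inner_quadratic[OF volumetric_L2[OF u(1) \<theta>(1)] f_L2]]]
        DERIV_cmult[OF \<Psi>c_integral_DERIV[OF L(1,2)]]]])
       (simp add: volumetric_f elastic_def algebra_simps)
qed

end

section \<open>Minimizers and discrete solutions\<close>

lemma convex_on_tangent:
  fixes g :: "real \<Rightarrow> real"
  assumes "convex_on UNIV g" "g differentiable at s"
  shows "g s + deriv g s * h \<le> g (s + h)"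
proof -
  have "(g has_real_derivative deriv g s) (at s)"
    using assms(2) by (metis DERIV_imp_deriv real_differentiable_def)
  from convex_on_imp_above_tangent[OF assms(1) connected_UNIV _ _ this, of "s + h"] show ?thesis
    by (simp add: algebra_simps)
qed

text \<open>Compare the tangent at \<open>s\<close> with the values at \<open>s \<plusminus> (1 + \<bar>s\<bar>)\<close>.\<close>

lemma convex_deriv_linear_growth:
  fixes g :: "real \<Rightarrow> real"
  assumes "convex_on UNIV g" "\<And>s. g differentiable at s" "\<And>s. g s \<le> a * (1 + \<bar>s\<bar>)\<^sup>2" "a \<ge> 0"
  shows "\<bar>deriv g s\<bar> \<le> (4 * a + \<bar>g 0\<bar> + \<bar>deriv g 0\<bar>) * (1 + \<bar>s\<bar>)"
proof -
  let ?r = "1 + \<bar>s\<bar>"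
  \<comment> \<open>The tangent at 0 gives a linear lower bound.\<close>
  have low: "g s \<ge> - (\<bar>g 0\<bar> + \<bar>deriv g 0\<bar>) * ?r"
  proof -
    have "g 0 + deriv g 0 * s \<le> g s" using convex_on_tangent[OF assms(1,2), of 0 s] by simp
    moreover have "\<bar>deriv g 0 * s\<bar> \<le> \<bar>deriv g 0\<bar> * ?r" by (simp add: abs_mult mult_left_mono)
    moreover have "\<bar>g 0\<bar> \<le> \<bar>g 0\<bar> * ?r" by (simp add: distrib_left)
    ultimately show ?thesis unfolding minus_mult_left[symmetric] distrib_right[of "\<bar>g 0\<bar>"] by linarith
  qed
  \<comment> \<open>The choice of \<open>h\<close> gives 1 + \<bar>s + h\<bar> \<le> 2 (1 +
    \<bar>s\<bar>), whence the factor 4.\<close>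
  have up: "g (s + h) \<le> 4 * a * ?r\<^sup>2" if "\<bar>h\<bar> = ?r" for h
  proof -
    have "g (s + h) \<le> a * (1 + \<bar>s + h\<bar>)\<^sup>2" by (rule assms)
    also have "\<dots> \<le> a * (2 * ?r)\<^sup>2"
      using that assms(4) by (intro mult_left_mono power_mono) auto
    also have "\<dots> = 4 * a * ?r\<^sup>2" unfolding power_mult_distrib by simp
    finally show ?thesis .
  qed
  have "deriv g s * h \<le> (4 * a + \<bar>g 0\<bar> + \<bar>deriv g 0\<bar>) * ?r\<^sup>2" if h: "\<bar>h\<bar> = ?r" for h
  proof -
    have "(\<bar>g 0\<bar> + \<bar>deriv g 0\<bar>) * ?r \<le> (\<bar>g 0\<bar> + \<bar>deriv g 0\<bar>) * ?r\<^sup>2"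
      by (intro mult_left_mono) (auto simp: power2_eq_square algebra_simps)
    with convex_on_tangent[OF assms(1,2), of s h] low up[OF h] show ?thesis
      by (simp add: algebra_simps)
  qed
  note claim = this
  have "\<bar>deriv g s\<bar> * ?r \<le> (4 * a + \<bar>g 0\<bar> + \<bar>deriv g 0\<bar>) * ?r\<^sup>2"
  proof (cases "deriv g s \<ge> 0")
    case True
    then show ?thesis using claim[of ?r] by simp
  next
    case False
    then have "deriv g s * - ?r = \<bar>deriv g s\<bar> * ?r" by (simp only: mult_minus_left mult_minus_right abs_of_neg not_le)
    then show ?thesis using claim[of "- ?r"] by simp
  qed
  then have "\<bar>deriv g s\<bar> * ?r \<le> (4 * a + \<bar>g 0\<bar> + \<bar>deriv g 0\<bar>) * ?r * ?r"
    by (simp only: power2_eq_square mult.assoc)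
  then show ?thesis by (rule mult_right_le_imp_le) simp
qed

section \<open>The coupled minimization problem\<close>

locale coupled_step = material \<Omega> \<gamma> ell M \<alpha> LT L\<Psi> C T \<Psi>c +
    ch: fe_step \<Omega> Vch m \<phi>_old R \<tau> + flow: fe_step \<Omega> Vf \<kappa> \<theta>_old Sf \<tau>
  for \<Omega> :: "(real ^ 'd) set" and \<gamma> ell M \<alpha> LT L\<Psi> C T \<Psi>c Vch m \<phi>_old R \<tau> Vf \<kappa> \<theta>_old Sf +
  fixes Vu :: "(real ^ 'd \<Rightarrow> real ^ 'd) set" and f :: "real ^ 'd \<Rightarrow> real ^ 'd" and \<Psi>e :: "real \<Rightarrow> real"
  assumes Vu: "conforming_H10_vec \<Omega> Vu" and f: "f \<in> L2 \<Omega>"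
    and \<Psi>e'_L2: "(\<lambda>x. deriv \<Psi>e (\<phi>_old x)) \<in> L2 \<Omega>"
    and energy_convex: "convex_functional_on Vch Vu Vf (energy_c \<Omega> \<gamma> ell M \<alpha> C T \<Psi>c)"
begin

abbreviation Energy where "Energy \<phi> u \<theta> \<equiv> energy_c \<Omega> \<gamma> ell M \<alpha> C T \<Psi>c \<phi> u \<theta>"
abbreviation Pot where
  "Pot \<phi> u \<theta> \<equiv> potential \<Omega> \<gamma> ell m \<kappa> M \<alpha> C T \<Psi>c \<Psi>e R Sf f Vch Vf \<tau> \<phi>_old \<theta>_old \<phi> u \<theta>"
abbreviation Ach where "Ach \<equiv> affine_space \<Omega> Vch \<tau> \<phi>_old R"
abbreviation Af where "Af \<equiv> affine_space \<Omega> Vf \<tau> \<theta>_old Sf"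

text \<open>\<open>var_\<phi>\<close>, \<open>var_u\<close> and \<open>var_\<theta>\<close> are the
  partial derivatives of the potential without its dual norms. The eigenstrain is subtracted in the
  elastic strain, hence the minus sign before the coupling term.\<close>

definition var_\<phi> where "var_\<phi> \<phi> u \<eta> =
  \<gamma> * (ell * l2_inner \<Omega> (grad \<Omega> \<phi>) (grad \<Omega> \<eta>)
    + 1 / ell * l2_inner \<Omega> (\<lambda>x. deriv \<Psi>c (\<phi> x) - deriv \<Psi>e (\<phi>_old x)) \<eta>)
  - l2_inner \<Omega> (\<lambda>x. T' (\<phi> x) \<bullet> tensor_apply C (strain \<Omega> u x - T (\<phi> x))) \<eta>"

definition var_u where "var_u \<phi> u \<theta> v =
  l2_inner \<Omega> (\<lambda>x. tensor_apply C (strain \<Omega> u x - T (\<phi> x))) (strain \<Omega> v)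
  - l2_inner \<Omega> (\<lambda>x. \<alpha> * M * (\<theta> x - \<alpha> * dvg \<Omega> u x)) (dvg \<Omega> v) - l2_inner \<Omega> f v"

definition var_\<theta> where "var_\<theta> u \<theta> \<zeta> = l2_inner \<Omega> (\<lambda>x. M * (\<theta> x - \<alpha> * dvg \<Omega> u x)) \<zeta>"

lemma Vu_H1_vec: "u \<in> Vu \<Longrightarrow> u \<in> H1_vec"
  using Vu H10_vec_subset by (auto simp: conforming_H10_vec_def)

lemma Vu_lincomb: "u \<in> Vu \<Longrightarrow> v \<in> Vu \<Longrightarrow> (\<lambda>x. u x + c *\<^sub>R v x) \<in> Vu"
  using Vu fin_dim_space_lincomb by (auto simp: conforming_H10_vec_def)

lemma
  assumes "\<phi> \<in> Vch" "u \<in> Vu" "\<theta> \<in> Vf"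
  shows linear_var_\<phi>: "ch.linear_on (var_\<phi> \<phi> u)" and linear_var_\<theta>: "flow.linear_on (var_\<theta> u \<theta>)"
proof -
  note p = ch.V_L2[OF assms(1)] Vu_H1_vec[OF assms(2)] flow.V_L2[OF assms(3)]
  note A = C_L2[OF elastic_L2[OF p(2,1)], unfolded elastic_def]
  have L1: "(\<lambda>x. deriv \<Psi>c (\<phi> x) - deriv \<Psi>e (\<phi>_old x)) \<in> L2 \<Omega>"
    by (rule L2_diff[OF \<Psi>c'_L2[OF p(1)] \<Psi>e'_L2])
  have gr: "l2_inner \<Omega> (grad \<Omega> \<phi>) (grad \<Omega> (\<lambda>x. g x + c * h x))
      = l2_inner \<Omega> (grad \<Omega> \<phi>) (grad \<Omega> g) + c * l2_inner \<Omega> (grad \<Omega> \<phi>) (grad \<Omega> h)"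
    if "g \<in> Vch" "h \<in> Vch" for g h c
    using ch.l2_inner_grad_lincomb[OF ch.V_H1[OF that(1)] ch.V_H1[OF that(2)] ch.V_grad_L2[OF assms(1)], of c]
    by (simp only: l2_inner_commute[of "grad \<Omega> \<phi>"])
  note lin = ch.linear_onD[OF ch.linear_on_l2_inner[OF L1]] ch.linear_onD[OF ch.linear_on_l2_inner[OF coupling_L2[OF p(1) A]]]
  show "ch.linear_on (var_\<phi> \<phi> u)"
    unfolding ch.linear_on_def var_\<phi>_def by (intro ballI allI) (simp only: gr lin algebra_simps)
  have "(\<lambda>x. M * (\<theta> x - \<alpha> * dvg \<Omega> u x)) \<in> L2 \<Omega>"
    using L2_cmult[OF volumetric_L2[OF p(2,3)], of M] by (simp add: volumetric_def)
  then show "flow.linear_on (var_\<theta> u \<theta>)"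
    unfolding var_\<theta>_def[abs_def] by (rule flow.linear_on_l2_inner)
qed

text \<open>The derivative at \<open>t = 0\<close> of everything in the potential except the energy:
  the dual norms, through their representers, and the two linear terms.\<close>

definition slope where "slope w w' \<eta> v \<zeta> = l2_inner \<Omega> w \<eta> / \<tau> + l2_inner \<Omega> w' \<zeta> / \<tau>
  - \<gamma> / ell * l2_inner \<Omega> (\<lambda>x. deriv \<Psi>e (\<phi>_old x)) \<eta> - l2_inner \<Omega> f v"

definition gateaux where "gateaux \<phi> u \<theta> w w' \<eta> v \<zeta> = (l2_inner \<Omega> w \<eta> / \<tau> + var_\<phi> \<phi> u \<eta>) + var_u \<phi> u \<theta> v
  + (l2_inner \<Omega> w' \<zeta> / \<tau> + var_\<theta> u \<theta> \<zeta>)"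

context
  fixes \<phi> u \<theta> \<eta> v \<zeta> w w'
  assumes z: "\<phi> \<in> Ach" "u \<in> Vu" "\<theta> \<in> Af"
    and w: "ch.represents w (ch.residual \<phi>)" "flow.represents w' (flow.residual \<theta>)"
    and d: "\<eta> \<in> Vch" "(LINT x|\<L>. \<eta> x) = 0" "v \<in> Vu" "\<zeta> \<in> Vf" "(LINT x|\<L>. \<zeta> x) = 0"
begin

lemma candidate_mem: "\<phi> \<in> Vch" "\<theta> \<in> Vf"
  using z by (auto simp: affine_space_def)

abbreviation path where "path F t \<equiv> F (\<lambda>x. \<phi> x + t * \<eta> x) (\<lambda>x. u x + t *\<^sub>R v x) (\<lambda>x. \<theta> x + t * \<zeta> x)"

abbreviation slope_d where "slope_d \<equiv> slope w w' \<eta> v \<zeta>"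
abbreviation gateaux_d where "gateaux_d \<equiv> gateaux \<phi> u \<theta> w w' \<eta> v \<zeta>"

text \<open>Apart from the energy, the potential is an explicit quadratic polynomial along the line;
  its leading coefficient comes from the energies of the representers of the directions.\<close>

lemma Pot_path: "\<exists>c Q. Q \<ge> 0 \<and> (\<forall>t. path Pot t = c + t * slope_d + t\<^sup>2 * Q + path Energy t)"
proof -
  obtain k where k: "k \<ge> 0" "\<And>t. (dual_norm \<Omega> m Vch (l2_inner \<Omega> (ch.residual (\<lambda>x. \<phi> x + t * \<eta> x))))\<^sup>2
      = (dual_norm \<Omega> m Vch (l2_inner \<Omega> (ch.residual \<phi>)))\<^sup>2 + 2 * t * l2_inner \<Omega> w \<eta> + t\<^sup>2 * k"
    using ch.dual_norm_variation[OF z(1) w(1) d(1,2)] by blast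
  obtain k' where k': "k' \<ge> 0" "\<And>t. (dual_norm \<Omega> \<kappa> Vf (l2_inner \<Omega> (flow.residual (\<lambda>x. \<theta> x + t * \<zeta> x))))\<^sup>2
      = (dual_norm \<Omega> \<kappa> Vf (l2_inner \<Omega> (flow.residual \<theta>)))\<^sup>2 + 2 * t * l2_inner \<Omega> w' \<zeta> + t\<^sup>2 * k'"
    using flow.dual_norm_variation[OF z(3) w(2) d(4,5)] by blast
  have e: "l2_inner \<Omega> (\<lambda>x. deriv \<Psi>e (\<phi>_old x)) (\<lambda>x. \<phi> x + t * \<eta> x)
      = l2_inner \<Omega> (\<lambda>x. deriv \<Psi>e (\<phi>_old x)) \<phi> + t * l2_inner \<Omega> (\<lambda>x. deriv \<Psi>e (\<phi>_old x)) \<eta>" for t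
    by (rule ch.linear_onD[OF ch.linear_on_l2_inner[OF \<Psi>e'_L2] candidate_mem(1) d(1)])
  have ff: "l2_inner \<Omega> f (\<lambda>x. u x + t *\<^sub>R v x) = l2_inner \<Omega> f u + t * l2_inner \<Omega> f v" for t
    using l2_inner_add_right[OF H1_vec_L2[OF Vu_H1_vec[OF z(2)]] L2_scaleR[OF H1_vec_L2[OF Vu_H1_vec[OF d(3)]]] f, of t]
    by (simp only: l2_inner_scaleR_right)
  let ?c = "(dual_norm \<Omega> m Vch (l2_inner \<Omega> (ch.residual \<phi>)))\<^sup>2 / (2 * \<tau>)
    + (dual_norm \<Omega> \<kappa> Vf (l2_inner \<Omega> (flow.residual \<theta>)))\<^sup>2 / (2 * \<tau>)
    - \<gamma> / ell * l2_inner \<Omega> (\<lambda>x. deriv \<Psi>e (\<phi>_old x)) \<phi> - l2_inner \<Omega> f u"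
  let ?Q = "(k + k') / (2 * \<tau>)"
  have "path Pot t = ?c + t * slope_d + t\<^sup>2 * ?Q + path Energy t" for t
    unfolding potential_def ch.residual_def[symmetric] flow.residual_def[symmetric] k(2) k'(2) e ff slope_def
    using ch.\<tau> by (simp add: add_divide_distrib diff_divide_distrib algebra_simps)
  moreover have "?Q \<ge> 0" using k k' ch.\<tau> by simp
  ultimately show ?thesis by blast
qed

lemma Energy_DERIV: "((\<lambda>t. path Energy t) has_field_derivative gateaux_d - slope_d) (at 0)"
proof (rule DERIV_cong[OF energy_DERIV])
  have e: "l2_inner \<Omega> (\<lambda>x. deriv \<Psi>c (\<phi> x) - deriv \<Psi>e (\<phi>_old x)) \<eta>
      = l2_inner \<Omega> (\<lambda>x. deriv \<Psi>c (\<phi> x)) \<eta> - l2_inner \<Omega> (\<lambda>x. deriv \<Psi>e (\<phi>_old x)) \<eta>"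
    by (rule l2_inner_diff_left[OF \<Psi>c'_L2[OF ch.V_L2[OF candidate_mem(1)]] \<Psi>e'_L2 ch.V_L2[OF d(1)]])
  show "(\<gamma> * (ell * l2_inner \<Omega> (grad \<Omega> \<phi>) (grad \<Omega> \<eta>) + 1 / ell * l2_inner \<Omega> (\<lambda>x. deriv \<Psi>c (\<phi> x)) \<eta>)
        - l2_inner \<Omega> (\<lambda>x. T' (\<phi> x) \<bullet> tensor_apply C (elastic \<phi> u x)) \<eta>)
      + (l2_inner \<Omega> (\<lambda>x. tensor_apply C (elastic \<phi> u x)) (strain \<Omega> v) - M * \<alpha> * l2_inner \<Omega> (volumetric u \<theta>) (dvg \<Omega> v))
      + M * l2_inner \<Omega> (volumetric u \<theta>) \<zeta> = gateaux_d - slope_d"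
    unfolding gateaux_def slope_def var_\<phi>_def var_u_def var_\<theta>_def e l2_inner_cmult_left
    by (simp add: elastic_def volumetric_def[abs_def] algebra_simps)
qed (use candidate_mem z d ch.V_H1 flow.V_L2 Vu_H1_vec in auto)

lemma Pot_DERIV: "((\<lambda>t. path Pot t) has_field_derivative gateaux_d) (at 0)"
proof -
  obtain c Q where "\<forall>t. path Pot t = c + t * slope_d + t\<^sup>2 * Q + path Energy t" using Pot_path by blast
  then have eq: "(\<lambda>t. path Pot t) = (\<lambda>t. c + t * slope_d + t\<^sup>2 * Q + path Energy t)" by blast
  have "((\<lambda>t. c + t * slope_d + t\<^sup>2 * Q) has_field_derivative slope_d) (at 0)"
    by (auto intro!: derivative_eq_intros)
  from DERIV_add[OF this Energy_DERIV] show ?thesis unfolding eq by simp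
qed

text \<open>Convexity keeps every difference quotient with 0 < t < 1 below the increment up to
  \<open>t = 1\<close>; letting \<open>t\<close> tend to 0 from the right gives the tangent
  inequality.\<close>

lemma Energy_increment: "gateaux_d - slope_d \<le> path Energy 1 - path Energy 0"
proof (rule tendsto_upperbound)
  show "((\<lambda>t. (path Energy t - path Energy 0) / t) \<longlongrightarrow> gateaux_d - slope_d) (at_right 0)"
    using Energy_DERIV by (simp add: DERIV_def filterlim_at_split)
  have "(path Energy t - path Energy 0) / t \<le> path Energy 1 - path Energy 0" if t: "0 < t" "t < 1" for t
  proof -
    have "Energy (\<lambda>x. (1 - t) * \<phi> x + t * (\<phi> x + 1 * \<eta> x)) (\<lambda>x. (1 - t) *\<^sub>R u x + t *\<^sub>R (u x + 1 *\<^sub>R v x))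
        (\<lambda>x. (1 - t) * \<theta> x + t * (\<theta> x + 1 * \<zeta> x)) \<le> (1 - t) * Energy \<phi> u \<theta> + t * path Energy 1"
      using energy_convex candidate_mem z d t ch.lincomb[OF candidate_mem(1) d(1), of 1] flow.lincomb[OF candidate_mem(2) d(4), of 1] Vu_lincomb[OF z(2) d(3), of 1]
      unfolding convex_functional_on_def by (meson atLeastAtMost_iff less_imp_le)
    \<comment> \<open>The convex combinations of the end points are points of the line.\<close>
    moreover have "(\<lambda>x. (1 - t) * \<phi> x + t * (\<phi> x + 1 * \<eta> x)) = (\<lambda>x. \<phi> x + t * \<eta> x)"
      "(\<lambda>x. (1 - t) *\<^sub>R u x + t *\<^sub>R (u x + 1 *\<^sub>R v x)) = (\<lambda>x. u x + t *\<^sub>R v x)"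
      "(\<lambda>x. (1 - t) * \<theta> x + t * (\<theta> x + 1 * \<zeta> x)) = (\<lambda>x. \<theta> x + t * \<zeta> x)"
      by (simp_all add: fun_eq_iff algebra_simps)
    ultimately have "path Energy t \<le> (1 - t) * path Energy 0 + t * path Energy 1" by simp
    then have "path Energy t - path Energy 0 \<le> (path Energy 1 - path Energy 0) * t"
      unfolding left_diff_distrib by (simp only: mult.commute[of t] mult_1_left)
    then show ?thesis using t by (simp only: pos_divide_le_eq)
  qed
  then show "\<forall>\<^sub>F t in at_right 0. (path Energy t - path Energy 0) / t \<le> path Energy 1 - path Energy 0"
    unfolding eventually_at_right_field by (intro exI[of _ 1]) auto
qed simp

text \<open>The quadratic part adds the nonnegative \<open>Q\<close>, so the potential too lies
  above its tangent.\<close>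

lemma Pot_increment: "gateaux_d \<le> path Pot 1 - path Pot 0"
proof -
  obtain c Q where Q: "Q \<ge> 0" "\<And>t. path Pot t = c + t * slope_d + t\<^sup>2 * Q + path Energy t" using Pot_path by blast
  show ?thesis using Q(1) Energy_increment unfolding Q(2)[of 1] Q(2)[of 0] by simp
qed

end

text \<open>\<open>gateaux\<close> is a sum of three functionals in independent directions, so each
  is isolated by making the other two vanish.\<close>

lemma stationary_iff_components:
  assumes z: "\<phi> \<in> Ach" "u \<in> Vu" "\<theta> \<in> Af"
  shows "(\<forall>\<eta>\<in>Vch. \<forall>v\<in>Vu. \<forall>\<zeta>\<in>Vf. (LINT x|\<L>. \<eta> x) = 0 \<longrightarrow> (LINT x|\<L>. \<zeta> x) = 0 \<longrightarrow>
      gateaux \<phi> u \<theta> w w' \<eta> v \<zeta> = 0) \<longleftrightarrow>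
    (\<forall>\<eta>\<in>Vch. (LINT x|\<L>. \<eta> x) = 0 \<longrightarrow> l2_inner \<Omega> w \<eta> / \<tau> + var_\<phi> \<phi> u \<eta> = 0) \<and>
    (\<forall>v\<in>Vu. var_u \<phi> u \<theta> v = 0) \<and>
    (\<forall>\<zeta>\<in>Vf. (LINT x|\<L>. \<zeta> x) = 0 \<longrightarrow> l2_inner \<Omega> w' \<zeta> / \<tau> + var_\<theta> u \<theta> \<zeta> = 0)" (is "?L \<longleftrightarrow> ?R")
proof
  assume L: ?L
  have V: "\<phi> \<in> Vch" "\<theta> \<in> Vf" using z by (auto simp: affine_space_def)
  let ?a = "\<lambda>\<eta>. l2_inner \<Omega> w \<eta> / \<tau> + var_\<phi> \<phi> u \<eta>" and ?b = "var_u \<phi> u \<theta>"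
    and ?c = "\<lambda>\<zeta>. l2_inner \<Omega> w' \<zeta> / \<tau> + var_\<theta> u \<theta> \<zeta>"
  have L': "?a \<eta> + ?b v + ?c \<zeta> = 0"
    if "\<eta> \<in> Vch" "v \<in> Vu" "\<zeta> \<in> Vf" "(LINT x|\<L>. \<eta> x) = 0" "(LINT x|\<L>. \<zeta> x) = 0" for \<eta> v \<zeta>
    using L that unfolding gateaux_def by blast
  have a0: "?a (\<lambda>x. 0) = 0"
    using ch.linear_on_zero[OF linear_var_\<phi>[OF V(1) z(2) V(2)]] by (simp add: l2_inner_def)
  have c0: "?c (\<lambda>x. 0) = 0"
    using flow.linear_on_zero[OF linear_var_\<theta>[OF V(1) z(2) V(2)]] by (simp add: l2_inner_def)
  have b: "?b v = 0" if "v \<in> Vu" for v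
    using L'[OF ch.zero_mem that flow.zero_mem] a0 c0 by simp
  \<comment> \<open>Since \<open>?b\<close> already vanishes on all of \<open>Vu\<close>, any member
    may stand for \<open>v\<close>; \<open>u\<close> itself is at hand.\<close>
  moreover have "?a \<eta> = 0" if "\<eta> \<in> Vch" "(LINT x|\<L>. \<eta> x) = 0" for \<eta>
    using L'[OF that(1) z(2) flow.zero_mem that(2)] b[OF z(2)] c0 by simp
  moreover have "?c \<zeta> = 0" if "\<zeta> \<in> Vf" "(LINT x|\<L>. \<zeta> x) = 0" for \<zeta>
    using L'[OF ch.zero_mem z(2) that(1) _ that(2)] b[OF z(2)] a0 by simp
  ultimately show ?R by blast
qed (simp add: gateaux_def)

text \<open>Mean-free directions keep the whole line admissible, so a minimizer has zero derivative
  at \<open>t = 0\<close>. Conversely every competitor is the point \<open>t = 1\<close> of such a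
  line, and \<open>Pot_increment\<close> applies.\<close>

lemma minimizer_iff_stationary:
  assumes z: "\<phi> \<in> Ach" "u \<in> Vu" "\<theta> \<in> Af"
    and w: "ch.represents w (ch.residual \<phi>)" "flow.represents w' (flow.residual \<theta>)"
  shows "(\<forall>\<phi>'\<in>Ach. \<forall>u'\<in>Vu. \<forall>\<theta>'\<in>Af. Pot \<phi> u \<theta> \<le> Pot \<phi>' u' \<theta>') \<longleftrightarrow>
    (\<forall>\<eta>\<in>Vch. \<forall>v\<in>Vu. \<forall>\<zeta>\<in>Vf. (LINT x|\<L>. \<eta> x) = 0 \<longrightarrow> (LINT x|\<L>. \<zeta> x) = 0 \<longrightarrow>
      gateaux \<phi> u \<theta> w w' \<eta> v \<zeta> = 0)" (is "?L \<longleftrightarrow> ?R")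
proof
  assume L: ?L
  show ?R
  proof (intro ballI impI)
    fix \<eta> v \<zeta> assume d: "\<eta> \<in> Vch" "v \<in> Vu" "\<zeta> \<in> Vf" "(LINT x|\<L>. \<eta> x) = 0" "(LINT x|\<L>. \<zeta> x) = 0"
    have "Pot \<phi> u \<theta> \<le> Pot (\<lambda>x. \<phi> x + t * \<eta> x) (\<lambda>x. u x + t *\<^sub>R v x) (\<lambda>x. \<theta> x + t * \<zeta> x)" for t
      using L ch.affine_space_add[OF z(1) d(1,4), of t] flow.affine_space_add[OF z(3) d(3,5), of t]
        Vu_lincomb[OF z(2) d(2), of t] by blast
    then show "gateaux \<phi> u \<theta> w w' \<eta> v \<zeta> = 0"
      by (intro DERIV_local_min[OF Pot_DERIV[OF z w d(1,4,2,3,5)] zero_less_one]) simp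
  qed
next
  assume R: ?R
  show ?L
  proof (intro ballI)
    fix \<phi>' u' \<theta>' assume z': "\<phi>' \<in> Ach" "u' \<in> Vu" "\<theta>' \<in> Af"
    obtain \<eta> where \<eta>: "\<eta> \<in> Vch" "(LINT x|\<L>. \<eta> x) = 0" "\<phi>' = (\<lambda>x. \<phi> x + 1 * \<eta> x)"
      by (rule ch.affine_space_diff[OF z(1) z'(1)])
    obtain \<zeta> where \<zeta>: "\<zeta> \<in> Vf" "(LINT x|\<L>. \<zeta> x) = 0" "\<theta>' = (\<lambda>x. \<theta> x + 1 * \<zeta> x)"
      by (rule flow.affine_space_diff[OF z(3) z'(3)])
    define v where "v = (\<lambda>x. u' x + (- 1) *\<^sub>R u x)"
    have v: "v \<in> Vu" unfolding v_def by (rule Vu_lincomb[OF z'(2) z(2)])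
    have u': "u' = (\<lambda>x. u x + 1 *\<^sub>R v x)" by (simp add: v_def)
    have "gateaux \<phi> u \<theta> w w' \<eta> v \<zeta> = 0" using R \<eta> v \<zeta> by blast
    with Pot_increment[OF z w \<eta>(1,2) v \<zeta>(1,2)]
    show "Pot \<phi> u \<theta> \<le> Pot \<phi>' u' \<theta>'" unfolding \<eta>(3) \<zeta>(3) u' by simp
  qed
qed

theorem minimizer_iff_discrete_solution:
  "is_arg_min (\<lambda>(\<phi>, u, \<theta>). Pot \<phi> u \<theta>) (\<lambda>(\<phi>, u, \<theta>). \<phi> \<in> Ach \<and> u \<in> Vu \<and> \<theta> \<in> Af) (\<phi>, u, \<theta>) \<longleftrightarrow>
    \<phi> \<in> Vch \<and> u \<in> Vu \<and> \<theta> \<in> Vf \<and>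
    (\<exists>\<mu>\<in>Vch. \<exists>p\<in>Vf. ch.evolution \<phi> \<mu> \<and> (\<forall>\<eta>\<in>Vch. l2_inner \<Omega> \<mu> \<eta> - var_\<phi> \<phi> u \<eta> = 0) \<and>
      (\<forall>v\<in>Vu. var_u \<phi> u \<theta> v = 0) \<and>
      flow.evolution \<theta> p \<and> (\<forall>\<zeta>\<in>Vf. l2_inner \<Omega> p \<zeta> - var_\<theta> u \<theta> \<zeta> = 0))" (is "?min \<longleftrightarrow> ?sol")
proof -
  have min_iff: "?min \<longleftrightarrow> \<phi> \<in> Ach \<and> u \<in> Vu \<and> \<theta> \<in> Af \<and>
      (\<forall>\<phi>'\<in>Ach. \<forall>u'\<in>Vu. \<forall>\<theta>'\<in>Af. Pot \<phi> u \<theta> \<le> Pot \<phi>' u' \<theta>')"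
    by (simp add: is_arg_min_def not_less) blast
  show ?thesis
  proof (cases "\<phi> \<in> Ach \<and> u \<in> Vu \<and> \<theta> \<in> Af")
    case False
    \<comment> \<open>Outside the admissible set both sides fail, since the evolution equations
      imply the constraints. Inside it representers of the residuals exist.\<close>
    then have "\<not> ?sol" using ch.evolution_imp_affine flow.evolution_imp_affine by blast
    with False show ?thesis unfolding min_iff by blast
  next
    case True
    then have z: "\<phi> \<in> Ach" "u \<in> Vu" "\<theta> \<in> Af" by auto
    have V: "\<phi> \<in> Vch" "\<theta> \<in> Vf" and mean: "(LINT x|\<L>. ch.residual \<phi> x) = 0" "(LINT x|\<L>. flow.residual \<theta> x) = 0"
      using z by (simp_all add: ch.affine_space_iff flow.affine_space_iff)
    obtain w where w: "ch.represents w (ch.residual \<phi>)"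
      using ch.represents_exists[OF ch.residual_L2[OF V(1)] mean(1)] by blast
    obtain w' where w': "flow.represents w' (flow.residual \<theta>)"
      using flow.represents_exists[OF flow.residual_L2[OF V(2)] mean(2)] by blast
    show ?thesis
      unfolding min_iff minimizer_iff_stationary[OF z w w'] stationary_iff_components[OF z]
        ch.stationary_iff[OF z(1) w linear_var_\<phi>[OF V(1) z(2) V(2)]]
        flow.stationary_iff[OF z(3) w' linear_var_\<theta>[OF V(1) z(2) V(2)]]
      using z V by blast
  qed
qed

end

theorem lemma2:
  fixes \<Omega> :: "(real ^ 'd) set"
    and \<gamma> ell m \<kappa> M \<alpha> \<tau> cC CC cT CT :: real
    and \<Psi> \<Psi>c \<Psi>e :: "real \<Rightarrow> real"
    and C :: "real ^ 'd ^ 'd ^ 'd ^ 'd"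
    and T :: "real \<Rightarrow> real ^ 'd ^ 'd"
    and R Sf :: "real ^ 'd \<Rightarrow> real"
    and f :: "real ^ 'd \<Rightarrow> real ^ 'd"
    and Vch Vf :: "(real ^ 'd \<Rightarrow> real) set"
    and Vu :: "(real ^ 'd \<Rightarrow> real ^ 'd) set"
    and \<phi>_old \<theta>_old \<phi> \<theta> :: "real ^ 'd \<Rightarrow> real"
    and u_old u :: "real ^ 'd \<Rightarrow> real ^ 'd"
  assumes dim: "CARD('d) = 2 \<or> CARD('d) = 3"
    and domain: "lipschitz_domain \<Omega>"
    and interface: "\<gamma> > 0" "ell > 0"
    and spaces: "conforming_H1 \<Omega> Vch" "conforming_H10_vec \<Omega> Vu" "conforming_H1 \<Omega> Vf"
    and A1: "\<And>s. \<Psi> s \<ge> 0" "\<And>s. \<Psi> s = \<Psi>c s - \<Psi>e s"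
      "convex_on UNIV \<Psi>c" "convex_on UNIV \<Psi>e"
      "\<And>s. \<Psi>c differentiable at s" "\<And>s. \<Psi>e differentiable at s"
      "\<exists>L. L-lipschitz_on UNIV (deriv \<Psi>c)"
    and A2: "m > 0" "\<kappa> > 0" "M > 0" "0 < \<alpha>" "\<alpha> \<le> 1"
    and A3: "elasticity_symmetries C" "cC > 0" "CC > 0"
      "\<And>e. transpose e = e \<Longrightarrow>
         cC * (norm e)\<^sup>2 \<le> e \<bullet> tensor_apply C e \<and> e \<bullet> tensor_apply C e \<le> CC * (norm e)\<^sup>2"
    and A4: "\<And>s. transpose (T s) = T s" "\<exists>L. L-lipschitz_on UNIV T"
      "\<And>s. T differentiable at s" "cT > 0" "CT > 0"
      "\<And>v. v \<in> L2 \<Omega> \<Longrightarrow>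
         cT * l2_norm \<Omega> v \<le> l2_norm \<Omega> (\<lambda>x. T (v x)) \<and>
         l2_norm \<Omega> (\<lambda>x. T (v x)) \<le> CT * l2_norm \<Omega> v"
    and A5: "R \<in> L2 \<Omega>" "Sf \<in> L2 \<Omega>" "f \<in> L2 \<Omega>"
    and energy_convex: "convex_functional_on Vch Vu Vf (energy_c \<Omega> \<gamma> ell M \<alpha> C T \<Psi>c)"
    and step: "\<tau> > 0"
    and previous: "\<phi>_old \<in> Vch" "u_old \<in> Vu" "\<theta>_old \<in> Vf"
  shows
    "is_arg_min
       (\<lambda>(\<phi>, u, \<theta>). potential \<Omega> \<gamma> ell m \<kappa> M \<alpha> C T \<Psi>c \<Psi>e R Sf f Vch Vf \<tau> \<phi>_old \<theta>_old \<phi> u \<theta>)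
       (\<lambda>(\<phi>, u, \<theta>). \<phi> \<in> affine_space \<Omega> Vch \<tau> \<phi>_old R \<and> u \<in> Vu \<and>
                       \<theta> \<in> affine_space \<Omega> Vf \<tau> \<theta>_old Sf)
       (\<phi>, u, \<theta>)
     \<longleftrightarrow>
     \<phi> \<in> Vch \<and> u \<in> Vu \<and> \<theta> \<in> Vf \<and>
     (\<exists>\<mu>\<in>Vch. \<exists>p\<in>Vf.
        (\<forall>\<eta>\<in>Vch.
           l2_inner \<Omega> (\<lambda>x. \<phi> x - \<phi>_old x) \<eta>
           + \<tau> * l2_inner \<Omega> (\<lambda>x. m *\<^sub>R grad \<Omega> \<mu> x) (grad \<Omega> \<eta>)
           - \<tau> * l2_inner \<Omega> R \<eta> = 0) \<and>
        (\<forall>\<eta>\<in>Vch.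
           l2_inner \<Omega> \<mu> \<eta>
           - \<gamma> * (ell * l2_inner \<Omega> (grad \<Omega> \<phi>) (grad \<Omega> \<eta>)
                  + 1 / ell * l2_inner \<Omega> (\<lambda>x. deriv \<Psi>c (\<phi> x) - deriv \<Psi>e (\<phi>_old x)) \<eta>)
           + l2_inner \<Omega> (\<lambda>x. vector_derivative T (at (\<phi> x))
                                \<bullet> tensor_apply C (strain \<Omega> u x - T (\<phi> x))) \<eta> = 0) \<and>
        (\<forall>\<eta>\<in>Vu.
           l2_inner \<Omega> (\<lambda>x. tensor_apply C (strain \<Omega> u x - T (\<phi> x))) (strain \<Omega> \<eta>)
           - l2_inner \<Omega> (\<lambda>x. \<alpha> * M * (\<theta> x - \<alpha> * dvg \<Omega> u x)) (dvg \<Omega> \<eta>)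
           - l2_inner \<Omega> f \<eta> = 0) \<and>
        (\<forall>\<eta>\<in>Vf.
           l2_inner \<Omega> (\<lambda>x. \<theta> x - \<theta>_old x) \<eta>
           + \<tau> * l2_inner \<Omega> (\<lambda>x. \<kappa> *\<^sub>R grad \<Omega> p x) (grad \<Omega> \<eta>)
           - \<tau> * l2_inner \<Omega> Sf \<eta> = 0) \<and>
        (\<forall>\<eta>\<in>Vf.
           l2_inner \<Omega> p \<eta>
           - l2_inner \<Omega> (\<lambda>x. M * (\<theta> x - \<alpha> * dvg \<Omega> u x)) \<eta> = 0))"
proof -
  have bd: "bounded_domain \<Omega>"
    using domain by (simp add: bounded_domain_def lipschitz_domain_def)
  then interpret bounded_domain \<Omega> .
  obtain LT where LT: "LT-lipschitz_on UNIV T" using A4(2) by blast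
  obtain L\<Psi> where L\<Psi>: "L\<Psi>-lipschitz_on UNIV (deriv \<Psi>c)" using A1(7) by blast
  have mat: "material \<Omega> LT L\<Psi> C T \<Psi>c"
    using bd A3(1) LT A4(3) A1(5) L\<Psi> by (simp add: material_def material_axioms_def)
  have ch: "fe_step \<Omega> Vch m \<phi>_old R \<tau>"
    using bd spaces(1) A2(1) previous(1) A5(1) step
    by (simp add: fe_step_def fe_step_axioms_def fe_space_def fe_space_axioms_def)
  have flow: "fe_step \<Omega> Vf \<kappa> \<theta>_old Sf \<tau>"
    using bd spaces(3) A2(2) previous(3) A5(2) step
    by (simp add: fe_step_def fe_step_axioms_def fe_space_def fe_space_axioms_def)
  have \<phi>_old_L2: "\<phi>_old \<in> L2 \<Omega>"
    using spaces(1) previous(1) by (auto simp: conforming_H1_def H1_def)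
  \<comment> \<open>Nonnegativity of \<Psi> gives \<Psi>e \<le> \<Psi>c, and \<Psi>c grows at most
    quadratically. A convex function with a quadratic upper bound has a derivative of linear
    growth.\<close>
  have \<Psi>e'_L2: "(\<lambda>x. deriv \<Psi>e (\<phi>_old x)) \<in> L2 \<Omega>"
  proof -
    \<comment> \<open>The sum of the coefficients of the constant, linear and quadratic terms in the
      bound on \<Psi>c; each power is at most the square of 1 + \<bar>s\<bar>.\<close>
    let ?a = "\<bar>\<Psi>c 0\<bar> + \<bar>deriv \<Psi>c 0\<bar> + L\<Psi>"
    have L0: "L\<Psi> \<ge> 0" using lipschitz_on_nonneg[OF L\<Psi>] .
    have "\<Psi>e s \<le> ?a * (1 + \<bar>s\<bar>)\<^sup>2" for s
    proof -
      have "\<Psi>e s \<le> \<Psi>c s" using A1(1,2)[of s] by simp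
      also have "\<dots> \<le> \<bar>\<Psi>c 0\<bar> + \<bar>s\<bar> * (\<bar>deriv \<Psi>c 0\<bar> + L\<Psi> * \<bar>s\<bar>)"
        using material.\<Psi>c_increment[OF mat, of 0 s] by simp
      also have "\<dots> \<le> \<bar>\<Psi>c 0\<bar> * (1 + \<bar>s\<bar>)\<^sup>2 + \<bar>deriv \<Psi>c 0\<bar> * (1 + \<bar>s\<bar>)\<^sup>2 + L\<Psi> * (1 + \<bar>s\<bar>)\<^sup>2"
      proof -
        have "1 \<le> (1 + \<bar>s\<bar>)\<^sup>2" "\<bar>s\<bar> \<le> (1 + \<bar>s\<bar>)\<^sup>2" "\<bar>s\<bar> * \<bar>s\<bar> \<le> (1 + \<bar>s\<bar>)\<^sup>2"
          by (simp_all add: power2_eq_square distrib_left distrib_right)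
        then have "\<bar>\<Psi>c 0\<bar> * 1 \<le> \<bar>\<Psi>c 0\<bar> * (1 + \<bar>s\<bar>)\<^sup>2" "\<bar>deriv \<Psi>c 0\<bar> * \<bar>s\<bar> \<le> \<bar>deriv \<Psi>c 0\<bar> * (1 + \<bar>s\<bar>)\<^sup>2"
          "L\<Psi> * (\<bar>s\<bar> * \<bar>s\<bar>) \<le> L\<Psi> * (1 + \<bar>s\<bar>)\<^sup>2"
          using L0 by (intro mult_left_mono; simp)+
        moreover have "\<bar>s\<bar> * (\<bar>deriv \<Psi>c 0\<bar> + L\<Psi> * \<bar>s\<bar>) = \<bar>deriv \<Psi>c 0\<bar> * \<bar>s\<bar> + L\<Psi> * (\<bar>s\<bar> * \<bar>s\<bar>)"
          by (simp only: distrib_left mult_ac)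
        ultimately show ?thesis by linarith
      qed
      finally show ?thesis by (simp only: distrib_right)
    qed
    from convex_deriv_linear_growth[OF A1(4,6) this] L0
    have growth: "\<bar>deriv \<Psi>e s\<bar> \<le> (4 * ?a + \<bar>\<Psi>e 0\<bar> + \<bar>deriv \<Psi>e 0\<bar>) * (1 + \<bar>s\<bar>)" for s by simp
    have "(\<lambda>x. deriv \<Psi>e (\<phi>_old x)) \<in> borel_measurable \<L>"
    proof (rule measurable_compose[OF L2_measurable[OF \<phi>_old_L2]])
      have "deriv \<Psi>e s = vector_derivative \<Psi>e (at s)" for s
        using A1(6)[of s] by (metis DERIV_imp_deriv has_real_derivative_iff_has_vector_derivative vector_derivative_works)
      with vector_derivative_measurable[OF A1(6)] show "deriv \<Psi>e \<in> borel_measurable borel"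
        by presburger
    qed
    then show ?thesis
    proof (rule L2_affine_bound[OF _ \<phi>_old_L2])
      let ?K = "4 * ?a + \<bar>\<Psi>e 0\<bar> + \<bar>deriv \<Psi>e 0\<bar>"
      show "norm (deriv \<Psi>e (\<phi>_old x)) \<le> ?K + ?K * norm (\<phi>_old x)" for x
        using growth[of "\<phi>_old x"] by (simp only: real_norm_def distrib_left mult_1_right)
    qed
  qed
  interpret coupled_step \<Omega> \<gamma> ell M \<alpha> LT L\<Psi> C T \<Psi>c Vch m \<phi>_old R \<tau> Vf \<kappa> \<theta>_old Sf Vu f \<Psi>e
    using mat ch flow spaces(2) A5(3) \<Psi>e'_L2 energy_convex
    by (simp add: coupled_step_def coupled_step_axioms_def)
  \<comment> \<open>\<open>var_\<phi>\<close> is subtracted as a whole, while the statement adds the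
    coupling term separately; the last two rewrite rules bring both to the form a + c - b.\<close>
  show ?thesis
    using minimizer_iff_discrete_solution[of \<phi> u \<theta>]
    unfolding ch.evolution_def flow.evolution_def var_\<phi>_def var_u_def var_\<theta>_def diff_diff_eq2 diff_add_eq .
qed

end
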